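(* Let $G$ be a 2-connected graph on $n$ vertices with $\delta(G)\geq k$, and let $C$ be a longest cycle in $G$, of length $c\in[10,n-1]$. If $e(G)>\max\{f(n,k+1,c),f(n,\lfloor c/2\rfloor,c)\}$, then the $C$-closure $\overline{G}$ of $G$ is isomorphic to $W_{n,k,c}$ or to $Z_{n,k,c}$.
   Context: Graphs are simple and finite. The $m$-closure of a graph is obtained by recursively joining pairs of nonadjacent vertices whose degree sum (in the current graph) is at least $m$ until no such pair remains. For a cycle $C$ of length $c$ in $G$, the $C$-closure $\overline{G}$ is obtained from $G$ by replacing $G[V(C)]$ by its $(c+1)$-closure. $W_{n,k,c}$: a clique $K_{c-k+1}$ plus $n-(c-k+1)$ new vertices each joined exactly to the same $k$ vertices of the clique. $f(n,k,c)=\binom{c-k+1}{2}+k(n-c+k-1)$. $Z_{n,k,c}$: union of a clique $K_{c-k+1}$ and $\frac{n-(c-k+1)}{k-1}$ cliques $K_{k+1}$ such that any two of these cliques share exactly the same two vertices. *)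

theory Defs
  imports Complex_Main
begin

record 'a ugraph =
  verts :: "'a set"
  edges :: "'a set set"

definition all_pairs :: "'a set \<Rightarrow> 'a set set" where
  "all_pairs S = {e. e \<subseteq> S \<and> card e = 2}"

definition simple_graph :: "'a ugraph \<Rightarrow> bool" where
  "simple_graph G \<longleftrightarrow> finite (verts G) \<and> edges G \<subseteq> all_pairs (verts G)"

definition degree :: "'a ugraph \<Rightarrow> 'a \<Rightarrow> nat" where
  "degree G v = card {e \<in> edges G. v \<in> e}"

definition min_degree :: "'a ugraph \<Rightarrow> nat" where
  "min_degree G = Min (degree G ` verts G)"

definition induced :: "'a ugraph \<Rightarrow> 'a set \<Rightarrow> 'a ugraph" where
  "induced G S = \<lparr>verts = verts G \<inter> S, edges = {e \<in> edges G. e \<subseteq> S}\<rparr>"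

definition graph_connected :: "'a ugraph \<Rightarrow> bool" where
  "graph_connected G \<longleftrightarrow> verts G \<noteq> {} \<and>
     (\<forall>u \<in> verts G. \<forall>v \<in> verts G. (u, v) \<in> {(x, y). {x, y} \<in> edges G}\<^sup>*)"

definition two_connected :: "'a ugraph \<Rightarrow> bool" where
  "two_connected G \<longleftrightarrow> card (verts G) > 2 \<and>
     (\<forall>X \<subseteq> verts G. card X < 2 \<longrightarrow> graph_connected (induced G (verts G - X)))"

definition graph_iso :: "'a ugraph \<Rightarrow> 'b ugraph \<Rightarrow> bool" where
  "graph_iso G H \<longleftrightarrow> (\<exists>\<phi>. bij_betw \<phi> (verts G) (verts H) \<and>
     (\<forall>u \<in> verts G. \<forall>v \<in> verts G. {u, v} \<in> edges G \<longleftrightarrow> {\<phi> u, \<phi> v} \<in> edges H))"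

text \<open>A cycle is given by the list of its vertices in cyclic order, so its length is the length
  of the list and its vertex set is the set of the list.\<close>

definition is_cycle :: "'a ugraph \<Rightarrow> 'a list \<Rightarrow> bool" where
  "is_cycle G C \<longleftrightarrow> length C \<ge> 3 \<and> distinct C \<and> set C \<subseteq> verts G \<and>
     (\<forall>i < length C. {C ! i, C ! (Suc i mod length C)} \<in> edges G)"

definition longest_cycle :: "'a ugraph \<Rightarrow> 'a list \<Rightarrow> bool" where
  "longest_cycle G C \<longleftrightarrow> is_cycle G C \<and> (\<forall>D. is_cycle G D \<longrightarrow> length D \<le> length C)"

definition closure_step :: "nat \<Rightarrow> 'a ugraph \<Rightarrow> 'a ugraph \<Rightarrow> bool" where
  "closure_step m G H \<longleftrightarrow> (\<exists>u \<in> verts G. \<exists>v \<in> verts G. u \<noteq> v \<and> {u, v} \<notin> edges G \<and>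
     degree G u + degree G v \<ge> m \<and> H = G\<lparr>edges := insert {u, v} (edges G)\<rparr>)"

definition is_closure :: "nat \<Rightarrow> 'a ugraph \<Rightarrow> 'a ugraph \<Rightarrow> bool" where
  "is_closure m G H \<longleftrightarrow> (closure_step m)\<^sup>*\<^sup>* G H \<and> (\<nexists>K. closure_step m H K)"

text \<open>For simple graphs the description is justified by \<open>ex1_closure\<close> below: the process ends, and
  the result does not depend on the order in which the edges are added.\<close>

definition m_closure :: "nat \<Rightarrow> 'a ugraph \<Rightarrow> 'a ugraph" where
  "m_closure m G = (THE H. is_closure m G H)"

definition C_closure :: "'a ugraph \<Rightarrow> 'a list \<Rightarrow> 'a ugraph" where
  "C_closure G C = G\<lparr>edges := (edges G - edges (induced G (set C))) \<union>
     edges (m_closure (length C + 1) (induced G (set C)))\<rparr>"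

text \<open>In the definitions below subtraction is on \<open>nat\<close>; it truncates nothing when \<open>k \<le> c + 1\<close>
  and \<open>c < n\<close>, and the \<open>k\<close> special vertices of \<open>W_graph\<close> lie in the clique when \<open>2 * k \<le> c + 1\<close>.
  A 2-connected graph on \<open>n\<close> vertices with minimum degree at least \<open>k\<close> and circumference \<open>c < n\<close>
  satisfies \<open>2 * k \<le> c\<close> by Dirac's theorem.\<close>

definition f_edges :: "nat \<Rightarrow> nat \<Rightarrow> nat \<Rightarrow> nat" where
  "f_edges n k c = ((c + 1 - k) choose 2) + k * (n + k - (c + 1))"

definition W_graph :: "nat \<Rightarrow> nat \<Rightarrow> nat \<Rightarrow> nat ugraph" where
  "W_graph n k c = \<lparr>verts = {..<n},
     edges = all_pairs {..<c + 1 - k} \<union> {{u, v} | u v. u \<in> {..<k} \<and> v \<in> {c + 1 - k..<n}}\<rparr>"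

text \<open>The shared vertices are 0 and 1. If \<open>k - 1\<close> does not divide \<open>n - (c + 1 - k)\<close>, no graph
  \<open>Z\<close> on \<open>n\<close> vertices exists; the graph below then has fewer than \<open>n\<close> vertices and hence is not
  isomorphic to any graph on \<open>n\<close> vertices.\<close>

definition Z_cliques :: "nat \<Rightarrow> nat \<Rightarrow> nat \<Rightarrow> nat set set" where
  "Z_cliques n k c = insert {..<c + 1 - k}
     {{0, 1} \<union> {c + 1 - k + i * (k - 1)..<c + 1 - k + (i + 1) * (k - 1)} | i.
        i < (n - (c + 1 - k)) div (k - 1)}"

definition Z_graph :: "nat \<Rightarrow> nat \<Rightarrow> nat \<Rightarrow> nat ugraph" where
  "Z_graph n k c = \<lparr>verts = \<Union> (Z_cliques n k c), edges = \<Union> (all_pairs ` Z_cliques n k c)\<rparr>"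

lemma simple_graph_induced: "simple_graph G \<Longrightarrow> simple_graph (induced G S)"
  by (auto simp: simple_graph_def induced_def all_pairs_def)

lemma finite_edges: "simple_graph G \<Longrightarrow> finite (edges G)"
  unfolding simple_graph_def all_pairs_def
  by (rule finite_subset[of _ "Pow (verts G)"]) auto

lemma closure_step_simple:
  assumes "closure_step m G H" "simple_graph G"
  shows "simple_graph H \<and> verts H = verts G \<and> edges G \<subset> edges H"
proof -
  obtain u v where uv: "u \<in> verts G" "v \<in> verts G" "u \<noteq> v" "{u, v} \<notin> edges G"
    "H = G\<lparr>edges := insert {u, v} (edges G)\<rparr>"
    using assms(1) unfolding closure_step_def by blast
  then show ?thesis using assms(2) by (auto simp: simple_graph_def all_pairs_def)
qed

lemma closure_steps_simple:
  assumes "(closure_step m)\<^sup>*\<^sup>* G H" "simple_graph G"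
  shows "simple_graph H \<and> verts H = verts G"
  using assms by (induction rule: rtranclp_induct) (auto dest: closure_step_simple)

lemma closure_steps_below:
  assumes "(closure_step m)\<^sup>*\<^sup>* G K" "simple_graph H" "verts H = verts G"
    "edges G \<subseteq> edges H" "\<nexists>L. closure_step m H L"
  shows "verts K = verts G \<and> edges K \<subseteq> edges H"
  using assms(1)
proof (induction rule: rtranclp_induct)
  case base
  then show ?case using assms by simp
next
  case (step K L)
  then obtain u v where uv: "u \<in> verts K" "v \<in> verts K" "u \<noteq> v"
    "degree K u + degree K v \<ge> m" "L = K\<lparr>edges := insert {u, v} (edges K)\<rparr>"
    unfolding closure_step_def by blast
  have "degree K w \<le> degree H w" for w
    unfolding degree_def using step finite_edges[OF assms(2)] by (intro card_mono) auto
  then have "degree H u + degree H v \<ge> m"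
    using uv(4) by (meson add_mono le_trans)
  then have "{u, v} \<in> edges H"
    using assms(3,5) uv(1-3) step.IH unfolding closure_step_def by metis
  then show ?case using uv step.IH by simp
qed

lemma closure_steps_mono:
  "(closure_step m)\<^sup>*\<^sup>* G H \<Longrightarrow> edges G \<subseteq> edges H"
  by (induction rule: rtranclp_induct) (auto simp: closure_step_def)

lemma ex_closure:
  assumes "simple_graph G"
  shows "\<exists>H. is_closure m G H"
  using assms
proof (induction "card (all_pairs (verts G) - edges G)" arbitrary: G rule: less_induct)
  case less
  show ?case
  proof (cases "\<exists>K. closure_step m G K")
    case False
    then show ?thesis unfolding is_closure_def by blast
  next
    case True
    then obtain K where K: "closure_step m G K" by blast
    note s = closure_step_simple[OF K less.prems]
    have "finite (all_pairs (verts G))"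
      using less.prems unfolding simple_graph_def all_pairs_def
      by (auto intro: finite_subset[of _ "Pow (verts G)"])
    moreover have "all_pairs (verts K) - edges K \<subset> all_pairs (verts G) - edges G"
    proof -
      obtain e where "e \<in> edges K" "e \<notin> edges G" using s by blast
      moreover have "e \<in> all_pairs (verts G)"
        using s calculation unfolding simple_graph_def by auto
      ultimately show ?thesis using s by auto
    qed
    ultimately have "card (all_pairs (verts K) - edges K) < card (all_pairs (verts G) - edges G)"
      by (meson finite_Diff psubset_card_mono)
    then obtain H where "is_closure m K H" using less.hyps s by blast
    then have "is_closure m G H"
      using K unfolding is_closure_def by (meson converse_rtranclp_into_rtranclp)
    then show ?thesis by blast
  qed
qed

lemma ex1_closure:
  assumes "simple_graph G"
  shows "\<exists>!H. is_closure m G H"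
proof (rule ex_ex1I[OF ex_closure[OF assms]])
  fix H K :: "'a ugraph"
  assume H: "is_closure m G H" and K: "is_closure m G K"
  have sH: "simple_graph H \<and> verts H = verts G" "simple_graph K \<and> verts K = verts G"
    using H K assms closure_steps_simple unfolding is_closure_def by blast+
  have HK: "(closure_step m)\<^sup>*\<^sup>* G H" "(closure_step m)\<^sup>*\<^sup>* G K"
    "\<nexists>L. closure_step m H L" "\<nexists>L. closure_step m K L"
    using H K unfolding is_closure_def by auto
  have "edges K \<subseteq> edges H"
    using closure_steps_below[OF HK(2) _ _ closure_steps_mono[OF HK(1)] HK(3)] sH by simp
  moreover have "edges H \<subseteq> edges K"
    using closure_steps_below[OF HK(1) _ _ closure_steps_mono[OF HK(2)] HK(4)] sH by simp
  ultimately show "H = K" using sH by (intro ugraph.equality) auto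
qed

lemma is_closure_m_closure: "simple_graph G \<Longrightarrow> is_closure m G (m_closure m G)"
  unfolding m_closure_def by (rule theI') (rule ex1_closure)

end

theory Submission
  imports Defs "HOL-Library.Disjoint_Sets"
begin

text \<open>Enlarge G to an edge-maximal graph F of circumference c. Then nonadjacent vertices are
  joined by a path on more than c vertices, and Kopylov's argument applies: a path on more than
  c vertices in a 2-connected graph gives a cycle that is longer than c or at least as long as the
  sum of the degrees of its ends on the path. So deleting vertices of degree at most \<open>c div 2\<close>
  repeatedly leaves a clique, on \<open>c + 1 - s\<close> vertices say, and deleting vertices of degree at most s
  repeatedly leaves the same clique H. Hence F has at most \<open>f(n, s, c)\<close> edges, and convexity of f
  together with the minimum degree forces \<open>s = k\<close>.

  A path outside H joining two vertices of H has at most \<open>k - 1\<close> inner vertices. Let p be the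
  number of vertices of a longest path P outside H. Adding \<open>k - p\<close> further outside vertices to H
  must not give a graph with a Hamiltonian path between the neighbours of the ends of P, and an
  Ore-type degree sum argument then leaves only two possibilities: \<open>p = 1\<close> and all outside vertices
  have the same k neighbours, or \<open>p = k - 1\<close> and the outside vertices form cliques on \<open>k - 1\<close>
  vertices, all joined to the same two vertices of H.

  The minimum degree of G forces G and F to agree on all edges that meet the outside. So few
  edges of H are missing in G that the closure restores all of them, whence the C-closure of
  G is F.\<close>

section \<open>Paths, cycles and cliques\<close>

definition nbrs :: "'a set set \<Rightarrow> 'a \<Rightarrow> 'a set" where
  "nbrs E v = {w. {v, w} \<in> E}"

definition path_in :: "'a set set \<Rightarrow> 'a list \<Rightarrow> bool" where
  "path_in E xs \<longleftrightarrow> distinct xs \<and> successively (\<lambda>u v. {u, v} \<in> E) xs"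

definition path_between :: "'a set set \<Rightarrow> 'a \<Rightarrow> 'a \<Rightarrow> 'a list \<Rightarrow> bool" where
  "path_between E u v xs \<longleftrightarrow> path_in E xs \<and> xs \<noteq> [] \<and> hd xs = u \<and> last xs = v"

definition cycle_in :: "'a set set \<Rightarrow> 'a list \<Rightarrow> bool" where
  "cycle_in E xs \<longleftrightarrow> path_in E xs \<and> 3 \<le> length xs \<and> {last xs, hd xs} \<in> E"

definition clique :: "'a set set \<Rightarrow> 'a set \<Rightarrow> bool" where
  "clique E S \<longleftrightarrow> all_pairs S \<subseteq> E"

lemma pair_in_all_pairs_iff [simp]: "{u, v} \<in> all_pairs S \<longleftrightarrow> u \<in> S \<and> v \<in> S \<and> u \<noteq> v"
  by (auto simp: all_pairs_def card_insert_if)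

lemma finite_all_pairs: "finite S \<Longrightarrow> finite (all_pairs S)"
  unfolding all_pairs_def by (rule finite_subset[of _ "Pow S"]) auto

lemma card_all_pairs: "finite S \<Longrightarrow> card (all_pairs S) = card S choose 2"
  unfolding all_pairs_def by (rule n_subsets)

lemma all_pairs_mono: "S \<subseteq> T \<Longrightarrow> all_pairs S \<subseteq> all_pairs T"
  by (auto simp: all_pairs_def)

lemma all_pairsE:
  assumes "e \<in> all_pairs S"
  obtains u v where "e = {u, v}" "u \<in> S" "v \<in> S" "u \<noteq> v"
  using assms unfolding all_pairs_def by (auto simp: card_2_iff)

lemma in_nbrs_iff: "w \<in> nbrs E v \<longleftrightarrow> {v, w} \<in> E" and in_nbrs_iff': "w \<in> nbrs E v \<longleftrightarrow> {w, v} \<in> E"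
  by (auto simp: nbrs_def insert_commute)

lemma nbrs_mono: "E \<subseteq> F \<Longrightarrow> nbrs E v \<subseteq> nbrs F v"
  by (auto simp: nbrs_def)

lemma edge_in_all_pairs: "\<lbrakk>{u, v} \<in> E; E \<subseteq> all_pairs V\<rbrakk> \<Longrightarrow> u \<in> V \<and> v \<in> V \<and> u \<noteq> v"
  by (metis pair_in_all_pairs_iff subsetD)

lemma nbrs_subset: "E \<subseteq> all_pairs V \<Longrightarrow> nbrs E v \<subseteq> V - {v}"
  by (auto simp: nbrs_def dest: edge_in_all_pairs)

lemma finite_nbrs: "\<lbrakk>E \<subseteq> all_pairs V; finite V\<rbrakk> \<Longrightarrow> finite (nbrs E v)"
  by (meson finite_Diff finite_subset nbrs_subset)

lemma cliqueD: "\<lbrakk>clique E S; u \<in> S; v \<in> S; u \<noteq> v\<rbrakk> \<Longrightarrow> {u, v} \<in> E"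
  by (meson clique_def pair_in_all_pairs_iff subsetD)

lemma clique_subset: "\<lbrakk>clique E S; T \<subseteq> S\<rbrakk> \<Longrightarrow> clique E T"
  unfolding clique_def using all_pairs_mono by blast

lemma clique_subset_nbrs: "\<lbrakk>clique E S; u \<in> S\<rbrakk> \<Longrightarrow> S - {u} \<subseteq> nbrs E u"
  by (auto simp: in_nbrs_iff dest: cliqueD)

lemma path_in_append:
  "path_in E (xs @ ys) \<longleftrightarrow> path_in E xs \<and> path_in E ys \<and> set xs \<inter> set ys = {} \<and>
     (xs = [] \<or> ys = [] \<or> {last xs, hd ys} \<in> E)"
  by (auto simp: path_in_def successively_append_iff)

lemma path_in_Nil [simp]: "path_in E []" and path_in_single [simp]: "path_in E [x]"
  by (auto simp: path_in_def)

lemma path_in_Cons: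
  "path_in E (x # xs) \<longleftrightarrow> path_in E xs \<and> x \<notin> set xs \<and> (xs = [] \<or> {x, hd xs} \<in> E)"
  using path_in_append[of E "[x]" xs] by auto

lemma path_in_rev [simp]: "path_in E (rev xs) = path_in E xs"
  by (simp add: path_in_def insert_commute)

lemma path_in_distinct: "path_in E xs \<Longrightarrow> distinct xs"
  by (simp add: path_in_def)

lemma path_in_take: "path_in E xs \<Longrightarrow> path_in E (take m xs)"
  and path_in_drop: "path_in E xs \<Longrightarrow> path_in E (drop m xs)"
  by (metis append_take_drop_id path_in_append)+

lemma path_in_transfer:
  assumes "path_in E xs" "\<And>u v. \<lbrakk>u \<in> set xs; v \<in> set xs; {u, v} \<in> E\<rbrakk> \<Longrightarrow> {u, v} \<in> F"
  shows "path_in F xs"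
  using assms successively_mono[of "\<lambda>u v. {u, v} \<in> E" xs "\<lambda>u v. {u, v} \<in> F"]
  unfolding path_in_def by blast

lemma path_in_mono: "\<lbrakk>path_in E xs; E \<subseteq> F\<rbrakk> \<Longrightarrow> path_in F xs"
  by (erule path_in_transfer) blast

lemma cycle_in_mono: "\<lbrakk>cycle_in E xs; E \<subseteq> F\<rbrakk> \<Longrightarrow> cycle_in F xs"
  unfolding cycle_in_def using path_in_mono by blast

lemma path_in_subset:
  assumes "E \<subseteq> all_pairs V" "path_in E xs" "hd xs \<in> V"
  shows "set xs \<subseteq> V"
  using assms(2,3)
proof (induction xs)
  case (Cons x xs)
  then show ?case
    using edge_in_all_pairs[OF _ assms(1), of x "hd xs"]
    by (cases "xs = []") (auto simp: path_in_Cons)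
qed simp

lemma cycle_in_subset:
  assumes "E \<subseteq> all_pairs V" "cycle_in E D"
  shows "set D \<subseteq> V"
  using path_in_subset[OF assms(1), of D] assms(2)
    edge_in_all_pairs[OF _ assms(1), of "last D" "hd D"]
  unfolding cycle_in_def by blast

lemma length_cycle_in: "cycle_in E D \<Longrightarrow> length D = card (set D)"
  by (simp add: cycle_in_def path_in_def distinct_card)

lemma path_between_single [simp]: "path_between E u v [w] \<longleftrightarrow> w = u \<and> w = v"
  by (auto simp: path_between_def)

lemma path_between_rev [simp]: "path_between E u v (rev xs) \<longleftrightarrow> path_between E v u xs"
  by (auto simp: path_between_def hd_rev last_rev)

lemma path_between_ends: "path_between E u v xs \<Longrightarrow> u \<in> set xs \<and> v \<in> set xs"
  unfolding path_between_def using hd_in_set last_in_set by blast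

lemma path_between_mono: "\<lbrakk>path_between E u v xs; E \<subseteq> F\<rbrakk> \<Longrightarrow> path_between F u v xs"
  unfolding path_between_def using path_in_mono by blast

lemma path_between_append:
  assumes "path_between E u v xs" "path_between E v' w ys" "{v, v'} \<in> E" "set xs \<inter> set ys = {}"
  shows "path_between E u w (xs @ ys)"
  using assms by (auto simp: path_between_def path_in_append)

lemma path_between_join:
  assumes "path_between E u v xs" "path_between E v w ys" "set xs \<inter> set ys \<subseteq> {v}"
  shows "path_between E u w (xs @ tl ys)" "set (xs @ tl ys) = set xs \<union> set ys"
proof -
  obtain zs where ys: "ys = v # zs" using assms(2) by (cases ys) (auto simp: path_between_def)
  have "v \<in> set xs" using assms(1) last_in_set unfolding path_between_def by blast
  then show "path_between E u w (xs @ tl ys)" "set (xs @ tl ys) = set xs \<union> set ys"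
    using assms ys by (auto simp: path_between_def path_in_append path_in_Cons)
qed

lemma path_between_prefix:
  assumes "path_between E u v xs" "w \<in> set xs"
  obtains ys zs where "xs = ys @ zs" "path_between E u w ys"
proof -
  obtain ys zs where xs: "xs = (ys @ [w]) @ zs" using assms(2) split_list by fastforce
  have "hd (ys @ [w]) = u" using assms(1) unfolding path_between_def xs by (cases ys) auto
  then have "path_between E u w (ys @ [w])"
    using assms(1) unfolding path_between_def xs path_in_append[of E "ys @ [w]"] by auto
  then show thesis using that xs by blast
qed

lemma clique_path_in:
  assumes "clique E (set xs)" "distinct xs"
  shows "path_in E xs"
  using assms
proof (induction xs)
  case (Cons x xs)
  then have "path_in E xs" using clique_subset[of E "set (x # xs)" "set xs"] by auto
  moreover have "{x, hd xs} \<in> E" if "xs \<noteq> []"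
    using Cons.prems that by (auto intro!: cliqueD[of E "set (x # xs)"])
  ultimately show ?case using Cons.prems by (auto simp: path_in_Cons)
qed simp

lemma clique_hamiltonian_path:
  assumes "clique E S" "finite S" "a \<in> S" "b \<in> S" "a \<noteq> b"
  obtains xs where "path_between E a b xs" "set xs = S"
proof -
  obtain zs where zs: "set zs = S - {a, b}" "distinct zs"
    using assms(2) finite_distinct_list[of "S - {a, b}"] by auto
  have "set (a # zs @ [b]) = S" "distinct (a # zs @ [b])" using zs assms(3-5) by auto
  then show thesis
    using that[of "a # zs @ [b]"] clique_path_in[of E "a # zs @ [b]"] assms(1)
    by (simp add: path_between_def)
qed

lemma cycle_in_of_paths:
  assumes P: "path_between E u v P" and Q: "path_between E u v Q"
    and "set P \<inter> set Q \<subseteq> {u, v}" "w \<in> set P \<union> set Q - {u, v}" "u \<noteq> v"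
  obtains D where "cycle_in E D" "set D = set P \<union> set Q"
proof -
  have "Q \<noteq> []" "tl Q \<noteq> []"
    using Q \<open>u \<noteq> v\<close> by (auto simp: path_between_def) (metis last_ConsL list.collapse)
  then obtain I where I: "Q = u # I @ [v]"
    using Q unfolding path_between_def
    by (metis append_butlast_last_id last_tl list.collapse)
  have uvP: "u \<in> set P" "v \<in> set P" "P \<noteq> []" using P by (auto simp: path_between_def)
  have set: "set (P @ rev I) = set P \<union> set Q" using uvP I by auto
  have "path_in E (P @ rev I)"
    using P Q I assms(3)
    by (auto simp: path_between_def path_in_append path_in_Cons hd_rev insert_commute)
  moreover have "{last (P @ rev I), hd (P @ rev I)} \<in> E"
    using P Q I by (cases I) (auto simp: path_between_def path_in_Cons insert_commute)
  moreover have "card {u, v, w} \<le> card (set (P @ rev I))"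
    using assms(4) uvP set by (intro card_mono) auto
  then have "3 \<le> length (P @ rev I)"
    using assms(4,5) card_length[of "P @ rev I"] by (auto split: if_splits)
  ultimately show thesis using that[of "P @ rev I"] set by (simp add: cycle_in_def)
qed

text \<open>The detour follows \<open>P\<close> back from \<open>w\<close> to \<open>x\<close>, jumps to the first neighbour of \<open>x\<close> behind \<open>w\<close>
  and follows \<open>P\<close> to its end.\<close>

lemma detour_through_end:
  assumes P: "path_between E x p P" and "{x, p} \<in> E" "w \<in> set P" "w \<noteq> p"
  shows "\<exists>Q. path_between E w p Q \<and> set Q \<subseteq> set P \<and> x \<in> set Q \<and> nbrs E x \<inter> set P \<subseteq> set Q"
proof -
  obtain us vs where P1: "P = us @ w # vs" using assms(3) by (meson split_list)
  have "vs \<noteq> []" "last vs = p" using P assms(4) unfolding P1 path_between_def by auto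
  then have "\<exists>s\<in>set vs. {x, s} \<in> E" using assms(2) last_in_set by blast
  then obtain v1 s v2 where s: "vs = v1 @ s # v2" "{x, s} \<in> E" "\<forall>y\<in>set v1. {x, y} \<notin> E"
    using split_list_first_prop[of vs "\<lambda>s. {x, s} \<in> E"] by blast
  have P2: "P = (us @ [w]) @ v1 @ s # v2" using P1 s by simp
  have x: "x = hd (us @ [w])" using P unfolding P1 path_between_def by (cases us) auto
  have "path_between E w p (rev (us @ [w]) @ s # v2)"
    using P s(2) x unfolding P2 path_between_def
    by (auto simp: path_in_append path_in_Cons last_rev hd_rev hd_append insert_commute)
  moreover have "x \<in> set (us @ [w])" using x by (cases us) auto
  moreover have "nbrs E x \<inter> set P \<subseteq> set (us @ [w]) \<union> set (s # v2)"
    using s(3) unfolding P2 by (auto simp: nbrs_def)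
  ultimately show ?thesis unfolding P2 by (intro exI[of _ "rev (us @ [w]) @ s # v2"]) auto
qed

section \<open>Two disjoint paths\<close>

definition biconnected :: "'a set \<Rightarrow> 'a set set \<Rightarrow> bool" where
  "biconnected V E \<longleftrightarrow> 3 \<le> card V \<and> (\<forall>z\<in>V. \<forall>S. S \<subseteq> V - {z} \<and> S \<noteq> {} \<and> S \<noteq> V - {z} \<longrightarrow>
     (\<exists>u\<in>S. \<exists>w\<in>V - {z} - S. {u, w} \<in> E))"

lemma biconnected_mono: "\<lbrakk>biconnected V E; E \<subseteq> F\<rbrakk> \<Longrightarrow> biconnected V F"
  unfolding biconnected_def by (meson subsetD)

lemma biconnected_path_avoiding:
  assumes "biconnected V E" "z \<in> V" "u \<in> V - {z}" "v \<in> V - {z}"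
  shows "\<exists>xs. path_between E u v xs \<and> set xs \<subseteq> V - {z}"
proof -
  define S where "S = {w. \<exists>xs. path_between E u w xs \<and> set xs \<subseteq> V - {z}}"
  have SV: "S \<subseteq> V - {z}" unfolding S_def path_between_def using last_in_set by blast
  have "path_between E u u [u]" by simp
  then have "u \<in> S" unfolding S_def using assms(3) by fastforce
  have "S = V - {z}"
  proof (rule ccontr)
    assume "S \<noteq> V - {z}"
    then obtain a b where ab: "a \<in> S" "b \<in> V - {z} - S" "{a, b} \<in> E"
      using assms(1,2) SV \<open>u \<in> S\<close> unfolding biconnected_def by blast
    then obtain xs where xs: "path_between E u a xs" "set xs \<subseteq> V - {z}" unfolding S_def by blast
    have "b \<notin> set xs"
    proof
      assume "b \<in> set xs"
      then obtain ys zs where "xs = ys @ zs" "path_between E u b ys"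
        using path_between_prefix[OF xs(1)] by blast
      then have "b \<in> S" using xs(2) unfolding S_def by auto
      then show False using ab(2) by blast
    qed
    then have "path_between E u b (xs @ [b])"
      using path_between_append[OF xs(1), of b b "[b]"] ab(3) by simp
    then have "b \<in> S" using xs(2) ab(2) unfolding S_def by fastforce
    then show False using ab(2) by blast
  qed
  then show ?thesis using assms(4) unfolding S_def by blast
qed

definition path_from_to :: "'a set set \<Rightarrow> 'a set \<Rightarrow> 'a set \<Rightarrow> 'a list \<Rightarrow> bool" where
  "path_from_to E S T P \<longleftrightarrow> path_in E P \<and> P \<noteq> [] \<and> set P \<inter> S = {hd P} \<and> set P \<inter> T = {last P}"

lemma biconnected_path_from_to:
  assumes "biconnected V E" "z \<in> V" "S \<subseteq> V - {z}" "T \<subseteq> V - {z}" "S \<noteq> {}" "T \<noteq> {}"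
  shows "\<exists>J. path_from_to E S T J \<and> set J \<subseteq> V - {z}"
proof -
  obtain u t where ut: "u \<in> S" "t \<in> T" using assms by blast
  then obtain xs where xs: "path_between E u t xs" "set xs \<subseteq> V - {z}"
    using biconnected_path_avoiding[OF assms(1,2), of u t] assms(3,4) by blast
  then have "\<exists>x\<in>set xs. x \<in> S" using ut unfolding path_between_def by (meson hd_in_set)
  then obtain ys u' zs where S: "xs = ys @ u' # zs" "u' \<in> S" "\<forall>x\<in>set zs. x \<notin> S"
    using split_list_last_prop[of xs "\<lambda>x. x \<in> S"] by blast
  have "last (u' # zs) = t" using xs(1) unfolding S path_between_def by simp
  then have "\<exists>x\<in>set (u' # zs). x \<in> T" using ut(2) by (metis last_in_set list.distinct(1))
  then obtain ms t' ws where T: "u' # zs = ms @ t' # ws" "t' \<in> T" "\<forall>x\<in>set ms. x \<notin> T"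
    using split_list_first_prop[of "u' # zs" "\<lambda>x. x \<in> T"] by blast
  have xs_eq: "xs = ys @ (ms @ [t']) @ ws" using S(1) T(1) by simp
  have hd: "hd (ms @ [t']) = u'" using T(1) by (cases ms) auto
  have "set (ms @ [t']) \<inter> S = {u'}" using S(2,3) T(1) by (cases ms) auto
  moreover have "path_in E (ms @ [t'])"
    using xs(1) unfolding xs_eq path_between_def path_in_append[of E ys]
      path_in_append[of E "ms @ [t']"] by blast
  ultimately show ?thesis
    using hd T(2,3) xs(2) unfolding xs_eq path_from_to_def by (intro exI[of _ "ms @ [t']"]) auto
qed

definition linked :: "'a set \<Rightarrow> 'a set set \<Rightarrow> 'a set \<Rightarrow> 'a set \<Rightarrow> 'a \<Rightarrow> 'a \<Rightarrow> bool" where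
  "linked V E S T p q \<longleftrightarrow> (\<exists>A B. path_from_to E S T A \<and> path_from_to E S T B \<and>
     set A \<union> set B \<subseteq> V \<and> set A \<inter> set B = {} \<and> p \<in> {hd A, hd B} \<and> q \<in> {last A, last B})"

lemma path_between_splice:
  assumes A: "path_between E a q A" "z \<in> set A" and J: "path_between E z b J"
    and "set A \<inter> set J \<subseteq> {z}"
  obtains A' where "path_between E a b A'" "set A' \<subseteq> set A - {q} \<union> set J"
proof -
  obtain ys zs where A_eq: "A = ys @ zs" and ys: "path_between E a z ys"
    using path_between_prefix[OF A] by blast
  have "set ys \<inter> set J \<subseteq> {z}" using assms(4) A_eq by auto
  note join = path_between_join[OF ys J this]
  have "z \<in> set J" using J hd_in_set unfolding path_between_def by blast
  moreover have "q \<notin> set ys \<or> q = z"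
  proof (cases "zs = []")
    case False
    then have "q \<in> set zs" using A(1) last_in_set[OF False] unfolding A_eq path_between_def by simp
    then show ?thesis using A(1) unfolding A_eq path_between_def path_in_append by blast
  qed (use A(1) ys A_eq in \<open>auto simp: path_between_def\<close>)
  ultimately have "set ys \<subseteq> set A - {q} \<union> set J" using A_eq by auto
  then show thesis using that[OF join(1)] join(2) by blast
qed

lemma path_from_to_between: "path_from_to E S T P \<Longrightarrow> path_between E (hd P) (last P) P"
  by (simp add: path_from_to_def path_between_def)

lemma path_from_toI:
  "\<lbrakk>path_between E u v P; set P \<inter> S = {u}; set P \<inter> T = {v}\<rbrakk> \<Longrightarrow> path_from_to E S T P"
  by (simp add: path_from_to_def path_between_def)

lemma path_from_to_reroute:
  assumes P: "path_from_to E S T' P" "T \<subseteq> T'"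
    and J: "path_between E z b J" "z \<in> set P" "set J \<inter> set P \<subseteq> {z}" "set J \<inter> S \<subseteq> {z}"
      "set J \<inter> T = {b}"
  obtains P' where "path_from_to E S T P'" "hd P' = hd P" "last P' = b"
    "set P' \<subseteq> set P - {last P} \<union> set J"
proof -
  obtain P' where P': "path_between E (hd P) b P'" "set P' \<subseteq> set P - {last P} \<union> set J"
    using path_between_splice[OF path_from_to_between[OF P(1)] J(2,1)] J(3) by blast
  have PS: "set P \<inter> S = {hd P}" and PT: "set P \<inter> T' \<subseteq> {last P}"
    using P(1) by (simp_all add: path_from_to_def)
  then have "set P' \<inter> S \<subseteq> {hd P}" using P'(2) J(2,4) by auto
  moreover have "set P' \<inter> T \<subseteq> {b}" using P'(2) P(2) PT J(5) by blast
  ultimately have "set P' \<inter> S = {hd P}" "set P' \<inter> T = {b}"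
    using path_between_ends[OF P'(1)] PS J(5) by blast+
  with P'(1) have "path_from_to E S T P'" by (rule path_from_toI)
  then show thesis using that P' unfolding path_between_def by blast
qed

lemma path_from_to_snoc:
  assumes "path_from_to E S (insert q T) A" "last A = q" "{q, q'} \<in> E" "q \<notin> T" "q' \<in> T" "S \<inter> T = {}"
  shows "path_from_to E S T (A @ [q'])" "hd (A @ [q']) = hd A"
proof -
  have "set A \<inter> T = {}" using assms(1,2,4) unfolding path_from_to_def by auto
  then show "path_from_to E S T (A @ [q'])" "hd (A @ [q']) = hd A"
    using assms unfolding path_from_to_def by (auto simp: path_in_append)
qed

lemma linked_step_reroute:
  assumes conn: "biconnected V E" and A: "path_from_to E S (insert q T) A" "last A = q" "set A \<subseteq> V"
    and B: "path_from_to E S T B" "last B = q'" "set B \<subseteq> V"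
    and AB: "set A \<inter> set B = {}" "p \<in> {hd A, hd B}"
    and V: "S \<subseteq> V" "T \<subseteq> V" "S \<inter> T = {}"
    and q: "{q, q'} \<in> E" "q \<notin> T" "q' \<in> T" "T \<noteq> {q'}"
  shows "linked V E S T p q'"
proof -
  note Aq' = path_from_to_snoc[OF A(1,2) q(1-3) V(3)]
  have "q \<in> set A" using A unfolding path_from_to_def by auto
  let ?U = "set A \<union> set B \<union> S - {q'}"
  have "?U \<subseteq> V - {q'}" "T - {q'} \<subseteq> V - {q'}" "T - {q'} \<noteq> {}" "q' \<in> V" "q \<in> ?U"
    using A(3) B(3) V q \<open>q \<in> set A\<close> by auto
  then obtain J where J: "path_from_to E ?U (T - {q'}) J" "set J \<subseteq> V - {q'}"
    using biconnected_path_from_to[OF conn, of q' ?U "T - {q'}"] by blast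
  have JU: "set J \<inter> set A \<subseteq> {hd J}" "set J \<inter> set B \<subseteq> {hd J}" "set J \<inter> S \<subseteq> {hd J}"
      "hd J \<in> set A \<union> set B \<union> S"
    and JT: "set J \<inter> T = {last J}" and "q' \<notin> set J"
    using J unfolding path_from_to_def by auto
  note J_between = path_from_to_between[OF J(1)]
  consider (on_A) "hd J \<in> set A" | (on_B) "hd J \<in> set B" | (on_S) "hd J \<in> S" "hd J \<notin> set A \<union> set B"
    using JU(4) by blast
  then show ?thesis
  proof cases
    case on_A
    obtain A' where A': "path_from_to E S T A'" "hd A' = hd A" "set A' \<subseteq> set A - {last A} \<union> set J"
      using path_from_to_reroute[OF A(1) subset_insertI J_between on_A JU(1,3) JT] by blast
    have "set A' \<inter> set B = {}" using A'(3) AB(1) JU(2) on_A by blast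
    moreover have "set A' \<union> set B \<subseteq> V" using A'(3) A(3) B(3) J(2) by blast
    ultimately show ?thesis
      using A' B AB(2) unfolding linked_def by (intro exI[of _ A'] exI[of _ B]) simp
  next
    case on_B
    obtain B' where B': "path_from_to E S T B'" "hd B' = hd B" "set B' \<subseteq> set B - {q'} \<union> set J"
      using path_from_to_reroute[OF B(1) subset_refl J_between on_B JU(2,3) JT] B(2) by blast
    have "set (A @ [q']) \<inter> set B' = {}" using B'(3) AB(1) JU(1) on_B \<open>q' \<notin> set J\<close> by auto
    moreover have "set (A @ [q']) \<union> set B' \<subseteq> V" using B'(3) A(3) B(3) J(2) V(2) q(3) by auto
    ultimately show ?thesis
      using Aq' B' AB(2) unfolding linked_def by (intro exI[of _ "A @ [q']"] exI[of _ B']) simp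
  next
    case on_S
    define D where "D = (if p = hd A then A @ [q'] else B)"
    have D: "path_from_to E S T D" "hd D = p" "last D = q'" "set D \<subseteq> set A \<union> set B \<union> {q'}"
      using Aq' B(1,2) AB(2) unfolding D_def by auto
    moreover have "path_from_to E S T J"
      using J(1) JU(3) JT on_S(1) unfolding path_from_to_def by blast
    moreover have "set D \<inter> set J = {}" using D(4) JU(1,2) on_S(2) \<open>q' \<notin> set J\<close> by blast
    moreover have "set D \<union> set J \<subseteq> V" using D(4) A(3) B(3) J(2) \<open>q' \<in> V\<close> by blast
    ultimately show ?thesis unfolding linked_def by (intro exI[of _ D] exI[of _ J]) simp
  qed
qed

lemma linked_step:
  assumes conn: "biconnected V E" and L: "linked V E S (insert q T) p q"
    and V: "S \<subseteq> V" "T \<subseteq> V" "S \<inter> T = {}"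
    and q: "{q, q'} \<in> E" "q \<notin> T" "q' \<in> T" "T \<noteq> {q'}"
  shows "linked V E S T p q'"
proof -
  obtain A B where A: "path_from_to E S (insert q T) A" "last A = q" "set A \<subseteq> V"
    and B: "path_from_to E S (insert q T) B" "set B \<subseteq> V"
    and AB: "set A \<inter> set B = {}" "p \<in> {hd A, hd B}"
    using L unfolding linked_def by (auto simp: Int_commute)
  have "q \<notin> set B" using A(1,2) AB(1) unfolding path_from_to_def by auto
  then have BT: "path_from_to E S T B" using B(1) unfolding path_from_to_def by auto
  show ?thesis
  proof (cases "last B = q'")
    case True
    then show ?thesis using linked_step_reroute[OF conn A BT _ B(2) AB V q] by blast
  next
    case False
    then have "q' \<notin> set B" using BT q(3) unfolding path_from_to_def by (metis Int_iff singletonD)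
    then show ?thesis
      using path_from_to_snoc[OF A(1,2) q(1-3) V(3)] A(3) BT B(2) AB V(2) q(3) unfolding linked_def
      by (intro exI[of _ "A @ [q']"] exI[of _ B]) auto
  qed
qed

lemma linkedE:
  assumes "linked V E S T p q"
  obtains A B where "path_from_to E S T A" "path_from_to E S T B" "set A \<inter> set B = {}"
    "hd A = p" "q \<in> {last A, last B}"
proof -
  obtain A B where AB: "path_from_to E S T A" "path_from_to E S T B" "set A \<inter> set B = {}"
    "p \<in> {hd A, hd B}" "q \<in> {last A, last B}"
    using assms unfolding linked_def by auto
  show thesis using that[OF AB(1-3)] that[OF AB(2,1)] AB by (cases "p = hd A") auto
qed

lemma linked_along_path:
  assumes conn: "biconnected V E" and P: "path_in E P" "set P \<subseteq> V"
    and "0 < i" "i \<le> j" "Suc j < length P"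
  shows "linked V E (set (take (Suc i) P)) (set (drop j P)) (P ! i) (P ! j)"
  using assms(5,6)
proof (induction j rule: dec_induct)
  case base
  let ?X = "set (take i P)" and ?Y = "set (drop (Suc i) P)"
  have i: "i < length P" using base by simp
  have sets: "set (take (Suc i) P) = insert (P ! i) ?X" "set (drop i P) = insert (P ! i) ?Y"
    using i by (simp_all add: take_Suc_conv_app_nth flip: Cons_nth_drop_Suc)
  have "distinct (take i P @ P ! i # drop (Suc i) P)"
    "set P = set (take i P @ P ! i # drop (Suc i) P)"
    using path_in_distinct[OF P(1)] id_take_nth_drop[OF i] by metis+
  then have XY: "?X \<subseteq> V - {P ! i}" "?Y \<subseteq> V - {P ! i}" "P ! i \<in> V" using P(2) by auto
  moreover have "?X \<noteq> {}" "?Y \<noteq> {}" using \<open>0 < i\<close> base by auto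
  ultimately obtain J where "path_from_to E ?X ?Y J" "set J \<subseteq> V - {P ! i}"
    using biconnected_path_from_to[OF conn] by blast
  then show ?case
    using XY(3) unfolding linked_def sets path_from_to_def
    by (intro exI[of _ "[P ! i]"] exI[of _ J]) auto
next
  case (step j)
  let ?T = "set (drop (Suc j) P)"
  have dist: "distinct P" using P(1) by (rule path_in_distinct)
  have j: "drop j P = P ! j # P ! Suc j # P ! Suc (Suc j) # drop (Suc (Suc (Suc j))) P"
    using step.prems by (simp add: Cons_nth_drop_Suc)
  then have T: "drop (Suc j) P = P ! Suc j # P ! Suc (Suc j) # drop (Suc (Suc (Suc j))) P"
    by (metis drop_Suc list.sel(3) tl_drop)
  have "path_in E (drop j P)" using P(1) by (rule path_in_drop)
  then have q: "{P ! j, P ! Suc j} \<in> E" "P ! j \<notin> ?T" "P ! Suc j \<in> ?T" "?T \<noteq> {P ! Suc j}"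
    unfolding j T by (auto simp: path_in_Cons)
  have "linked V E (set (take (Suc i) P)) (insert (P ! j) ?T) (P ! i) (P ! j)"
    using step.IH step.prems unfolding j T by simp
  moreover have "set (take (Suc i) P) \<subseteq> V" "?T \<subseteq> V"
    using P(2) by (meson set_take_subset set_drop_subset order_trans)+
  moreover have "set (take (Suc i) P) \<inter> ?T = {}"
    using dist step.hyps(1) by (intro set_take_disj_set_drop_if_distinct) simp_all
  ultimately show ?case using linked_step[OF conn] q by blast
qed

section \<open>Long cycles from long paths\<close>

lemma cycle_in_of_linking:
  assumes A: "path_from_to E S T A" and B: "path_from_to E S T B" and disj: "set A \<inter> set B = {}"
    and Q1: "path_between E (hd B) (hd A) Q1" "set Q1 \<subseteq> S"
    and Q2: "path_between E (last A) (last B) Q2" "set Q2 \<subseteq> T"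
    and ST: "S \<inter> T \<subseteq> {hd A} \<inter> {last A}"
  obtains D where "cycle_in E D" "set Q1 \<union> set Q2 \<subseteq> set D"
proof -
  have AS: "set A \<inter> S = {hd A}" "set A \<inter> T = {last A}"
    and BS: "set B \<inter> S = {hd B}" "set B \<inter> T = {last B}"
    using A B by (simp_all add: path_from_to_def)
  have ends: "hd A \<noteq> hd B" "hd A \<noteq> last B" "last B \<in> T" "hd B \<in> S" using AS BS disj by auto
  have "set Q1 \<inter> set A \<subseteq> {hd A}" using AS(1) Q1(2) by blast
  note QA = path_between_join[OF Q1(1) path_from_to_between[OF A] this]
  have "set (Q1 @ tl A) \<inter> set Q2 \<subseteq> {last A}" using AS(2) ST Q1(2) Q2(2) QA(2) by blast
  note QAQ = path_between_join[OF QA(1) Q2(1) this]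
  have "set Q1 \<inter> set B \<subseteq> {hd B}" "set Q2 \<inter> set B \<subseteq> {last B}" using BS Q1(2) Q2(2) by blast+
  then have "set ((Q1 @ tl A) @ tl Q2) \<inter> set B \<subseteq> {hd B, last B}"
    using disj unfolding QAQ(2) QA(2) by blast
  moreover have "hd A \<in> set ((Q1 @ tl A) @ tl Q2) \<union> set B - {hd B, last B}"
    using path_between_ends[OF Q1(1)] ends(1,2) unfolding QAQ(2) QA(2) by auto
  moreover have "hd B \<noteq> last B" using ST ends by auto
  ultimately obtain D where "cycle_in E D" "set D = set ((Q1 @ tl A) @ tl Q2) \<union> set B"
    using cycle_in_of_paths[OF QAQ(1) path_from_to_between[OF B]] by blast
  then show thesis using that[of D] QAQ(2) QA(2) by blast
qed

lemma set_take_inter_set_drop: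
  assumes "distinct P" "i \<le> j" "j < length P"
  shows "set (take (Suc i) P) \<inter> set (drop j P) \<subseteq> {P ! i} \<inter> {P ! j}"
proof (cases "i = j")
  case True
  have "set (take i P) \<inter> set (drop i P) = {}"
    using assms(1) by (intro set_take_disj_set_drop_if_distinct) auto
  then show ?thesis using True assms(3) by (auto simp: take_Suc_conv_app_nth)
next
  case False
  then show ?thesis using set_take_disj_set_drop_if_distinct[of P "Suc i" j] assms by simp
qed

lemma noncrossing_cycle:
  assumes conn: "biconnected V E" and P: "path_in E P" "set P \<subseteq> V"
    and ij: "0 < i" "i \<le> j" "Suc j < length P"
    and chords: "{hd P, P ! i} \<in> E" "{last P, P ! j} \<in> E"
  obtains D where "cycle_in E D"
    "insert (hd P) (nbrs E (hd P) \<inter> set (take (Suc i) P)) \<subseteq> set D"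
    "insert (last P) (nbrs E (last P) \<inter> set (drop j P)) \<subseteq> set D"
proof -
  define x y S T where "x = hd P" and "y = last P"
    and "S = set (take (Suc i) P)" and "T = set (drop j P)"
  obtain A B where A: "path_from_to E S T A" and B: "path_from_to E S T B"
    and AB: "set A \<inter> set B = {}" "hd A = P ! i" "P ! j \<in> {last A, last B}"
    using linkedE[OF linked_along_path[OF conn P ij]] unfolding S_def T_def by metis
  have ends: "hd A \<in> S" "hd B \<in> S" "last A \<in> T" "last B \<in> T" "hd A \<noteq> hd B" "last A \<noteq> last B"
    using A B AB(1) unfolding path_from_to_def by auto
  have left: "path_between E x (P ! i) (take (Suc i) P)"
    using path_in_take[OF P(1), of "Suc i"] ij last_snoc[of "take i P" "P ! i"]
    unfolding x_def path_between_def by (auto simp: hd_take simp flip: take_Suc_conv_app_nth)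
  have right: "path_between E y (P ! j) (rev (drop j P))"
    using path_in_drop[OF P(1)] ij unfolding y_def path_between_def
    by (auto simp: hd_rev last_rev hd_drop_conv_nth)
  have ST: "S \<inter> T \<subseteq> {hd A} \<inter> {last A}"
  proof -
    have "S \<inter> T \<subseteq> {hd A}"
      using set_take_inter_set_drop[OF path_in_distinct[OF P(1)] ij(2)] ij(3) AB(2)
      unfolding S_def T_def by auto
    then show ?thesis using A unfolding path_from_to_def by blast
  qed
  obtain Q1 where Q1: "path_between E (hd B) (hd A) Q1" "set Q1 \<subseteq> S"
    "insert x (nbrs E x \<inter> S) \<subseteq> set Q1"
    using detour_through_end[OF left, of "hd B"] chords(1) ends AB(2) unfolding S_def x_def by auto
  have detour: "\<exists>Q. path_between E w (P ! j) Q \<and> set Q \<subseteq> T \<and> insert y (nbrs E y \<inter> T) \<subseteq> set Q"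
    if "w \<in> T" "w \<noteq> P ! j" for w
    using detour_through_end[OF right, of w] chords(2) that unfolding T_def y_def by auto
  have "\<exists>Q2. path_between E (last A) (last B) Q2 \<and> set Q2 \<subseteq> T \<and> insert y (nbrs E y \<inter> T) \<subseteq> set Q2"
  proof (cases "P ! j = last B")
    case True
    then show ?thesis using detour[OF ends(3)] ends(6) by auto
  next
    case False
    then show ?thesis
      using detour[OF ends(4)] AB(3) by (metis empty_iff insert_iff path_between_rev set_rev)
  qed
  then obtain Q2 where Q2: "path_between E (last A) (last B) Q2" "set Q2 \<subseteq> T"
    "insert y (nbrs E y \<inter> T) \<subseteq> set Q2" by blast
  obtain D where "cycle_in E D" "set Q1 \<union> set Q2 \<subseteq> set D"
    using cycle_in_of_linking[OF A B AB(1) Q1(1,2) Q2(1,2) ST] .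
  then show thesis using that[of D] Q1(3) Q2(3) unfolding x_def y_def S_def T_def by blast
qed

lemma last_nbr_index:
  assumes "nbrs E x \<inter> set P \<noteq> {}"
  obtains i where "i < length P" "{x, P ! i} \<in> E" "nbrs E x \<inter> set P \<subseteq> set (take (Suc i) P)"
proof -
  obtain ys z zs where "P = ys @ z # zs" "{x, z} \<in> E" "\<forall>w\<in>set zs. {x, w} \<notin> E"
    using assms split_list_last_prop[of P "\<lambda>w. {x, w} \<in> E"] by (auto simp: nbrs_def)
  then show thesis using that[of "length ys"] by (auto simp: nbrs_def)
qed

lemma first_nbr_index:
  assumes "nbrs E x \<inter> set P \<noteq> {}"
  obtains i where "i < length P" "{x, P ! i} \<in> E" "nbrs E x \<inter> set P \<subseteq> set (drop i P)"
proof -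
  obtain ys z zs where "P = ys @ z # zs" "{x, z} \<in> E" "\<forall>w\<in>set ys. {x, w} \<notin> E"
    using assms split_list_first_prop[of P "\<lambda>w. {x, w} \<in> E"] by (auto simp: nbrs_def)
  then show thesis using that[of "length ys"] by (auto simp: nbrs_def)
qed

lemma card_nbrs_eq_card_indices:
  assumes "distinct P"
  shows "card (nbrs E x \<inter> set P) = card {i. i < length P \<and> {x, P ! i} \<in> E}"
proof -
  have "(!) P ` {i. i < length P \<and> {x, P ! i} \<in> E} = nbrs E x \<inter> set P"
    by (auto simp: nbrs_def in_set_conv_nth)
  moreover have "inj_on ((!) P) {i. i < length P \<and> {x, P ! i} \<in> E}"
    using assms by (auto simp: inj_on_def nth_eq_iff_index_eq)
  from card_image[OF this] have "card ((!) P ` {i. i < length P \<and> {x, P ! i} \<in> E}) =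
    card {i. i < length P \<and> {x, P ! i} \<in> E}" .
  ultimately show ?thesis by simp
qed

lemma noncrossing_long_cycle:
  assumes conn: "biconnected V E" and loopfree: "\<And>v. {v} \<notin> E" and P: "path_in E P" "set P \<subseteq> V"
    and ij: "i \<le> j" "j < length P" "{hd P, P ! i} \<in> E" "{last P, P ! j} \<in> E"
    and nbrs: "nbrs E (hd P) \<inter> set P \<subseteq> set (take (Suc i) P)"
      "nbrs E (last P) \<inter> set P \<subseteq> set (drop j P)"
  obtains D where "cycle_in E D"
    "card (nbrs E (hd P) \<inter> set P) + card (nbrs E (last P) \<inter> set P) \<le> length D"
proof -
  define X Y where "X = nbrs E (hd P) \<inter> set P" and "Y = nbrs E (last P) \<inter> set P"
  have "P \<noteq> []" using ij(2) by auto
  then have ends: "hd P = P ! 0" "last P = P ! (length P - 1)"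
    by (simp_all add: hd_conv_nth last_conv_nth)
  have dist: "distinct P" using P(1) by (rule path_in_distinct)
  have "i \<noteq> 0" using ij(3) loopfree ends(1) by (metis insert_absorb2)
  moreover have "j \<noteq> length P - 1" using ij(4) loopfree ends(2) by (metis insert_absorb2)
  ultimately have ij': "0 < i" "Suc j < length P" using ij(2) by auto
  obtain D where D: "cycle_in E D"
    "insert (hd P) (nbrs E (hd P) \<inter> set (take (Suc i) P)) \<subseteq> set D"
    "insert (last P) (nbrs E (last P) \<inter> set (drop j P)) \<subseteq> set D"
    using noncrossing_cycle[OF conn P ij'(1) ij(1) ij'(2) ij(3,4)] .
  have "insert (hd P) (X \<union> Y) \<subseteq> set D" using D(2,3) nbrs unfolding X_def Y_def by blast
  then have "card (insert (hd P) (X \<union> Y)) \<le> length D"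
    using card_mono[of "set D"] length_cycle_in[OF D(1)] by simp
  moreover have "hd P \<notin> X \<union> Y"
  proof -
    have "hd P \<in> set (take j P)"
      using ij' ij(1) ends(1) by (auto simp: in_set_conv_nth intro!: exI[of _ 0])
    moreover have "set (take j P) \<inter> set (drop j P) = {}"
      using dist by (intro set_take_disj_set_drop_if_distinct) auto
    ultimately show ?thesis using nbrs(2) loopfree unfolding X_def Y_def by (auto simp: nbrs_def)
  qed
  moreover have "X \<inter> Y \<subseteq> {P ! i}"
    using set_take_inter_set_drop[OF dist ij(1,2)] nbrs unfolding X_def Y_def by blast
  then have "card (X \<inter> Y) \<le> 1" using card_mono[of "{P ! i}"] by fastforce
  moreover have "card X + card Y = card (X \<union> Y) + card (X \<inter> Y)"
    unfolding X_def Y_def by (intro card_Un_Int) auto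
  ultimately have "card X + card Y \<le> length D" unfolding X_def Y_def by simp
  then show thesis using that D(1) unfolding X_def Y_def by blast
qed

lemma crossing_cycle:
  assumes P: "path_in E P" and ij: "i < j" "j < length P" "{last P, P ! i} \<in> E" "{hd P, P ! j} \<in> E"
    and long: "3 \<le> Suc i + (length P - j)"
  obtains D where "cycle_in E D" "length D = Suc i + (length P - j)"
proof -
  let ?A = "take (Suc i) P" and ?B = "drop j P"
  have "?A \<noteq> []" "?B \<noteq> []" using ij by auto
  moreover have ends: "hd ?A = hd P" "last ?A = P ! i" "hd ?B = P ! j" "last ?B = last P"
    using ij by (simp_all add: hd_take hd_drop_conv_nth, simp add: take_Suc_conv_app_nth)
  moreover have "set ?A \<inter> set ?B = {}"
    using path_in_distinct[OF P] ij(1) by (intro set_take_disj_set_drop_if_distinct) auto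
  ultimately have "path_in E (?A @ rev ?B)"
    using path_in_take[OF P, of "Suc i"] path_in_drop[OF P, of j] ij(3)
    unfolding path_in_append by (simp add: hd_rev insert_commute)
  then have "cycle_in E (?A @ rev ?B)"
    using ends ij \<open>?A \<noteq> []\<close> \<open>?B \<noteq> []\<close> long unfolding cycle_in_def
    by (auto simp: last_rev insert_commute)
  moreover have "length (?A @ rev ?B) = Suc i + (length P - j)" using ij by simp
  ultimately show thesis using that by blast
qed

text \<open>Nothing of \<open>X\<close> or \<open>Y\<close> lies strictly between \<open>i\<close> and \<open>j\<close>, and \<open>Y\<close> is disjoint from the
  predecessors of \<open>X\<close> unless \<open>j = Suc i\<close>.\<close>

lemma closest_pair_card_bound:
  fixes i j m :: nat
  assumes XY: "X \<subseteq> {0<..<m}" "Y \<subseteq> {..<m - 1}" and ij: "i \<in> Y" "j \<in> X" "i < j"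
    and closest: "\<And>i' j'. \<lbrakk>i' \<in> Y; j' \<in> X; i' < j'\<rbrakk> \<Longrightarrow> j - i \<le> j' - i'"
  shows "min m (card X + card Y) \<le> Suc i + (m - j)"
proof (cases "j = Suc i")
  case False
  define X' where "X' = (\<lambda>l. l - 1) ` X"
  have fin: "finite X" "finite Y" using XY finite_subset by blast+
  have "inj_on (\<lambda>l. l - 1) {0<..<m}" by (auto simp: inj_on_def)
  then have "inj_on (\<lambda>l. l - 1) X" using XY(1) by (rule inj_on_subset)
  then have X': "card X' = card X" "finite X'"
    unfolding X'_def using fin by (simp_all add: card_image)
  have "X' \<inter> Y = {}"
  proof (rule ccontr)
    assume "X' \<inter> Y \<noteq> {}"
    then obtain l where "l \<in> X" "l - 1 \<in> Y" unfolding X'_def by auto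
    moreover from this have "0 < l" using XY(1) by auto
    ultimately show False using closest[of "l - 1" l] False ij(3) by auto
  qed
  have outside: "l \<le> i \<or> j \<le> l" if "l \<in> X \<union> Y" for l
    using that closest[of i l] closest[of l j] ij by fastforce
  have "insert (m - 1) (X' - {j - 1} \<union> Y) \<subseteq> {..i} \<union> {j..<m}"
  proof -
    have "l - 1 \<in> {..i} \<union> {j..<m}" if "l \<in> X" "l - 1 \<noteq> j - 1" for l
      using outside[of l] that subsetD[OF XY(1) that(1)] by auto
    moreover have "Y \<subseteq> {..i} \<union> {j..<m}" using outside XY(2) by fastforce
    moreover have "m - 1 \<in> {j..<m}" using subsetD[OF XY(1) ij(2)] by auto
    ultimately show ?thesis unfolding X'_def by blast
  qed
  then have "card (insert (m - 1) (X' - {j - 1} \<union> Y)) \<le> card ({..i} \<union> {j..<m})"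
    by (intro card_mono) auto
  also have "card ({..i} \<union> {j..<m}) = Suc i + (m - j)"
    using ij(3) by (subst card_Un_disjoint) auto
  also have "card (insert (m - 1) (X' - {j - 1} \<union> Y)) = Suc (card (X' - {j - 1}) + card Y)"
  proof -
    have "m - 1 \<notin> X' \<union> Y" using XY unfolding X'_def by force
    moreover have "card (X' - {j - 1} \<union> Y) = card (X' - {j - 1}) + card Y"
      using fin X' \<open>X' \<inter> Y = {}\<close> by (intro card_Un_disjoint) auto
    ultimately show ?thesis using fin X' by simp
  qed
  finally show ?thesis using X' by (simp add: card_Diff_singleton_if split: if_splits)
qed (use XY ij in auto)

theorem long_cycle_of_path:
  assumes conn: "biconnected V E" and loopfree: "\<And>v. {v} \<notin> E"
    and P: "path_in E P" "set P \<subseteq> V" "3 \<le> length P"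
    and deg: "2 \<le> card (nbrs E (hd P) \<inter> set P)" "2 \<le> card (nbrs E (last P) \<inter> set P)"
  obtains D where "cycle_in E D"
    "min (length P) (card (nbrs E (hd P) \<inter> set P) + card (nbrs E (last P) \<inter> set P)) \<le> length D"
proof -
  define X Y where "X = {i. i < length P \<and> {hd P, P ! i} \<in> E}"
    and "Y = {i. i < length P \<and> {last P, P ! i} \<in> E}"
  have cards: "card (nbrs E (hd P) \<inter> set P) = card X" "card (nbrs E (last P) \<inter> set P) = card Y"
    unfolding X_def Y_def using card_nbrs_eq_card_indices[OF path_in_distinct[OF P(1)]] by simp_all
  have "nbrs E (hd P) \<inter> set P \<noteq> {}" "nbrs E (last P) \<inter> set P \<noteq> {}" using deg by force+
  then obtain i j where i: "i \<in> X" "nbrs E (hd P) \<inter> set P \<subseteq> set (take (Suc i) P)"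
    and j: "j \<in> Y" "nbrs E (last P) \<inter> set P \<subseteq> set (drop j P)"
    unfolding X_def Y_def
    by (metis (mono_tags, lifting) last_nbr_index first_nbr_index mem_Collect_eq)
  show thesis
  proof (cases "i \<le> j")
    case True
    then obtain D where "cycle_in E D" "card X + card Y \<le> length D"
      using noncrossing_long_cycle[OF conn loopfree P(1,2) True] i j
      unfolding X_def Y_def cards[unfolded X_def Y_def] by blast
    then show thesis using that cards by simp
  next
    case False
    then obtain a b where ab: "a \<in> Y" "b \<in> X" "a < b"
      and closest: "\<And>a' b'. \<lbrakk>a' \<in> Y; b' \<in> X; a' < b'\<rbrakk> \<Longrightarrow> b - a \<le> b' - a'"
      using ex_has_least_nat[of "\<lambda>(a, b). a \<in> Y \<and> b \<in> X \<and> a < b" "(j, i)" "\<lambda>(a, b). b - a"] i j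
      by auto
    have "P \<noteq> []" using P(3) by auto
    then have "0 \<notin> X" "length P - 1 \<notin> Y"
      using loopfree unfolding X_def Y_def by (auto simp: hd_conv_nth last_conv_nth)
    then have "l \<in> {0<..<length P}" if "l \<in> X" for l
      using that unfolding X_def by (cases l) auto
    moreover have "l \<in> {..<length P - 1}" if "l \<in> Y" for l
      using that \<open>length P - 1 \<notin> Y\<close> unfolding Y_def by (cases "l = length P - 1") auto
    ultimately have "X \<subseteq> {0<..<length P}" "Y \<subseteq> {..<length P - 1}" by blast+
    from closest_pair_card_bound[OF this ab closest]
    have bound: "min (length P) (card X + card Y) \<le> Suc a + (length P - b)" .
    then have "3 \<le> Suc a + (length P - b)" using P(3) deg cards by simp
    then obtain D where "cycle_in E D" "length D = Suc a + (length P - b)"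
      using crossing_cycle[OF P(1) ab(3)] ab unfolding X_def Y_def by blast
    then show thesis using that bound cards by simp
  qed
qed

section \<open>Counting edges by disintegration\<close>

lemma card_edges_remove_vertex:
  assumes "finite S" "v \<in> S"
  shows "card (E \<inter> all_pairs S) \<le> card (E \<inter> all_pairs (S - {v})) + card (nbrs E v \<inter> S)"
proof -
  have "e \<in> E \<inter> all_pairs (S - {v}) \<union> (\<lambda>w. {v, w}) ` (nbrs E v \<inter> S)"
    if "e \<in> E" "e \<in> all_pairs S" for e
  proof -
    from \<open>e \<in> all_pairs S\<close> obtain a b where "e = {a, b}" "a \<in> S" "b \<in> S" "a \<noteq> b"
      by (rule all_pairsE)
    then show ?thesis
      using \<open>e \<in> E\<close> by (cases "v = a"; cases "v = b") (auto simp: nbrs_def insert_commute)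
  qed
  then have "E \<inter> all_pairs S \<subseteq> E \<inter> all_pairs (S - {v}) \<union> (\<lambda>w. {v, w}) ` (nbrs E v \<inter> S)" by blast
  then have "card (E \<inter> all_pairs S) \<le>
      card (E \<inter> all_pairs (S - {v}) \<union> (\<lambda>w. {v, w}) ` (nbrs E v \<inter> S))"
    using assms(1) by (intro card_mono) (auto simp: finite_all_pairs)
  also have "\<dots> \<le> card (E \<inter> all_pairs (S - {v})) + card ((\<lambda>w. {v, w}) ` (nbrs E v \<inter> S))"
    by (rule card_Un_le)
  also have "card ((\<lambda>w. {v, w}) ` (nbrs E v \<inter> S)) \<le> card (nbrs E v \<inter> S)"
    using assms(1) by (intro card_image_le) simp
  finally show ?thesis by simp
qed

lemma card_edges_eliminate:
  assumes "finite S" "T \<subseteq> S" "card T \<le> m" "m \<le> card S"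
    and "\<And>U. \<lbrakk>T \<subset> U; U \<subseteq> S\<rbrakk> \<Longrightarrow> \<exists>v\<in>U - T. card (nbrs E v \<inter> U) \<le> d"
  shows "card (E \<inter> all_pairs S) \<le> (m choose 2) + d * (card S - m)"
  using assms
proof (induction "card S - m" arbitrary: S)
  case 0
  have "card (E \<inter> all_pairs S) \<le> card (all_pairs S)"
    using "0.prems"(1) by (intro card_mono) (auto simp: finite_all_pairs)
  then show ?case using 0 by (simp add: card_all_pairs)
next
  case (Suc l)
  then have "T \<subset> S" by auto
  then obtain v where v: "v \<in> S - T" "card (nbrs E v \<inter> S) \<le> d" using Suc.prems(5) by blast
  have card: "card S = Suc (card (S - {v}))"
    using Suc.prems(1) v(1) by (metis DiffD1 card_Suc_Diff1)
  have "card (E \<inter> all_pairs (S - {v})) \<le> (m choose 2) + d * (card (S - {v}) - m)"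
  proof (rule Suc.hyps(1))
    show "\<exists>v\<in>U - T. card (nbrs E v \<inter> U) \<le> d" if "T \<subset> U" "U \<subseteq> S - {v}" for U
      using Suc.prems(5)[of U] that by blast
  qed (use Suc.hyps(2) Suc.prems v(1) card in auto)
  moreover have "card S - m = Suc (card (S - {v}) - m)" using Suc.hyps(2) card by simp
  ultimately show ?case using card_edges_remove_vertex[of S v E] Suc.prems(1) v by auto
qed

text \<open>This is what Kopylov's disintegration, the repeated deletion of vertices of degree at most
  \<open>d\<close>, leaves of the graph.\<close>

definition core :: "'a set \<Rightarrow> 'a set set \<Rightarrow> nat \<Rightarrow> 'a set" where
  "core V E d = \<Union> {U. U \<subseteq> V \<and> (\<forall>v\<in>U. d < card (nbrs E v \<inter> U))}"

lemma core_subset: "core V E d \<subseteq> V"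
  unfolding core_def by auto

lemma core_greatest: "\<lbrakk>U \<subseteq> V; \<And>v. v \<in> U \<Longrightarrow> d < card (nbrs E v \<inter> U)\<rbrakk> \<Longrightarrow> U \<subseteq> core V E d"
  unfolding core_def by blast

lemma core_degree:
  assumes "finite V" "v \<in> core V E d"
  shows "d < card (nbrs E v \<inter> core V E d)"
proof -
  obtain U where U: "v \<in> U" "U \<subseteq> V" "\<forall>v\<in>U. d < card (nbrs E v \<inter> U)"
    using assms(2) unfolding core_def by blast
  then have "U \<subseteq> core V E d" by (intro core_greatest) auto
  then have "card (nbrs E v \<inter> U) \<le> card (nbrs E v \<inter> core V E d)"
    using finite_subset[OF core_subset assms(1)] by (intro card_mono) auto
  then show ?thesis using U by fastforce
qed

lemma core_eliminate:
  assumes "finite V" "core V E d \<subset> U" "U \<subseteq> V"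
  shows "\<exists>v\<in>U - core V E d. card (nbrs E v \<inter> U) \<le> d"
proof (rule ccontr)
  assume neg: "\<not> ?thesis"
  have "d < card (nbrs E v \<inter> U)" if "v \<in> U" for v
  proof (cases "v \<in> core V E d")
    case True
    have "card (nbrs E v \<inter> core V E d) \<le> card (nbrs E v \<inter> U)"
      using assms finite_subset by (intro card_mono) auto
    then show ?thesis using core_degree[OF assms(1) True] by linarith
  qed (use neg that in force)
  then show False using core_greatest[OF assms(3)] assms(2) by blast
qed

lemma card_edges_le_of_core:
  assumes "finite V" "E \<subseteq> all_pairs V" "card (core V E d) \<le> m" "m \<le> card V"
  shows "card E \<le> (m choose 2) + d * (card V - m)"
proof -
  have "E \<inter> all_pairs V = E" using assms(2) by blast
  then show ?thesis
    using card_edges_eliminate[OF assms(1) core_subset assms(3,4), of E d]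
      core_eliminate[OF assms(1)]
    by simp
qed

lemma of_nat_choose_two: "2 * int (m choose 2) = int m * (int m - 1)"
  by (induction m) (auto simp: numeral_2_eq_2 algebra_simps)

lemma of_nat_f_edges:
  assumes "a \<le> c" "c < n"
  shows "2 * int (f_edges n a c) =
    (int c + 1 - int a) * (int c - int a) + 2 * int a * (int n + int a - int c - 1)"
proof -
  have "int (c + 1 - a) = int c + 1 - int a" "int (n + a - (c + 1)) = int n + int a - int c - 1"
    using assms by auto
  then show ?thesis using of_nat_choose_two[of "c + 1 - a"] by (simp add: f_edges_def)
qed

lemma f_edges_convex:
  assumes "a \<le> s" "s \<le> b" "b \<le> c" "c < n"
  shows "f_edges n s c \<le> max (f_edges n a c) (f_edges n b c)"
proof (rule ccontr)
  assume "\<not> ?thesis"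
  then have less: "f_edges n a c < f_edges n s c" "f_edges n b c < f_edges n s c" by auto
  define F :: "int \<Rightarrow> int" where
    "F x = (int c + 1 - x) * (int c - x) + 2 * x * (int n + x - int c - 1)" for x
  have F: "2 * int (f_edges n x c) = F (int x)" if "x \<le> c" for x
    unfolding F_def by (rule of_nat_f_edges[OF that assms(4)])
  have diff: "F x - F y = (x - y) * (3 * (x + y) + (2 * int n - 4 * int c - 3))" for x y
    unfolding F_def by (simp add: algebra_simps)
  have "0 < F (int s) - F (int a)" "0 < F (int s) - F (int b)"
    using less F[of a] F[of s] F[of b] assms by auto
  moreover have "int a < int s" "int s < int b" using less assms by (auto simp: order_less_le)
  ultimately have "0 < 3 * (int s + int a) + (2 * int n - 4 * int c - 3)"
    "3 * (int s + int b) + (2 * int n - 4 * int c - 3) < 0"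
    unfolding diff by (auto simp: zero_less_mult_iff)
  then show False using \<open>int a < int s\<close> \<open>int s < int b\<close> by (smt (verit))
qed

lemma degenerate_le_f_edges:
  assumes "c < n"
  shows "((c div 2) choose 2) + (c div 2) * (n - c div 2) \<le> f_edges n (c div 2) c"
proof -
  define t where "t = c div 2"
  have t: "t \<le> c" "t \<le> n" "c = 2 * t \<or> c = 2 * t + 1" unfolding t_def using assms by auto
  have "2 * (int (t choose 2) + int t * (int n - int t)) \<le> 2 * int (f_edges n t c)"
    using of_nat_choose_two[of t] of_nat_f_edges[OF t(1) assms] t(3) by (auto simp: algebra_simps)
  then have "int ((t choose 2) + t * (n - t)) \<le> int (f_edges n t c)"
    using t(2) by (simp add: of_nat_diff)
  then show ?thesis unfolding t_def by linarith
qed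

lemma missing_edges_bound:
  assumes "c < n" "k + 1 \<le> c" "f_edges n (k + 1) c < e" "e + d \<le> f_edges n k c"
  shows "d + 3 * k + 2 \<le> c"
proof -
  have "2 * int (f_edges n k c) = 2 * int (f_edges n (k + 1) c) + 4 * int c - 2 * int n - 6 * int k"
    using of_nat_f_edges[of "k + 1" c n] of_nat_f_edges[of k c n] assms(1,2)
    by (simp add: algebra_simps)
  then show ?thesis using assms by linarith
qed

section \<open>Edge-maximal graphs of bounded circumference\<close>

lemma path_in_remove_closing_edge:
  assumes "path_in (insert {hd xs, last xs} E) xs" "3 \<le> length xs"
  shows "path_in E xs"
proof -
  have "xs \<noteq> []" using assms(2) by auto
  then have ends: "hd xs = xs ! 0" "last xs = xs ! (length xs - 1)"
    by (simp_all add: hd_conv_nth last_conv_nth)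
  have "{xs ! i, xs ! Suc i} \<noteq> {hd xs, last xs}" if "Suc i < length xs" for i
  proof -
    have lt: "i < length xs" "0 < length xs" "length xs - 1 < length xs" using that by auto
    show ?thesis
    proof
      assume "{xs ! i, xs ! Suc i} = {hd xs, last xs}"
      then have "xs ! i = xs ! 0 \<and> xs ! Suc i = xs ! (length xs - 1) \<or>
          xs ! i = xs ! (length xs - 1) \<and> xs ! Suc i = xs ! 0"
        by (simp add: ends doubleton_eq_iff)
      then have "i = 0 \<and> Suc i = length xs - 1 \<or> i = length xs - 1 \<and> Suc i = 0"
        using lt that path_in_distinct[OF assms(1)] nth_eq_iff_index_eq by metis
      then show False using assms(2) that by auto
    qed
  qed
  then show ?thesis using assms(1) unfolding path_in_def successively_conv_nth by blast
qed

lemma cycle_in_new_edge: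
  assumes cyc: "cycle_in (insert {u, v} E) D" "\<not> cycle_in E D"
  obtains xs where "path_between E u v xs" "length xs = length D"
proof -
  let ?F = "insert {u, v} E"
  have D: "path_in ?F D" "3 \<le> length D" "{last D, hd D} \<in> ?F"
    using cyc(1) by (auto simp: cycle_in_def)
  have "\<exists>xs. path_in ?F xs \<and> length xs = length D \<and> {hd xs, last xs} = {u, v}"
  proof (cases "{last D, hd D} = {u, v}")
    case True
    then show ?thesis using D(1) by (metis insert_commute)
  next
    case False
    then have "\<not> path_in E D" using D cyc(2) by (auto simp: cycle_in_def)
    then obtain i where i: "Suc i < length D" "{D ! i, D ! Suc i} \<notin> E"
      using path_in_distinct[OF D(1)] by (auto simp: path_in_def successively_conv_nth)
    then have uv: "{D ! i, D ! Suc i} = {u, v}"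
      using D(1) unfolding path_in_def successively_conv_nth by auto
    let ?A = "take (Suc i) D" and ?B = "drop (Suc i) D"
    have ne: "?A \<noteq> []" "?B \<noteq> []" using i by auto
    have ends: "hd ?A = hd D" "last ?A = D ! i" "hd ?B = D ! Suc i" "last ?B = last D"
      using i by (simp_all add: hd_take hd_drop_conv_nth, simp add: take_Suc_conv_app_nth)
    have "path_in ?F (?A @ ?B)" using D(1) by simp
    then have "path_in ?F (?B @ ?A)" using D(3) ends unfolding path_in_append by auto
    moreover have "{hd (?B @ ?A), last (?B @ ?A)} = {u, v}" using uv ends ne by auto
    moreover have "length (?B @ ?A) = length D" by simp
    ultimately show ?thesis by blast
  qed
  then obtain xs where xs: "path_in ?F xs" "length xs = length D" "{hd xs, last xs} = {u, v}"
    by blast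
  then have "path_in E xs" "xs \<noteq> []" using path_in_remove_closing_edge[of xs E] D(2) by auto
  then have "path_between E u v xs \<or> path_between E u v (rev xs)"
    using xs(3) by (auto simp: path_between_def doubleton_eq_iff hd_rev last_rev)
  then show thesis using that[of xs] that[of "rev xs"] xs(2) by auto
qed

lemma ex_longest_distinct_list:
  assumes "finite V" "Q xs" "\<And>xs. Q xs \<Longrightarrow> distinct xs \<and> set xs \<subseteq> V"
  obtains ys where "Q ys" "\<And>zs. Q zs \<Longrightarrow> length zs \<le> length ys"
proof -
  have "length xs \<le> card V" if "Q xs" for xs
    using assms(3)[OF that] assms(1) by (metis card_mono distinct_card)
  then show thesis
    using Lattices_Big.ex_has_greatest_nat[of Q xs length "Suc (card V)"] assms(2) that
    by (auto simp: less_Suc_eq_le)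
qed

lemma biconnected_two_nbrs:
  assumes "biconnected V E" "finite V" "E \<subseteq> all_pairs V" "v \<in> V"
  shows "2 \<le> card (nbrs E v)"
proof (rule ccontr)
  assume "\<not> ?thesis"
  then have "card (nbrs E v) \<le> 1" by simp
  then obtain z0 where z0: "nbrs E v \<subseteq> {z0}"
    using finite_nbrs[OF assms(3,2)]
    by (metis card_le_Suc0_iff_eq One_nat_def empty_subsetI equals0I insertCI subsetI)
  have V3: "3 \<le> card V" using assms(1) by (simp add: biconnected_def)
  have other: "\<exists>x\<in>V. x \<notin> {a, b}" for a b
  proof (rule ccontr)
    assume "\<not> ?thesis"
    then have "card V \<le> card {a, b}" by (intro card_mono) auto
    then show False using V3 by (simp add: card_insert_if split: if_splits)
  qed
  obtain z where z: "z \<in> V - {v}" "nbrs E v \<subseteq> {z}"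
    using z0 nbrs_subset[OF assms(3), of v] other[of v v] by (cases "nbrs E v = {}") auto
  moreover have "{v} \<noteq> V - {z}" using other[of v z] by blast
  ultimately have "\<exists>u\<in>{v}. \<exists>w\<in>V - {z} - {v}. {u, w} \<in> E"
    using assms(1,4) unfolding biconnected_def by blast
  then show False using z(2) by (auto simp: nbrs_def)
qed

locale bounded_circumference =
  fixes V :: "'a set" and E :: "'a set set" and c :: nat
  assumes finite_V: "finite V" and edges_V: "E \<subseteq> all_pairs V" and biconn: "biconnected V E"
    and c_ge_3: "3 \<le> c" and cycle_le: "cycle_in E D \<Longrightarrow> length D \<le> c"
begin

lemma loopfree: "{v} \<notin> E"
  using edges_V pair_in_all_pairs_iff[of v v] by auto

lemmas nbrs_V = nbrs_subset[OF edges_V] and fin_nbrs = finite_nbrs[OF edges_V finite_V]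

lemma clique_card_le:
  assumes "clique E H" "H \<subseteq> V" "3 \<le> card H"
  shows "card H \<le> c"
proof -
  have "finite H" using assms(2) finite_V finite_subset by blast
  then obtain xs where xs: "set xs = H" "distinct xs" using finite_distinct_list by blast
  then have len: "length xs = card H" using distinct_card by metis
  then have "xs \<noteq> []" using assms(3) by auto
  moreover from this have "hd xs \<noteq> last xs"
    using assms(3) xs(2) len by (auto simp: hd_conv_nth last_conv_nth nth_eq_iff_index_eq)
  ultimately have "{last xs, hd xs} \<in> E" using cliqueD[OF assms(1)] xs(1) by force
  then have "cycle_in E xs"
    using clique_path_in[of E xs] assms(1,3) xs len by (simp add: cycle_in_def)
  then show ?thesis using cycle_le len by metis
qed

lemma end_nbrs_on_long_path:
  assumes P: "path_in E P" "c < length P"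
    and inextensible: "\<And>w. \<lbrakk>w \<in> A; path_in E (w # P); {w, last P} \<notin> E\<rbrakk> \<Longrightarrow> False"
  shows "nbrs E (hd P) \<inter> A \<subseteq> set P"
proof
  fix w assume w: "w \<in> nbrs E (hd P) \<inter> A"
  show "w \<in> set P"
  proof (rule ccontr)
    assume "w \<notin> set P"
    then have path: "path_in E (w # P)" using P(1) w by (auto simp: path_in_Cons in_nbrs_iff')
    have "P \<noteq> []" using P(2) by auto
    have "{w, last P} \<notin> E"
    proof
      assume "{w, last P} \<in> E"
      then have "cycle_in E (w # P)"
        using path P(2) \<open>P \<noteq> []\<close> c_ge_3 by (simp add: cycle_in_def insert_commute)
      then show False using cycle_le P(2) by fastforce
    qed
    then show False using inextensible path w by blast
  qed
qed

end

locale edge_maximal = bounded_circumference +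
  assumes maximal: "\<lbrakk>u \<in> V; v \<in> V; u \<noteq> v; {u, v} \<notin> E\<rbrakk> \<Longrightarrow> \<exists>xs. path_between E u v xs \<and> c < length xs"

lemma (in bounded_circumference) ex_edge_maximal: "\<exists>F. E \<subseteq> F \<and> edge_maximal V F c"
proof -
  define \<F> where "\<F> = {F. E \<subseteq> F \<and> F \<subseteq> all_pairs V \<and> (\<forall>D. cycle_in F D \<longrightarrow> length D \<le> c)}"
  have "finite \<F>" unfolding \<F>_def
    using finite_all_pairs[OF finite_V] by (auto intro: finite_subset[of _ "Pow (all_pairs V)"])
  moreover have "E \<in> \<F>" unfolding \<F>_def using edges_V cycle_le by auto
  ultimately obtain F where "F \<in> \<F>" and max: "\<forall>F'\<in>\<F>. F \<subseteq> F' \<longrightarrow> F = F'"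
    using finite_has_maximal2[of \<F> E] by metis
  then have F: "E \<subseteq> F" "F \<subseteq> all_pairs V" "\<And>D. cycle_in F D \<Longrightarrow> length D \<le> c" unfolding \<F>_def by auto
  have "edge_maximal V F c"
  proof
    show "biconnected V F" using biconn F(1) by (rule biconnected_mono)
    fix u v assume uv: "u \<in> V" "v \<in> V" "u \<noteq> v" "{u, v} \<notin> F"
    have "insert {u, v} F \<notin> \<F>" using max uv(4) by blast
    then obtain D where D: "cycle_in (insert {u, v} F) D" "c < length D"
      unfolding \<F>_def using F uv by (auto simp: not_le)
    then have "\<not> cycle_in F D" using F(3) by fastforce
    then show "\<exists>xs. path_between F u v xs \<and> c < length xs"
      using cycle_in_new_edge[OF D(1)] D(2) by metis
  qed (use finite_V c_ge_3 F in auto)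
  then show ?thesis using F(1) by blast
qed

context edge_maximal begin

text \<open>A longest path on more than \<open>c\<close> vertices with nonadjacent ends in the two cores contains all
  neighbours of its ends in these cores.\<close>

lemma core_adjacent:
  assumes "u \<in> core V E a" "v \<in> core V E b" "u \<noteq> v" "c < a + b + 2" "1 \<le> a" "1 \<le> b"
  shows "{u, v} \<in> E"
proof (rule ccontr)
  assume "{u, v} \<notin> E"
  define Q where "Q P \<longleftrightarrow> path_in E P \<and> c < length P \<and> hd P \<in> core V E a \<and> last P \<in> core V E b \<and>
    {hd P, last P} \<notin> E" for P
  have V: "set P \<subseteq> V" if "Q P" for P
    using that path_in_subset[OF edges_V, of P] subsetD[OF core_subset, of "hd P" V E a]
    unfolding Q_def by blast
  obtain xs where "Q xs"
    using maximal[of u v] \<open>{u, v} \<notin> E\<close> assms(1-3) subsetD[OF core_subset]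
    unfolding Q_def path_between_def by metis
  then obtain P where "Q P" and longest: "\<And>P'. Q P' \<Longrightarrow> length P' \<le> length P"
    using ex_longest_distinct_list[OF finite_V, of Q] V path_in_distinct unfolding Q_def by blast
  then have P: "path_in E P" "c < length P" "hd P \<in> core V E a" "last P \<in> core V E b"
    "{hd P, last P} \<notin> E"
    unfolding Q_def by auto
  have "P \<noteq> []" using P(2) by auto
  have "nbrs E (hd P) \<inter> core V E a \<subseteq> set P"
  proof (rule end_nbrs_on_long_path[OF P(1,2)])
    fix w assume "w \<in> core V E a" "path_in E (w # P)" "{w, last P} \<notin> E"
    then have "Q (w # P)" using P \<open>P \<noteq> []\<close> unfolding Q_def by simp
    then show False using longest by fastforce
  qed
  then have "card (nbrs E (hd P) \<inter> core V E a) \<le> card (nbrs E (hd P) \<inter> set P)"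
    by (intro card_mono) auto
  moreover have "nbrs E (hd (rev P)) \<inter> core V E b \<subseteq> set (rev P)"
  proof (rule end_nbrs_on_long_path)
    fix w assume w: "w \<in> core V E b" "path_in E (w # rev P)" "{w, last (rev P)} \<notin> E"
    then have "path_in E (P @ [w])" using path_in_rev[of E "w # rev P"] by simp
    then have "Q (P @ [w])"
      using w P \<open>P \<noteq> []\<close> unfolding Q_def by (simp add: last_rev insert_commute)
    then show False using longest by fastforce
  qed (use P in auto)
  then have "card (nbrs E (last P) \<inter> core V E b) \<le> card (nbrs E (last P) \<inter> set P)"
    by (intro card_mono) (auto simp: hd_rev)
  ultimately have deg: "a + 1 \<le> card (nbrs E (hd P) \<inter> set P)"
    "b + 1 \<le> card (nbrs E (last P) \<inter> set P)"
    using core_degree[OF finite_V P(3)] core_degree[OF finite_V P(4)] by linarith+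
  obtain D where "cycle_in E D"
    "min (length P) (card (nbrs E (hd P) \<inter> set P) + card (nbrs E (last P) \<inter> set P)) \<le> length D"
    using long_cycle_of_path[OF biconn loopfree P(1) V[OF \<open>Q P\<close>]] P(2) c_ge_3 deg assms(5,6) by auto
  then show False using cycle_le[of D] P(2) deg assms(4) by linarith
qed

lemma core_half_clique: "clique E (core V E (c div 2))"
  using core_adjacent[of _ "c div 2" _ "c div 2"] c_ge_3
  unfolding clique_def by (auto elim!: all_pairsE)

lemma core_half_nbrs:
  "v \<in> core V E (c div 2) \<Longrightarrow> nbrs E v \<inter> core V E (c div 2) = core V E (c div 2) - {v}"
  using clique_subset_nbrs[OF core_half_clique] nbrs_V by blast

lemma core_half_card:
  assumes "core V E (c div 2) \<noteq> {}"
  shows "c div 2 + 2 \<le> card (core V E (c div 2))" "card (core V E (c div 2)) \<le> c"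
proof -
  obtain v where v: "v \<in> core V E (c div 2)" using assms by blast
  show "c div 2 + 2 \<le> card (core V E (c div 2))"
    using core_degree[OF finite_V v] core_half_nbrs[OF v] v by simp
  then show "card (core V E (c div 2)) \<le> c"
    using clique_card_le[OF core_half_clique core_subset] c_ge_3 by simp
qed

lemma core_stable:
  assumes nonempty: "core V E (c div 2) \<noteq> {}"
  shows "core V E (c + 1 - card (core V E (c div 2))) = core V E (c div 2)"
proof -
  define t H s where "t = c div 2" and "H = core V E t" and "s = c + 1 - card H"
  have card_H: "t + 2 \<le> card H" "card H \<le> c"
    using core_half_card nonempty unfolding H_def t_def by auto
  then have s: "1 \<le> s" "s \<le> t" unfolding s_def t_def by auto
  have HV: "H \<subseteq> V" "finite H"
    unfolding H_def by (rule core_subset, rule finite_subset[OF core_subset finite_V])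
  have deg: "card (nbrs E v \<inter> H) = card H - 1" if "v \<in> H" for v
    using core_half_nbrs[of v] that unfolding H_def t_def by simp
  have "H \<subseteq> core V E s" using deg card_H s by (intro core_greatest[OF HV(1)]) auto
  have H_core: "H \<subseteq> core V E (card H - 2)" using deg card_H by (intro core_greatest[OF HV(1)]) auto
  have "core V E s \<subseteq> H"
  proof (rule ccontr)
    assume "\<not> ?thesis"
    then obtain u where u: "u \<in> core V E s" "u \<notin> H" by blast
    have "1 \<le> card H - 2" "c < s + (card H - 2) + 2"
      using card_H c_ge_3 unfolding s_def t_def by auto
    then have "{u, v} \<in> E" if "v \<in> H" for v
      using core_adjacent[of u s v "card H - 2"] u that H_core s(1) by blast
    then have nbrs_u: "H \<subseteq> nbrs E u" by (auto simp: nbrs_def)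
    have "insert u H \<subseteq> core V E t"
    proof (rule core_greatest)
      show "insert u H \<subseteq> V" using subsetD[OF core_subset u(1)] HV(1) by blast
      fix v assume v: "v \<in> insert u H"
      have "t < card (nbrs E v \<inter> H)"
      proof (cases "v = u")
        case True
        then have "nbrs E v \<inter> H = H" using nbrs_u by auto
        then show ?thesis using card_H by simp
      qed (use v deg card_H in auto)
      also have "\<dots> \<le> card (nbrs E v \<inter> insert u H)" using fin_nbrs by (intro card_mono) auto
      finally show "t < card (nbrs E v \<inter> insert u H)" .
    qed
    then show False using u(2) unfolding H_def by blast
  qed
  then show ?thesis using \<open>H \<subseteq> core V E s\<close> unfolding s_def H_def t_def by blast
qed

lemma core_half_nonempty:
  assumes "c < card V" "f_edges (card V) (c div 2) c < card E"
  shows "core V E (c div 2) \<noteq> {}"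
proof
  assume "core V E (c div 2) = {}"
  then have "card E \<le> ((c div 2) choose 2) + (c div 2) * (card V - c div 2)"
    using card_edges_le_of_core[OF finite_V edges_V, of "c div 2" "c div 2"] assms(1) by simp
  then show False using degenerate_le_f_edges[OF assms(1)] assms(2) by linarith
qed

lemma card_edges_le_core_half:
  assumes "c < card V" "core V E (c div 2) \<noteq> {}"
  shows "card E \<le> f_edges (card V) (c + 1 - card (core V E (c div 2))) c"
proof -
  define h where "h = card (core V E (c div 2))"
  have h: "1 \<le> h" "h \<le> c" using core_half_card[OF assms(2)] unfolding h_def by auto
  have "card E \<le> (h choose 2) + (c + 1 - h) * (card V - h)"
    using card_edges_le_of_core[OF finite_V edges_V, of "c + 1 - h" h] core_stable[OF assms(2)]
      h assms(1)
    unfolding h_def by simp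
  also have "\<dots> = f_edges (card V) (c + 1 - h) c" using h assms(1) unfolding f_edges_def by simp
  finally show ?thesis unfolding h_def .
qed

lemma min_degree_le_core_half:
  assumes "c < card V" "core V E (c div 2) \<noteq> {}" "\<And>v. v \<in> V \<Longrightarrow> d \<le> card (nbrs E v)"
  shows "d \<le> c + 1 - card (core V E (c div 2))"
proof (rule ccontr)
  assume neg: "\<not> ?thesis"
  have "nbrs E v \<inter> V = nbrs E v" for v using nbrs_V by blast
  then have "V \<subseteq> core V E (c + 1 - card (core V E (c div 2)))"
    using assms(3) neg by (intro core_greatest) fastforce+
  then have "card V \<le> card (core V E (c div 2))"
    using core_stable[OF assms(2)] finite_subset[OF core_subset finite_V] by (metis card_mono)
  then show False using core_half_card(2)[OF assms(2)] assms(1) by simp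
qed

theorem large_clique_of_many_edges:
  assumes c: "c < card V" and deg: "\<And>v. v \<in> V \<Longrightarrow> k \<le> card (nbrs E v)"
    and many: "max (f_edges (card V) (k + 1) c) (f_edges (card V) (c div 2) c) < card E"
  obtains H where "H \<subseteq> V" "clique E H" "card H = c + 1 - k" "2 \<le> k" "k < c div 2"
    "card E \<le> f_edges (card V) k c"
proof -
  have nonempty: "core V E (c div 2) \<noteq> {}" using core_half_nonempty[OF c] many by simp
  define h s where "h = card (core V E (c div 2))" and "s = c + 1 - h"
  have h: "c div 2 + 2 \<le> h" "h \<le> c" using core_half_card[OF nonempty] unfolding h_def by auto
  have edges: "card E \<le> f_edges (card V) s c"
    using card_edges_le_core_half[OF c nonempty] unfolding s_def h_def .
  have low: "d \<le> s" if "\<And>v. v \<in> V \<Longrightarrow> d \<le> card (nbrs E v)" for d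
    using min_degree_le_core_half[OF c nonempty that] unfolding s_def h_def .
  have "s = k"
  proof (rule ccontr)
    assume "s \<noteq> k"
    then have "f_edges (card V) s c \<le>
        max (f_edges (card V) (k + 1) c) (f_edges (card V) (c div 2) c)"
      using low[OF deg] h c unfolding s_def by (intro f_edges_convex) auto
    then show False using edges many by linarith
  qed
  moreover have "2 \<le> s" using low biconnected_two_nbrs[OF biconn finite_V edges_V] by blast
  moreover have "s \<noteq> c div 2" using edges many by auto
  ultimately show thesis
    using that[OF core_subset core_half_clique] edges h unfolding s_def h_def by simp
qed

end

section \<open>Hamiltonian paths in a clique with additional vertices\<close>

definition has_hamilton_path :: "'a set set \<Rightarrow> 'a set \<Rightarrow> 'a \<Rightarrow> 'a \<Rightarrow> bool" where
  "has_hamilton_path E S a b \<longleftrightarrow> (\<exists>xs. path_between E a b xs \<and> set xs = S)"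

lemma has_hamilton_path_commute: "has_hamilton_path E S a b \<longleftrightarrow> has_hamilton_path E S b a"
  unfolding has_hamilton_path_def by (metis path_between_rev set_rev)

lemma has_hamilton_path_mono: "\<lbrakk>has_hamilton_path E S a b; E \<subseteq> F\<rbrakk> \<Longrightarrow> has_hamilton_path F S a b"
  unfolding has_hamilton_path_def using path_between_mono[of E a b _ F] by blast

lemma two_opt:
  assumes dist: "distinct xs" and ij: "i < j" "Suc j < length xs"
    and edges: "\<And>l. \<lbrakk>Suc l < length xs; l \<noteq> i; l \<noteq> j\<rbrakk> \<Longrightarrow> {xs ! l, xs ! Suc l} \<in> E"
    and new: "{xs ! i, xs ! j} \<in> E" "{xs ! Suc i, xs ! Suc j} \<in> E"
  shows "has_hamilton_path E (set xs) (hd xs) (last xs)"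
proof -
  define A M Z where "A = take (Suc i) xs" and "M = take (j - i) (drop (Suc i) xs)"
    and "Z = drop (Suc j) xs"
  have "drop (j - i) (drop (Suc i) xs) = Z" using ij(1) unfolding Z_def by simp
  then have xs: "xs = A @ M @ Z" unfolding A_def M_def by (metis append_take_drop_id)
  have ne: "A \<noteq> []" "M \<noteq> []" "Z \<noteq> []" using ij unfolding A_def M_def Z_def by auto
  have paths: "path_in E A" "path_in E M" "path_in E Z"
    using dist edges ij unfolding path_in_def successively_conv_nth A_def M_def Z_def by auto
  have ends: "hd A = hd xs" "last A = xs ! i" "last Z = last xs" "hd Z = xs ! Suc j"
    using ij unfolding A_def Z_def
    by (simp_all add: hd_take hd_drop_conv_nth, simp add: take_Suc_conv_app_nth)
  have ends_M: "hd M = xs ! Suc i" "last M = xs ! j"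
    using ij ne(2) last_conv_nth[OF ne(2)]
    unfolding M_def by (simp_all add: hd_take hd_drop_conv_nth)
  have disj: "set A \<inter> set M = {}" "set A \<inter> set Z = {}" "set M \<inter> set Z = {}"
    using dist unfolding xs by auto
  have "path_between E (hd xs) (xs ! i) A" "path_between E (xs ! j) (xs ! Suc i) (rev M)"
    "path_between E (xs ! Suc j) (last xs) Z"
    using paths ne ends ends_M unfolding path_between_def by (simp_all add: hd_rev last_rev)
  note parts = this
  have "path_between E (hd xs) (xs ! Suc i) (A @ rev M)"
    using disj by (intro path_between_append[OF parts(1,2) new(1)]) simp
  from path_between_append[OF this parts(3) new(2)]
  have "path_between E (hd xs) (last xs) ((A @ rev M) @ Z)" using disj by auto
  moreover have "set ((A @ rev M) @ Z) = set xs" unfolding xs by auto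
  ultimately show ?thesis unfolding has_hamilton_path_def by blast
qed

text \<open>If \<open>xs ! i\<close> is adjacent to \<open>xs ! l\<close>, then \<open>xs ! Suc i\<close> is not adjacent to \<open>xs ! Suc l\<close>.\<close>

lemma hamilton_path_gap_degree_sum:
  assumes loopfree: "\<And>v. {v} \<notin> E" and dist: "distinct xs" and i: "Suc i < length xs"
    and edges: "\<And>l. \<lbrakk>Suc l < length xs; l \<noteq> i\<rbrakk> \<Longrightarrow> {xs ! l, xs ! Suc l} \<in> E"
    and none: "\<not> has_hamilton_path E (set xs) (hd xs) (last xs)"
  shows "card (nbrs E (xs ! i) \<inter> set xs) + card (nbrs E (xs ! Suc i) \<inter> set xs) \<le> length xs"
proof -
  define m where "m = length xs"
  define L L' where "L = {l. Suc l < m \<and> {xs ! i, xs ! l} \<in> E}"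
    and "L' = {l. Suc l < m \<and> {xs ! Suc i, xs ! Suc l} \<in> E}"
  have fin: "finite L" "finite L'"
    unfolding L_def L'_def by (auto intro: finite_subset[of _ "{..<m}"])
  have i_notin: "i \<notin> L" "i \<notin> L'" using loopfree unfolding L_def L'_def by auto
  have "False" if "l \<in> L" "l \<in> L'" for l
  proof -
    have l: "Suc l < length xs" "{xs ! i, xs ! l} \<in> E" "{xs ! Suc i, xs ! Suc l} \<in> E"
      using that unfolding L_def L'_def m_def by auto
    then have "i \<noteq> l" using i_notin that by auto
    then show False
      using two_opt[OF dist, of i l E] two_opt[OF dist, of l i E] i l edges none
      by (cases "i < l") (auto simp: insert_commute)
  qed
  then have "card L + card L' = card (L \<union> L')" using fin by (intro card_Un_disjoint[symmetric]) auto
  also have "\<dots> \<le> card ({..<m - 1} - {i})"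
    using i_notin by (intro card_mono) (auto simp: L_def L'_def)
  finally have "card L + card L' \<le> m - 2" using i by (simp add: m_def)
  moreover have "card (nbrs E (xs ! i) \<inter> set xs) \<le> Suc (card L)"
  proof -
    have "{l. l < m \<and> {xs ! i, xs ! l} \<in> E} \<subseteq> insert (m - 1) L" by (auto simp: L_def)
    then have "card {l. l < m \<and> {xs ! i, xs ! l} \<in> E} \<le> card (insert (m - 1) L)"
      using fin by (intro card_mono) auto
    also have "\<dots> \<le> Suc (card L)" by (rule card_insert_le_m1) auto
    finally show ?thesis unfolding card_nbrs_eq_card_indices[OF dist] m_def .
  qed
  moreover have "card (nbrs E (xs ! Suc i) \<inter> set xs) \<le> Suc (card L')"
  proof -
    have "l \<in> insert 0 (Suc ` L')" if "l < m" "{xs ! Suc i, xs ! l} \<in> E" for l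
      using that by (cases l) (auto simp: L'_def)
    then have "card {l. l < m \<and> {xs ! Suc i, xs ! l} \<in> E} \<le> card (insert 0 (Suc ` L'))"
      using fin by (intro card_mono) auto
    also have "\<dots> \<le> Suc (card L')" using fin by (simp add: card_insert_if card_image)
    finally show ?thesis unfolding card_nbrs_eq_card_indices[OF dist] m_def .
  qed
  ultimately show ?thesis using i unfolding m_def by linarith
qed

lemma hamilton_path_new_edge_degree_sum:
  assumes loopfree: "\<And>v. {v} \<notin> E"
    and ham: "has_hamilton_path (insert {u, w} E) S a b" "\<not> has_hamilton_path E S a b"
  shows "card (nbrs E u \<inter> S) + card (nbrs E w \<inter> S) \<le> card S"
proof -
  obtain xs where xs: "path_between (insert {u, w} E) a b xs" "set xs = S"
    using ham(1) unfolding has_hamilton_path_def by blast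
  then have path: "path_in (insert {u, w} E) xs" and ends: "hd xs = a" "last xs = b"
    by (auto simp: path_between_def)
  have dist: "distinct xs" using path by (rule path_in_distinct)
  have "\<not> path_in E xs" using ham(2) xs unfolding has_hamilton_path_def path_between_def by blast
  then obtain i where i: "Suc i < length xs" "{xs ! i, xs ! Suc i} \<notin> E"
    using dist by (auto simp: path_in_def successively_conv_nth)
  have step: "{xs ! l, xs ! Suc l} \<in> insert {u, w} E" if "Suc l < length xs" for l
    using path that by (auto simp: path_in_def successively_conv_nth)
  have gap: "{xs ! i, xs ! Suc i} = {u, w}" using step[OF i(1)] i(2) by simp
  have "{xs ! l, xs ! Suc l} \<in> E" if "Suc l < length xs" "l \<noteq> i" for l
  proof -
    have "{xs ! l, xs ! Suc l} \<noteq> {xs ! i, xs ! Suc i}"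
      using that i(1) dist nth_eq_iff_index_eq[OF dist] by (auto simp: doubleton_eq_iff)
    then show ?thesis using step[OF that(1)] gap by auto
  qed
  then have "card (nbrs E (xs ! i) \<inter> S) + card (nbrs E (xs ! Suc i) \<inter> S) \<le> length xs"
    using hamilton_path_gap_degree_sum[OF loopfree dist i(1)] ham(2) ends xs(2) by auto
  moreover have "length xs = card S" using dist xs(2) distinct_card by metis
  ultimately show ?thesis using gap by (auto simp: doubleton_eq_iff)
qed

lemma ex_degree_sum_closed:
  assumes "finite S" "E \<subseteq> all_pairs S" "\<not> has_hamilton_path E S a b"
  obtains F where "E \<subseteq> F" "F \<subseteq> all_pairs S" "\<not> has_hamilton_path F S a b"
    "\<And>u v. \<lbrakk>u \<in> S; v \<in> S; u \<noteq> v; card S < card (nbrs F u) + card (nbrs F v)\<rbrakk> \<Longrightarrow> {u, v} \<in> F"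
proof -
  define \<F> where "\<F> = {F. E \<subseteq> F \<and> F \<subseteq> all_pairs S \<and> \<not> has_hamilton_path F S a b}"
  have "finite \<F>" unfolding \<F>_def
    using finite_all_pairs[OF assms(1)] by (auto intro: finite_subset[of _ "Pow (all_pairs S)"])
  moreover have "E \<in> \<F>" unfolding \<F>_def using assms by blast
  ultimately obtain F where "F \<in> \<F>" and max: "\<forall>F'\<in>\<F>. F \<subseteq> F' \<longrightarrow> F = F'"
    using finite_has_maximal2[of \<F> E] by metis
  then have F: "E \<subseteq> F" "F \<subseteq> all_pairs S" "\<not> has_hamilton_path F S a b" unfolding \<F>_def by auto
  have loopfree: "{v} \<notin> F" for v using subsetD[OF F(2)] pair_in_all_pairs_iff[of v v S] by auto
  have "{u, v} \<in> F"
    if uv: "u \<in> S" "v \<in> S" "u \<noteq> v" "card S < card (nbrs F u) + card (nbrs F v)" for u v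
  proof (rule ccontr)
    assume "{u, v} \<notin> F"
    then have "insert {u, v} F \<notin> \<F>" using max by blast
    then have ham: "has_hamilton_path (insert {u, v} F) S a b" unfolding \<F>_def using F uv by auto
    have "nbrs F x \<inter> S = nbrs F x" for x using nbrs_subset[OF F(2)] by blast
    then show False using hamilton_path_new_edge_degree_sum[OF loopfree ham F(3)] uv(4) by simp
  qed
  then show thesis using that F by blast
qed

lemma degree_sum_closed_clique_nbrs:
  assumes fin: "finite H" "finite Y" and disj: "H \<inter> Y = {}" and small: "card Y < card H"
    and F: "F \<subseteq> all_pairs (H \<union> Y)" "clique F H" "\<not> clique F (H \<union> Y)"
    and closed: "\<And>u v. \<lbrakk>u \<in> H \<union> Y; v \<in> H \<union> Y; u \<noteq> v;
      card (H \<union> Y) < card (nbrs F u) + card (nbrs F v)\<rbrakk> \<Longrightarrow> {u, v} \<in> F"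
    and deg: "\<And>y. y \<in> Y \<Longrightarrow> card Y < card (nbrs F y)"
    and y: "y \<in> Y"
  shows "card (nbrs F y) = card Y + 1" "y' \<in> Y \<Longrightarrow> nbrs F y \<inter> H = nbrs F y' \<inter> H"
proof -
  have card: "card (H \<union> Y) = card H + card Y" using fin disj by (rule card_Un_disjoint)
  have fin_nbrs: "finite (nbrs F v)" for v using finite_nbrs[OF F(1)] fin by simp
  have deg_H: "card H - 1 \<le> card (nbrs F h)" if "h \<in> H" for h
    using card_mono[OF fin_nbrs clique_subset_nbrs[OF F(2) that]] that by simp
  have deg_H_Y: "card H \<le> card (nbrs F h)" if "h \<in> H" "z \<in> Y" "{h, z} \<in> F" for h z
  proof -
    have "insert z (H - {h}) \<subseteq> nbrs F h"
      using clique_subset_nbrs[OF F(2) that(1)] that(3) by (auto simp: in_nbrs_iff)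
    then have "card (insert z (H - {h})) \<le> card (nbrs F h)" using fin_nbrs by (intro card_mono)
    moreover have "z \<notin> H" "0 < card H" using that disj fin by (auto simp: card_gt_0_iff)
    ultimately show ?thesis using that(1) fin by simp
  qed
  have all_Y: "{h, z} \<in> F" if "h \<in> H" "z \<in> Y" "z' \<in> Y" "{h, z'} \<in> F" for h z z'
  proof (rule closed)
    show "card (H \<union> Y) < card (nbrs F h) + card (nbrs F z)"
      using deg_H_Y[OF that(1,3,4)] deg[OF that(2)] card by simp
  qed (use that disj in auto)
  show "nbrs F y \<inter> H = nbrs F y' \<inter> H" if "y' \<in> Y"
    using all_Y[OF _ y that] all_Y[OF _ that y] by (auto simp: in_nbrs_iff')
  show "card (nbrs F y) = card Y + 1"
  proof (rule ccontr)
    assume "card (nbrs F y) \<noteq> card Y + 1"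
    then have high: "card Y + 2 \<le> card (nbrs F y)" using deg[OF y] by simp
    have "{h, y} \<in> F" if "h \<in> H" for h
    proof (rule closed)
      show "card (H \<union> Y) < card (nbrs F h) + card (nbrs F y)"
        using deg_H[OF that] high card small by linarith
    qed (use that y disj in auto)
    then have HY: "{h, z} \<in> F" if "h \<in> H" "z \<in> Y" for h z using all_Y[OF that y] that(1) by blast
    have deg_Y: "card H \<le> card (nbrs F z)" if "z \<in> Y" for z
      using HY that fin_nbrs by (intro card_mono) (auto simp: in_nbrs_iff')
    have YY: "{z, z'} \<in> F" if "z \<in> Y" "z' \<in> Y" "z \<noteq> z'" for z z'
    proof (rule closed)
      show "card (H \<union> Y) < card (nbrs F z) + card (nbrs F z')"
        using deg_Y[OF that(1)] deg_Y[OF that(2)] card small by linarith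
    qed (use that in auto)
    have "{u, v} \<in> F" if "u \<in> H \<union> Y" "v \<in> H \<union> Y" "u \<noteq> v" for u v
      using that HY[of u v] HY[of v u] YY[of u v] cliqueD[OF F(2), of u v]
      by (auto simp: insert_commute)
    then have "clique F (H \<union> Y)" unfolding clique_def by (auto elim!: all_pairsE)
    then show False using F(3) by blast
  qed
qed

lemma clique_extension_nbrs:
  assumes loopfree: "\<And>v. {v} \<notin> E"
    and fin: "finite H" "finite Y" and disj: "H \<inter> Y = {}" and small: "card Y < card H"
    and H: "clique E H" "a \<in> H" "b \<in> H" "a \<noteq> b" and none: "\<not> has_hamilton_path E (H \<union> Y) a b"
    and deg: "\<And>y. y \<in> Y \<Longrightarrow> card Y < card (nbrs E y \<inter> (H \<union> Y))"
    and y: "y \<in> Y"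
  shows "card (nbrs E y \<inter> (H \<union> Y)) = card Y + 1" "y' \<in> Y \<Longrightarrow> nbrs E y \<inter> H = nbrs E y' \<inter> H"
proof -
  let ?E = "E \<inter> all_pairs (H \<union> Y)"
  have fin_U: "finite (H \<union> Y)" using fin by simp
  have "\<not> has_hamilton_path ?E (H \<union> Y) a b"
    using none has_hamilton_path_mono[of ?E _ a b E] by blast
  then obtain F where F: "?E \<subseteq> F" "F \<subseteq> all_pairs (H \<union> Y)" "\<not> has_hamilton_path F (H \<union> Y) a b"
    and closed: "\<And>u v. \<lbrakk>u \<in> H \<union> Y; v \<in> H \<union> Y; u \<noteq> v;
      card (H \<union> Y) < card (nbrs F u) + card (nbrs F v)\<rbrakk> \<Longrightarrow> {u, v} \<in> F"
    using ex_degree_sum_closed[OF fin_U, of ?E a b] by blast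
  have nbrs: "nbrs E z \<inter> (H \<union> Y) \<subseteq> nbrs F z" if "z \<in> Y" for z
  proof
    fix x assume x: "x \<in> nbrs E z \<inter> (H \<union> Y)"
    then have "x \<noteq> z" using loopfree[of z] by (auto simp: in_nbrs_iff)
    then show "x \<in> nbrs F z" using F(1) x that by (auto simp: in_nbrs_iff)
  qed
  have fin_nbrs: "finite (nbrs F z)" for z using finite_nbrs[OF F(2) fin_U] .
  have clique: "clique F H"
    using H(1) F(1) all_pairs_mono[of H "H \<union> Y"] unfolding clique_def by blast
  have not_clique: "\<not> clique F (H \<union> Y)"
    using clique_hamiltonian_path[of F "H \<union> Y" a b] fin_U H F(3)
    unfolding has_hamilton_path_def by blast
  have deg_F: "card Y < card (nbrs F z)" if "z \<in> Y" for z
    using deg[OF that] card_mono[OF fin_nbrs nbrs[OF that]] by simp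
  have nbrs_F: "card (nbrs F z) = card Y + 1" "z' \<in> Y \<Longrightarrow> nbrs F z \<inter> H = nbrs F z' \<inter> H"
    if "z \<in> Y" for z z'
    using degree_sum_closed_clique_nbrs[OF fin disj small F(2) clique not_clique _ _ that]
      closed deg_F
    by blast+
  have eq: "nbrs E z \<inter> (H \<union> Y) = nbrs F z" if "z \<in> Y" for z
    using card_seteq[OF fin_nbrs nbrs[OF that]] nbrs_F(1)[OF that] deg[OF that] by simp
  show "card (nbrs E y \<inter> (H \<union> Y)) = card Y + 1" using eq nbrs_F(1) y by simp
  show "nbrs E y \<inter> H = nbrs E y' \<inter> H" if "y' \<in> Y"
    using nbrs_F(2)[OF y that] eq[OF y] eq[OF that] by blast
qed

lemma clique_plus_vertex_hamilton_path:
  assumes H: "clique E H" "finite H" "a \<in> H" "b \<in> H" "a \<noteq> b" and w: "w \<notin> H"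
    and xy: "x \<in> nbrs E w \<inter> H" "y \<in> nbrs E w \<inter> H" "x \<noteq> y" "{x, y} \<noteq> {a, b}"
  shows "has_hamilton_path E (insert w H) a b"
proof -
  have insert: "has_hamilton_path E (insert w H) a' b'"
    if ab: "a' \<in> H" "b' \<in> H" "a' \<noteq> b'" and xy': "x' \<in> nbrs E w \<inter> H" "y' \<in> nbrs E w \<inter> H" "x' \<noteq> y'"
      "x' \<notin> {a', b'}" "y' \<noteq> b'" for a' b' x' y'
  proof -
    obtain xs where xs: "path_between E a' y' xs" "set xs = {a', y'}"
    proof (cases "a' = y'")
      case True
      then show thesis using that[of "[a']"] by simp
    next
      case False
      then show thesis using that[of "[a', y']"] cliqueD[OF H(1) ab(1), of y'] xy'(2)
        by (simp add: path_between_def path_in_Cons)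
    qed
    obtain ys where ys: "path_between E x' b' ys" "set ys = H - {a', y'}"
      using clique_hamiltonian_path[of E "H - {a', y'}" x' b'] clique_subset[OF H(1)] H(2) ab xy'
      by auto
    have "path_between E a' w (xs @ [w])"
      using xs xy' w ab(1)
      by (intro path_between_append[OF xs(1), of w w "[w]"]) (auto simp: in_nbrs_iff')
    then have "path_between E a' b' ((xs @ [w]) @ ys)"
      using xs ys xy' w by (intro path_between_append[OF _ ys(1), of a' w]) (auto simp: in_nbrs_iff)
    moreover have "set ((xs @ [w]) @ ys) = insert w H" using xs ys ab xy' by auto
    ultimately show ?thesis unfolding has_hamilton_path_def by blast
  qed
  have "x \<notin> {a, b} \<or> y \<notin> {a, b}" using xy by auto
  then obtain x' y' where xy': "x' \<in> nbrs E w \<inter> H" "y' \<in> nbrs E w \<inter> H" "x' \<noteq> y'" "x' \<notin> {a, b}"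
    using xy by metis
  show ?thesis
  proof (cases "y' = b")
    case True
    then have "has_hamilton_path E (insert w H) b a" using insert[of b a x' y'] H xy' by auto
    then show ?thesis by (simp add: has_hamilton_path_commute)
  next
    case False
    then show ?thesis using insert[of a b x' y'] H xy' by blast
  qed
qed

section \<open>Paths outside a large clique\<close>

definition longest_path :: "'a set set \<Rightarrow> 'a set \<Rightarrow> 'a list \<Rightarrow> bool" where
  "longest_path E S P \<longleftrightarrow> path_in E P \<and> P \<noteq> [] \<and> set P \<subseteq> S \<and>
     (\<forall>Q. path_in E Q \<and> set Q \<subseteq> S \<longrightarrow> length Q \<le> length P)"

lemma ex_longest_path:
  assumes "finite S" "S \<noteq> {}"
  obtains P where "longest_path E S P"
proof -
  obtain s where "s \<in> S" using assms(2) by blast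
  then have s: "path_in E [s] \<and> set [s] \<subseteq> S" by simp
  obtain P where P: "path_in E P \<and> set P \<subseteq> S"
    and max: "\<And>Q. path_in E Q \<and> set Q \<subseteq> S \<Longrightarrow> length Q \<le> length P"
    using ex_longest_distinct_list[OF assms(1), of "\<lambda>xs. path_in E xs \<and> set xs \<subseteq> S", OF s]
      path_in_distinct by blast
  have "P \<noteq> []" using max[OF s] by auto
  then show thesis using that P max unfolding longest_path_def by blast
qed

lemma longest_path_rev: "longest_path E S (rev P) \<longleftrightarrow> longest_path E S P"
  by (simp add: longest_path_def)

lemma longest_path_of_length:
  "\<lbrakk>longest_path E S P; path_in E Q; set Q \<subseteq> S; length Q = length P\<rbrakk> \<Longrightarrow> longest_path E S Q"
  by (auto simp: longest_path_def)

lemma longest_path_length_eq: "\<lbrakk>longest_path E S P; longest_path E S Q\<rbrakk> \<Longrightarrow> length P = length Q"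
  unfolding longest_path_def by (meson le_antisym)

lemma longest_path_hd_in: "longest_path E S P \<Longrightarrow> hd P \<in> S"
  unfolding longest_path_def by (meson hd_in_set subsetD)

lemma longest_path_hd_nbrs:
  assumes "longest_path E S P"
  shows "nbrs E (hd P) \<inter> S \<subseteq> set P"
proof
  fix w assume w: "w \<in> nbrs E (hd P) \<inter> S"
  show "w \<in> set P"
  proof (rule ccontr)
    assume "w \<notin> set P"
    then have "path_in E (w # P)" "set (w # P) \<subseteq> S"
      using assms w unfolding longest_path_def by (auto simp: path_in_Cons in_nbrs_iff')
    then have "length (w # P) \<le> length P" using assms unfolding longest_path_def by blast
    then show False by simp
  qed
qed

text \<open>The last neighbour of \<open>hd M\<close> on \<open>M\<close> closes \<open>M\<close> to a cycle with a tail; walk around the cycle,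
  and along the tail if \<open>v\<close> lies there.\<close>

lemma long_path_ending_at:
  assumes M: "path_in E M" and loopfree: "{hd M} \<notin> E" and nbrs: "nbrs E (hd M) \<subseteq> set M"
    and deg: "k \<le> card (nbrs E (hd M))" "1 \<le> k" and v: "v \<in> set M"
  obtains W where "path_in E W" "set W \<subseteq> set M" "last W = v" "k < length W"
proof -
  have "nbrs E (hd M) \<inter> set M \<noteq> {}" using nbrs deg by (auto simp: Int_absorb2)
  then obtain i where i: "i < length M" "{hd M, M ! i} \<in> E"
    "nbrs E (hd M) \<inter> set M \<subseteq> set (take (Suc i) M)"
    by (rule last_nbr_index)
  obtain j where j: "j < length M" "v = M ! j" using v by (auto simp: in_set_conv_nth)
  have "hd M \<in> set (take (Suc i) M)" using i(1) by (cases M) auto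
  then have "insert (hd M) (nbrs E (hd M)) \<subseteq> set (take (Suc i) M)" using i(3) nbrs by blast
  then have "card (insert (hd M) (nbrs E (hd M))) \<le> card (set (take (Suc i) M))"
    by (intro card_mono) auto
  also have "\<dots> \<le> Suc i" using card_length[of "take (Suc i) M"] i(1) by simp
  finally have "card (insert (hd M) (nbrs E (hd M))) \<le> Suc i" .
  moreover have "hd M \<notin> nbrs E (hd M)" using loopfree by (simp add: in_nbrs_iff)
  ultimately have "k < Suc i" using deg finite_subset[OF nbrs] by simp
  show thesis
  proof (cases "j \<le> i")
    case True
    let ?A = "take (Suc j) M" and ?B = "drop (Suc j) (take (Suc i) M)"
    have "take (Suc i) M = ?A @ ?B"
      using True by (metis Suc_le_mono append_take_drop_id min.absorb1 take_take)
    then have AB: "path_in E ?A" "path_in E ?B" "set ?B \<inter> set ?A = {}"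
      using path_in_take[OF M, of "Suc i"] path_in_append[of E ?A ?B] by auto
    have "hd ?A = hd M" "last ?A = v" "?A \<noteq> []" "?B \<noteq> [] \<Longrightarrow> last ?B = M ! i"
      using i(1) j
      by (simp add: hd_take, simp add: take_Suc_conv_app_nth, auto simp: take_Suc_conv_app_nth)
    moreover from this AB i(2) have "path_in E (?B @ ?A)"
      unfolding path_in_append by (auto simp: insert_commute)
    moreover have "length (?B @ ?A) = Suc i" using True i(1) by simp
    moreover have "set (?B @ ?A) \<subseteq> set M" by (auto dest: in_set_takeD in_set_dropD)
    ultimately show thesis using that[of "?B @ ?A"] \<open>k < Suc i\<close> by simp
  next
    case False
    have "last (take (Suc j) M) = v" using j by (simp add: take_Suc_conv_app_nth)
    then show thesis
      using that[of "take (Suc j) M"] path_in_take[OF M] set_take_subset[of "Suc j" M] False j(1)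
        \<open>k < Suc i\<close> by simp
  qed
qed

locale circumference_clique = bounded_circumference +
  fixes H :: "'a set" and k :: nat
  assumes H_V: "H \<subseteq> V" and clique_H: "clique E H" and card_H: "card H = c + 1 - k"
    and k_ge_2: "2 \<le> k" and two_k_le: "2 * k + 2 \<le> c"
    and degree_ge: "v \<in> V \<Longrightarrow> k \<le> card (nbrs E v)" and c_less: "c < card V"
begin

abbreviation R :: "'a set" where "R \<equiv> V - H"

lemma finite_H: "finite H" and finite_R: "finite R"
  using H_V finite_V finite_subset by auto

lemma card_R: "k \<le> card R"
  using card_Diff_subset[OF finite_H H_V] card_H c_less two_k_le by simp

lemma R_nonempty: "R \<noteq> {}"
  using card_R k_ge_2 by (metis card.empty not_numeral_le_zero order_trans)

lemma card_nbrs_split: "card (nbrs E v) = card (nbrs E v \<inter> H) + card (nbrs E v \<inter> R)"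
proof -
  have "nbrs E v = (nbrs E v \<inter> H) \<union> (nbrs E v \<inter> R)" using nbrs_V by blast
  moreover have "card \<dots> = card (nbrs E v \<inter> H) + card (nbrs E v \<inter> R)"
    using fin_nbrs by (intro card_Un_disjoint) auto
  ultimately show ?thesis by simp
qed

lemma no_hamilton_path_beside:
  assumes P: "path_in E P" "P \<noteq> []" "set P \<subseteq> R" "{a, hd P} \<in> E" "{a', last P} \<in> E"
    and Y: "Y \<subseteq> R - set P" "k \<le> length P + card Y"
  shows "\<not> has_hamilton_path E (H \<union> Y) a a'"
proof
  assume "has_hamilton_path E (H \<union> Y) a a'"
  then obtain ys where ys: "path_in E ys" "ys \<noteq> []" "hd ys = a" "last ys = a'" "set ys = H \<union> Y"
    unfolding has_hamilton_path_def path_between_def by blast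
  have "finite Y" "H \<inter> Y = {}" using Y(1) finite_R finite_subset by blast+
  then have len: "length ys = card H + card Y"
    using path_in_distinct[OF ys(1)] ys(5) finite_H by (metis card_Un_disjoint distinct_card)
  have "set ys \<inter> set P = {}" using ys(5) Y(1) P(3) by blast
  then have "cycle_in E (ys @ rev P)"
    unfolding cycle_in_def using P ys len card_H two_k_le
    by (auto simp: path_in_append hd_rev last_rev insert_commute)
  then have "length ys + length P \<le> c" using cycle_le by fastforce
  then show False using len card_H Y(2) two_k_le by simp
qed

lemma path_with_two_feet_short:
  assumes "path_in E P" "P \<noteq> []" "set P \<subseteq> R" "{a, hd P} \<in> E" "{a', last P} \<in> E"
    and "a \<in> H" "a' \<in> H" "a \<noteq> a'"
  shows "length P < k"
proof (rule ccontr)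
  assume "\<not> length P < k"
  then have "\<not> has_hamilton_path E H a a'"
    using no_hamilton_path_beside[OF assms(1-5), of "{}"] by simp
  then show False
    using clique_hamiltonian_path[OF clique_H finite_H assms(6-8)]
    unfolding has_hamilton_path_def by blast
qed

lemma cycle_through_clique_and_end_nbrs:
  assumes M: "path_in E M" "M \<noteq> []" "set M \<subseteq> R" and h: "h \<in> H" "{last M, h} \<in> E"
    and nbrs: "nbrs E (hd M) \<subseteq> insert h (set M)"
  obtains D where "cycle_in E D" "insert (hd M) (nbrs E (hd M) \<union> H) \<subseteq> set D"
proof -
  have "\<not> H \<subseteq> {h}" using card_mono[of "{h}" H] card_H two_k_le by auto
  then obtain y where y: "y \<in> H" "y \<noteq> h" by blast
  obtain hs where hs: "path_between E h y hs" "set hs = H"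
    using clique_hamiltonian_path[OF clique_H finite_H h(1) y(1)] y(2) by blast
  define P where "P = M @ hs"
  have "set M \<inter> set hs = {}" using M(3) hs(2) by blast
  then have P: "path_in E P" "set P \<subseteq> V" "hd P = hd M" "last P = y" "drop (length M) P = hs"
    using M hs h(2) H_V unfolding P_def path_between_def by (auto simp: path_in_append)
  obtain gs where "hs = h # gs" "gs \<noteq> []"
    using hs y unfolding path_between_def by (cases hs) (auto split: if_splits)
  then have h_index: "P ! length M = h" "take (Suc (length M)) P = M @ [h]"
    "Suc (length M) < length P"
    unfolding P_def by simp_all
  have "nbrs E (hd M) \<noteq> {}"
    using degree_ge[of "hd M"] k_ge_2 M(2,3) hd_in_set[OF M(2)] by fastforce
  then have "nbrs E (hd P) \<inter> set P \<noteq> {}" using nbrs hs(2) h(1) M(2) unfolding P_def by auto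
  then obtain i where i: "i < length P" "{hd P, P ! i} \<in> E"
    "nbrs E (hd P) \<inter> set P \<subseteq> set (take (Suc i) P)"
    by (rule last_nbr_index)
  have "P ! 0 = hd P" using M(2) unfolding P_def by (simp add: hd_conv_nth nth_append)
  then have "0 < i" using i(2) loopfree[of "hd P"] by (cases i) auto
  moreover have "i \<le> length M"
  proof (rule ccontr)
    assume "\<not> i \<le> length M"
    then have "P ! i \<in> set (drop (Suc (length M)) P)"
      using i(1) by (auto simp: in_set_conv_nth intro!: exI[of _ "i - Suc (length M)"])
    moreover have "P ! i \<in> set (take (Suc (length M)) P)"
      using i(2) nbrs unfolding P(3) h_index(2) by (auto simp: nbrs_def)
    ultimately show False
      using set_take_disj_set_drop_if_distinct[OF path_in_distinct[OF P(1)], of "Suc (length M)"]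
      by blast
  qed
  ultimately obtain D where D: "cycle_in E D"
    "insert (hd P) (nbrs E (hd P) \<inter> set (take (Suc i) P)) \<subseteq> set D"
    "insert (last P) (nbrs E (last P) \<inter> set (drop (length M) P)) \<subseteq> set D"
    using noncrossing_cycle[OF biconn P(1,2), of i "length M"] h_index i(2) P(4)
      cliqueD[OF clique_H y(1) h(1) y(2)]
    by metis
  have "nbrs E (hd M) \<subseteq> set P" using nbrs hs(2) h(1) unfolding P_def by auto
  then have "insert (hd M) (nbrs E (hd M)) \<subseteq> set D" using D(2) i(3) unfolding P(3) by blast
  moreover have "H \<subseteq> set D"
    using D(3) clique_subset_nbrs[OF clique_H y(1)] unfolding P(4,5) hs(2) by blast
  ultimately show thesis using that D(1) by blast
qed

lemma pendant_path_short:
  assumes "path_in E P" "P \<noteq> []" "set P \<subseteq> R" "h \<in> H" "{last P, h} \<in> E"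
  shows "length P < k"
proof -
  define Q where "Q xs \<longleftrightarrow> path_in E xs \<and> xs \<noteq> [] \<and> set xs \<subseteq> R \<and> (\<exists>h\<in>H. {last xs, h} \<in> E)" for xs
  have "Q P" using assms unfolding Q_def by auto
  then obtain M where "Q M" and max: "\<And>xs. Q xs \<Longrightarrow> length xs \<le> length M"
    using ex_longest_distinct_list[OF finite_V, of Q] path_in_distinct unfolding Q_def by blast
  then obtain h where M: "path_in E M" "M \<noteq> []" "set M \<subseteq> R" and h: "h \<in> H" "{last M, h} \<in> E"
    unfolding Q_def by blast
  have "length M < k"
  proof (rule ccontr)
    assume long: "\<not> length M < k"
    have "a = h" if "a \<in> nbrs E (hd M) \<inter> H" for a
      using path_with_two_feet_short[OF M, of a h] long h that
      by (auto simp: in_nbrs_iff' insert_commute)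
    then have "nbrs E (hd M) \<inter> H \<subseteq> {h}" by blast
    moreover have "nbrs E (hd M) \<inter> R \<subseteq> set M"
    proof
      fix w assume w: "w \<in> nbrs E (hd M) \<inter> R"
      show "w \<in> set M"
      proof (rule ccontr)
        assume "w \<notin> set M"
        then have "Q (w # M)" using M h w unfolding Q_def by (auto simp: path_in_Cons in_nbrs_iff')
        then show False using max by fastforce
      qed
    qed
    ultimately have "nbrs E (hd M) \<subseteq> insert h (set M)" using nbrs_V by blast
    then obtain D where D: "cycle_in E D" "insert (hd M) (nbrs E (hd M) \<union> H) \<subseteq> set D"
      using cycle_through_clique_and_end_nbrs[OF M h] by blast
    have hd_M: "hd M \<in> R" using M(2,3) by (meson hd_in_set subsetD)
    have "card (nbrs E (hd M) \<inter> H) \<le> 1"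
      using card_mono[OF _ \<open>nbrs E (hd M) \<inter> H \<subseteq> {h}\<close>] by simp
    then have "k \<le> card (nbrs E (hd M) \<inter> R) + 1"
      using degree_ge[of "hd M"] hd_M card_nbrs_split[of "hd M"] by simp
    moreover have "card (insert (hd M) (nbrs E (hd M) \<inter> R \<union> H)) =
        Suc (card (nbrs E (hd M) \<inter> R) + card H)"
      using hd_M nbrs_V[of "hd M"] fin_nbrs finite_H
      by (subst card_insert_disjoint) (auto intro: card_Un_disjoint)
    moreover have "card (insert (hd M) (nbrs E (hd M) \<inter> R \<union> H)) \<le> length D"
      using D(2) unfolding length_cycle_in[OF D(1)] by (intro card_mono) auto
    ultimately show False using cycle_le[OF D(1)] card_H two_k_le by linarith
  qed
  then show ?thesis using max[OF \<open>Q P\<close>] by linarith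
qed

lemma ex_path_to_clique:
  assumes "S \<subseteq> R" "S \<noteq> {}"
  obtains J h where "path_in E J" "J \<noteq> []" "set J \<subseteq> R" "set J \<inter> S = {hd J}" "h \<in> H"
    "{last J, h} \<in> E"
proof -
  obtain z where z: "z \<in> H" using card_H two_k_le by fastforce
  have "\<not> H \<subseteq> {z}" using card_mono[of "{z}" H] card_H two_k_le by auto
  then obtain J' where J': "path_from_to E S (H - {z}) J'" "set J' \<subseteq> V - {z}"
    using biconnected_path_from_to[OF biconn, of z S "H - {z}"] assms z H_V by blast
  define J where "J = butlast J'"
  have J'_eq: "J' = J @ [last J']" using J'(1) unfolding J_def path_from_to_def by simp
  have last: "last J' \<in> H" "last J' \<notin> S" using J'(1) assms(1) unfolding path_from_to_def by auto
  moreover have "hd J' \<in> S" using J'(1) unfolding path_from_to_def by auto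
  ultimately have "J \<noteq> []" using J'_eq by (metis append_Nil list.sel(1))
  have "path_in E (J @ [last J'])" using J'(1) J'_eq unfolding path_from_to_def by simp
  then have path: "path_in E J" "{last J, last J'} \<in> E" "last J' \<notin> set J"
    using \<open>J \<noteq> []\<close> by (auto simp: path_in_append)
  have "hd J = hd J'" using J'_eq \<open>J \<noteq> []\<close> by (metis hd_append2)
  have "set J' = insert (last J') (set J)" by (subst J'_eq) simp
  then have set_J: "set J = set J' - {last J'}" using path(3) by blast
  have "set J' \<inter> S = {hd J'}" "set J' \<inter> (H - {z}) \<subseteq> {last J'}"
    using J'(1) by (simp_all add: path_from_to_def)
  moreover have "hd J' \<noteq> last J'" using \<open>hd J' \<in> S\<close> last(2) by auto
  moreover have "set J \<inter> A = set J' \<inter> A - {last J'}" for A unfolding set_J by blast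
  ultimately have disj: "set J \<inter> S = {hd J'}" "set J \<inter> (H - {z}) = {}" by auto
  show thesis
  proof (rule that)
    show "set J \<subseteq> R" using J'(2) set_J disj(2) by auto
    show "set J \<inter> S = {hd J}" using disj(1) \<open>hd J = hd J'\<close> by simp
  qed (fact path(1) \<open>J \<noteq> []\<close> last(1) path(2))+
qed

lemma outside_path_short:
  assumes "path_in E Q" "set Q \<subseteq> R"
  shows "length Q < k"
proof -
  obtain M where longest: "longest_path E R M" using ex_longest_path[OF finite_R R_nonempty] .
  then have M: "path_in E M" "M \<noteq> []" "set M \<subseteq> R" "length Q \<le> length M"
    using assms unfolding longest_path_def by auto
  have "length M < k"
  proof (rule ccontr)
    assume long: "\<not> length M < k"
    have "{hd M, h} \<notin> E" if "h \<in> H" for h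
      using pendant_path_short[of "rev M" h] M that long by (auto simp: last_rev)
    then have nbrs: "nbrs E (hd M) \<subseteq> set M"
      using longest_path_hd_nbrs[OF longest] nbrs_V by (auto simp: nbrs_def)
    obtain J h where J: "path_in E J" "J \<noteq> []" "set J \<subseteq> R" "set J \<inter> set M = {hd J}" "h \<in> H"
      "{last J, h} \<in> E"
      using ex_path_to_clique[of "set M"] M by auto
    have "hd M \<in> V" using longest_path_hd_in[OF longest] by blast
    then obtain W where W: "path_in E W" "set W \<subseteq> set M" "last W = hd J" "k < length W"
      using long_path_ending_at[OF M(1) loopfree nbrs degree_ge, of "hd J"] J(4) k_ge_2 by auto
    then have W_J: "path_between E (hd W) (hd J) W" "path_between E (hd J) (last J) J"
      using J(1,2) by (auto simp: path_between_def)
    have "set W \<inter> set J \<subseteq> {hd J}" using W(2) J(4) by blast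
    note join = path_between_join[OF W_J this]
    have "length (W @ tl J) < k"
      using join M(3) W(2) J by (intro pendant_path_short[of _ h]) (auto simp: path_between_def)
    then show False using W(4) by simp
  qed
  then show ?thesis using M(4) by simp
qed

end

section \<open>Structure outside a large clique\<close>

lemma ex_distinct_elements:
  assumes "2 \<le> card A" "2 \<le> card B"
  obtains a b where "a \<in> A" "b \<in> B" "a \<noteq> b"
proof -
  obtain a where "a \<in> A" using assms(1) by (metis card.empty ex_in_conv not_numeral_le_zero)
  moreover have "\<not> B \<subseteq> {a}" using assms(2) card_mono[of "{a}" B] by auto
  ultimately show thesis using that by blast
qed

lemma path_in_start_anywhere:
  assumes P: "path_in E P" and nbrs: "set P - {hd P} \<subseteq> nbrs E (hd P)" and v: "v \<in> set P"
  obtains P' where "path_in E P'" "set P' = set P" "hd P' = v"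
proof -
  obtain A B where P_eq: "P = (A @ [v]) @ B" using v split_list by fastforce
  have hd: "hd (A @ [v]) = hd P" unfolding P_eq by (cases A) auto
  have parts: "path_in E (A @ [v])" "path_in E B" "set (A @ [v]) \<inter> set B = {}"
    using P unfolding P_eq path_in_append[of E "A @ [v]"] by auto
  have "hd P \<in> set (A @ [v])" using hd by (metis hd_in_set snoc_eq_iff_butlast)
  then have "hd B \<in> set P - {hd P}" if "B \<noteq> []"
    using parts(3) hd_in_set[OF that] unfolding P_eq by auto
  then have "{hd P, hd B} \<in> E" if "B \<noteq> []" using nbrs that by (auto simp: nbrs_def)
  moreover have "last (rev (A @ [v])) = hd P" using hd by (simp only: last_rev)
  ultimately have "path_in E (rev (A @ [v]) @ B)"
    using parts unfolding path_in_append[of E "rev (A @ [v])"] by (auto simp del: rev_append)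
  moreover have "set (rev (A @ [v]) @ B) = set P" "hd (rev (A @ [v]) @ B) = v"
    unfolding P_eq by auto
  ultimately show thesis using that by blast
qed

lemma longest_path_same_set:
  assumes "longest_path E S P" "path_in E P'" "set P' = set P"
  shows "longest_path E S P'"
proof -
  have "length P' = length P"
    using assms path_in_distinct distinct_card unfolding longest_path_def by metis
  then show ?thesis
    using longest_path_of_length[OF assms(1,2)] assms(1,3) unfolding longest_path_def by simp
qed

context bounded_circumference begin

lemma longest_path_hd_degree:
  assumes "longest_path E S P"
  shows "nbrs E (hd P) \<inter> S \<subseteq> set P - {hd P}" "card (nbrs E (hd P) \<inter> S) < length P"
proof -
  show sub: "nbrs E (hd P) \<inter> S \<subseteq> set P - {hd P}"
    using longest_path_hd_nbrs[OF assms] nbrs_V by blast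
  have "card (nbrs E (hd P) \<inter> S) \<le> card (set P - {hd P})" using sub by (intro card_mono) auto
  also have "\<dots> < card (set P)"
    using assms unfolding longest_path_def by (intro psubset_card_mono) auto
  finally show "card (nbrs E (hd P) \<inter> S) < length P" using card_length[of P] by linarith
qed

text \<open>From a neighbour of \<open>hd Q\<close> on \<open>P\<close> the path \<open>Q\<close> can be continued along \<open>P\<close> in either
  direction.\<close>

lemma longest_path_nbr_index:
  assumes P: "longest_path E S P" and Q: "path_in E Q" "Q \<noteq> []" "set Q \<subseteq> S - set P"
    and l: "l < length P" "{hd Q, P ! l} \<in> E"
  shows "length Q \<le> l" "l + length Q < length P"
proof -
  let ?A = "take (Suc l) P" and ?B = "drop l P"
  have P': "path_in E P" "set P \<subseteq> S" using P by (auto simp: longest_path_def)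
  have sub: "set ?A \<subseteq> set P" "set ?B \<subseteq> set P" by (simp_all add: set_take_subset set_drop_subset)
  have "last ?A = P ! l" "hd ?B = P ! l" "?A \<noteq> []" "?B \<noteq> []"
    using l(1) by (auto simp: take_Suc_conv_app_nth hd_drop_conv_nth)
  moreover have "set Q \<inter> set ?A = {}" "set Q \<inter> set ?B = {}" using Q(3) sub by blast+
  ultimately have "path_in E (rev Q @ rev ?A)" "path_in E (rev Q @ ?B)"
    using Q(1,2) path_in_take[OF P'(1), of "Suc l"] path_in_drop[OF P'(1), of l] l(2)
    unfolding path_in_append by (auto simp: last_rev hd_rev)
  moreover have "set (rev Q @ rev ?A) \<subseteq> S" "set (rev Q @ ?B) \<subseteq> S" using Q(3) P'(2) sub by auto
  ultimately have "length (rev Q @ rev ?A) \<le> length P" "length (rev Q @ ?B) \<le> length P"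
    using P unfolding longest_path_def by blast+
  then show "length Q \<le> l" "l + length Q < length P" using l(1) by auto
qed

lemma longest_path_beside_degree:
  assumes P: "longest_path E S P" and T: "T \<subseteq> S - set P" and Q: "longest_path E T Q"
  shows "card (nbrs E (hd Q) \<inter> (T \<union> set P)) < length P"
    and "card (nbrs E (hd Q) \<inter> (T \<union> set P)) = length P - 1 \<Longrightarrow>
      length Q = length P \<and> nbrs E (hd Q) \<inter> set P = {}"
proof -
  have Q': "path_in E Q" "Q \<noteq> []" "set Q \<subseteq> T" using Q by (auto simp: longest_path_def)
  have PQ: "length Q \<le> length P" using P Q' T unfolding longest_path_def by blast
  have "1 \<le> length Q" using Q'(2) by (cases Q) auto
  have T_nbrs: "card (nbrs E (hd Q) \<inter> T) < length Q" using longest_path_hd_degree(2)[OF Q] .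
  have "card (nbrs E (hd Q) \<inter> (T \<union> set P)) < length P \<and>
    (card (nbrs E (hd Q) \<inter> (T \<union> set P)) = length P - 1 \<longrightarrow>
      length Q = length P \<and> nbrs E (hd Q) \<inter> set P = {})"
  proof (cases "nbrs E (hd Q) \<inter> set P = {}")
    case True
    then have "nbrs E (hd Q) \<inter> (T \<union> set P) = nbrs E (hd Q) \<inter> T" by blast
    then show ?thesis using T_nbrs PQ True by auto
  next
    case False
    let ?I = "{l. l < length P \<and> {hd Q, P ! l} \<in> E}"
    have "?I \<subseteq> {length Q..<length P - length Q}"
      using longest_path_nbr_index[OF P Q'(1,2)] Q'(3) T by fastforce
    then have "card ?I \<le> card {length Q..<length P - length Q}" by (intro card_mono) auto
    then have "card (nbrs E (hd Q) \<inter> set P) \<le> length P - length Q - length Q"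
      using card_nbrs_eq_card_indices[of P E "hd Q"] P path_in_distinct[of E P]
      unfolding longest_path_def by auto
    moreover have "card (nbrs E (hd Q) \<inter> set P) \<noteq> 0" using False by simp
    moreover have "card (nbrs E (hd Q) \<inter> (T \<union> set P)) \<le>
        card (nbrs E (hd Q) \<inter> T) + card (nbrs E (hd Q) \<inter> set P)"
      unfolding Int_Un_distrib by (rule card_Un_le)
    ultimately show ?thesis using T_nbrs \<open>1 \<le> length Q\<close> by linarith
  qed
  then show "card (nbrs E (hd Q) \<inter> (T \<union> set P)) < length P"
    and "card (nbrs E (hd Q) \<inter> (T \<union> set P)) = length P - 1 \<Longrightarrow>
      length Q = length P \<and> nbrs E (hd Q) \<inter> set P = {}" by auto
qed

end

context circumference_clique begin

definition low :: "nat \<Rightarrow> 'a set \<Rightarrow> bool" where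
  "low p Y \<longleftrightarrow> (\<forall>w\<in>Y. card (nbrs E w \<inter> R - Y) < p)"

lemma low_extension:
  assumes P: "longest_path E R P" and U: "U \<subseteq> R - set P" "low (length P) U"
    and m: "card U \<le> m" "m \<le> card (R - set P)"
  shows "\<exists>Y. U \<subseteq> Y \<and> Y \<subseteq> R - set P \<and> card Y = m \<and> low (length P) Y"
  using m
proof (induction m rule: dec_induct)
  case base
  then show ?case using U by blast
next
  case (step m)
  then obtain Y where Y: "U \<subseteq> Y" "Y \<subseteq> R - set P" "card Y = m" "low (length P) Y" by auto
  have "finite Y" using Y(2) finite_R finite_subset by blast
  let ?T = "R - set P - Y"
  have "?T \<noteq> {}" using step.prems Y(2,3) by (metis Diff_eq_empty_iff Suc_n_not_le_n subset_antisym)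
  moreover have "finite ?T" using finite_R by simp
  ultimately obtain Q where Q: "longest_path E ?T Q" using ex_longest_path by blast
  have hd_Q: "hd Q \<in> ?T" using Q by (rule longest_path_hd_in)
  have "nbrs E (hd Q) \<inter> R - Y = nbrs E (hd Q) \<inter> (?T \<union> set P)"
    using P Y(2) unfolding longest_path_def by auto
  then have "card (nbrs E (hd Q) \<inter> R - Y) < length P"
    using longest_path_beside_degree(1)[OF P _ Q] by auto
  moreover have "card (nbrs E w \<inter> R - insert (hd Q) Y) \<le> card (nbrs E w \<inter> R - Y)" for w
    using finite_R by (intro card_mono) auto
  ultimately have "low (length P) (insert (hd Q) Y)"
    using Y(4) unfolding low_def by (fastforce intro: le_less_trans)
  moreover have "card (insert (hd Q) Y) = Suc m" using hd_Q Y(3) \<open>finite Y\<close> by simp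
  ultimately show ?case using Y(1,2) hd_Q by (intro exI[of _ "insert (hd Q) Y"]) auto
qed

lemma low_set_nbrs:
  assumes P: "path_in E P" "P \<noteq> []" "set P \<subseteq> R" "{a, hd P} \<in> E" "{a', last P} \<in> E"
    and a: "a \<in> H" "a' \<in> H" "a \<noteq> a'"
    and Y: "Y \<subseteq> R - set P" "length P + card Y = k" "low (length P) Y" and w: "w \<in> Y"
  shows "card (nbrs E w \<inter> H) + card (nbrs E w \<inter> Y) = card Y + 1"
    and "card (nbrs E w \<inter> R - Y) = length P - 1"
    and "w' \<in> Y \<Longrightarrow> nbrs E w \<inter> H = nbrs E w' \<inter> H"
proof -
  have fin_Y: "finite Y" using Y(1) finite_R finite_subset by blast
  have disj: "H \<inter> Y = {}" using Y(1) by blast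
  have small: "card Y < card H" using Y(2) card_H two_k_le by simp
  have split: "card (nbrs E y) = card (nbrs E y \<inter> (H \<union> Y)) + card (nbrs E y \<inter> R - Y)" for y
  proof -
    have "nbrs E y = nbrs E y \<inter> (H \<union> Y) \<union> (nbrs E y \<inter> R - Y)" using nbrs_V Y(1) by blast
    moreover have "(nbrs E y \<inter> (H \<union> Y)) \<inter> (nbrs E y \<inter> R - Y) = {}" by blast
    ultimately show ?thesis using fin_nbrs by (metis card_Un_disjoint finite_Un)
  qed
  have lost: "card (nbrs E y \<inter> R - Y) < length P" "k \<le> card (nbrs E y)" if "y \<in> Y" for y
    using Y(1,3) that degree_ge unfolding low_def by auto
  have deg: "card Y < card (nbrs E y \<inter> (H \<union> Y))" if "y \<in> Y" for y
    using lost[OF that] split[of y] Y(2) by linarith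
  have none: "\<not> has_hamilton_path E (H \<union> Y) a a'"
    using no_hamilton_path_beside[OF P Y(1)] Y(2) by simp
  note nbrs = clique_extension_nbrs[OF loopfree finite_H fin_Y disj small clique_H a none]
  have card: "card (nbrs E w \<inter> (H \<union> Y)) = card Y + 1" using nbrs(1)[OF _ w] deg by blast
  then show "card (nbrs E w \<inter> R - Y) = length P - 1" using lost[OF w] split[of w] Y(2) by linarith
  have "card (nbrs E w \<inter> (H \<union> Y)) = card (nbrs E w \<inter> H) + card (nbrs E w \<inter> Y)"
    unfolding Int_Un_distrib using fin_nbrs disj by (intro card_Un_disjoint) auto
  then show "card (nbrs E w \<inter> H) + card (nbrs E w \<inter> Y) = card Y + 1" using card by simp
  show "nbrs E w \<inter> H = nbrs E w' \<inter> H" if "w' \<in> Y" using nbrs(2)[OF _ w that] deg by blast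
qed

lemma longest_path_hd_clique_nbrs:
  assumes "longest_path E R P"
  shows "2 \<le> card (nbrs E (hd P) \<inter> H)"
proof -
  have "k \<le> card (nbrs E (hd P))" using longest_path_hd_in[OF assms] degree_ge by blast
  moreover have "length P < k" using assms outside_path_short unfolding longest_path_def by blast
  ultimately show ?thesis
    using card_nbrs_split[of "hd P"] longest_path_hd_degree(2)[OF assms] by linarith
qed

lemma longest_path_last_clique_nbrs: "longest_path E R P \<Longrightarrow> 2 \<le> card (nbrs E (last P) \<inter> H)"
  using longest_path_hd_clique_nbrs[of "rev P"] by (simp add: longest_path_rev hd_rev)

lemma low_vertices_nbrs:
  assumes P: "longest_path E R P" and U: "U \<subseteq> R - set P" "card U + length P \<le> k"
    and low: "\<forall>w\<in>U. card (nbrs E w \<inter> R) < length P" and w: "w \<in> U"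
  shows "card (nbrs E w \<inter> R) = length P - 1" "card (nbrs E w \<inter> H) + length P = k + 1"
    "w' \<in> U \<Longrightarrow> {w, w'} \<notin> E \<and> nbrs E w \<inter> H = nbrs E w' \<inter> H"
proof -
  have P': "path_in E P" "P \<noteq> []" "set P \<subseteq> R" using P by (auto simp: longest_path_def)
  have "low (length P) U" unfolding low_def
    using low finite_R by (meson Diff_subset card_mono finite_Int le_less_trans)
  moreover have "card U \<le> k - length P" using U(2) by simp
  moreover have "k - length P \<le> card (R - set P)"
    using card_R card_length[of P] diff_card_le_card_Diff[of "set P" R] by simp
  ultimately obtain Y where Y: "U \<subseteq> Y" "Y \<subseteq> R - set P" "card Y = k - length P" "low (length P) Y"
    using low_extension[OF P U(1), of "k - length P"] by blast
  obtain a a' where a: "a \<in> nbrs E (hd P) \<inter> H" "a' \<in> nbrs E (last P) \<inter> H" "a \<noteq> a'"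
    using longest_path_hd_clique_nbrs[OF P] longest_path_last_clique_nbrs[OF P]
    by (rule ex_distinct_elements)
  have card_Y: "length P + card Y = k" using Y(3) U(2) by simp
  have feet: "{a, hd P} \<in> E" "{a', last P} \<in> E" "a \<in> H" "a' \<in> H" using a by (auto simp: in_nbrs_iff')
  note nbrs = low_set_nbrs[OF P' feet a(3) Y(2) card_Y Y(4)]
  have wY: "w \<in> Y" using w Y(1) by blast
  have "card (nbrs E w \<inter> R) \<le> card (nbrs E w \<inter> R - Y)"
    using nbrs(2)[OF wY] bspec[OF low w] by linarith
  then have "nbrs E w \<inter> R - Y = nbrs E w \<inter> R" using finite_R by (intro card_seteq) auto
  then show "card (nbrs E w \<inter> R) = length P - 1" using nbrs(2)[OF wY] by simp
  have outside: "nbrs E w \<inter> Y = {}" using \<open>nbrs E w \<inter> R - Y = nbrs E w \<inter> R\<close> Y(2) by blast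
  then show "card (nbrs E w \<inter> H) + length P = k + 1" using nbrs(1)[OF wY] card_Y by simp
  show "{w, w'} \<notin> E \<and> nbrs E w \<inter> H = nbrs E w' \<inter> H" if "w' \<in> U"
    using outside nbrs(3)[OF wY, of w'] that Y(1) by (auto simp: nbrs_def)
qed

lemma ex_longest_path_beside:
  assumes "longest_path E R P"
  obtains Q where "longest_path E (R - set P) Q"
proof -
  have "length P < k" using assms outside_path_short unfolding longest_path_def by blast
  then have "\<not> R \<subseteq> set P" using card_mono[of "set P" R] card_length[of P] card_R by auto
  then show thesis using ex_longest_path[of "R - set P"] finite_R that by auto
qed

lemma longest_path_beside_low:
  assumes P: "longest_path E R P" and Q: "longest_path E (R - set P) Q"
  shows "card (nbrs E (hd Q) \<inter> R) < length P"
    and "card (nbrs E (hd Q) \<inter> R) = length P - 1 \<Longrightarrow> length Q = length P \<and> nbrs E (hd Q) \<inter> set P = {}"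
proof -
  have "R - set P \<union> set P = R" using P unfolding longest_path_def by blast
  then show "card (nbrs E (hd Q) \<inter> R) < length P"
    and "card (nbrs E (hd Q) \<inter> R) = length P - 1 \<Longrightarrow> length Q = length P \<and> nbrs E (hd Q) \<inter> set P = {}"
    using longest_path_beside_degree[OF P subset_refl Q] by auto
qed

text \<open>Otherwise the first two vertices of a longest path beside \<open>P\<close> would both be low, hence
  nonadjacent.\<close>

lemma longest_path_trivial:
  assumes P: "longest_path E R P" and short: "length P + 2 \<le> k"
  shows "length P = 1"
proof (rule ccontr)
  assume "length P \<noteq> 1"
  then have p: "2 \<le> length P" using P unfolding longest_path_def by (cases P) (auto simp: Suc_le_eq)
  obtain Q where Q: "longest_path E (R - set P) Q" using ex_longest_path_beside[OF P] .
  have hd_Q: "hd Q \<in> R - set P" using Q by (rule longest_path_hd_in)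
  note low_hd = longest_path_beside_low(1)[OF P Q]
  have deg: "card (nbrs E (hd Q) \<inter> R) = length P - 1"
    using low_vertices_nbrs(1)[OF P, of "{hd Q}"] hd_Q low_hd short by auto
  then have len: "length Q = length P" using longest_path_beside_low(2)[OF P Q] by simp
  have Q': "path_in E Q" "Q \<noteq> []" "set Q \<subseteq> R - set P" using Q by (auto simp: longest_path_def)
  have "nbrs E (hd Q) \<inter> R \<subseteq> set Q - {hd Q}"
  proof -
    have "nbrs E (hd Q) \<inter> set P = {}"
      using longest_path_beside_low(2)[OF P Q deg] by blast
    then show ?thesis using longest_path_hd_degree(1)[OF Q] by blast
  qed
  then have nbrs: "nbrs E (hd Q) \<inter> R = set Q - {hd Q}"
    using deg len Q'(1,2) path_in_distinct[OF Q'(1)]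
    by (intro card_seteq) (auto simp: distinct_card)
  obtain u where u: "u \<in> set Q - {hd Q}" "{hd Q, u} \<in> E"
  proof -
    have "card (set Q - {hd Q}) \<noteq> 0" using deg nbrs p by simp
    then have "set Q - {hd Q} \<noteq> {}" by (metis card.empty)
    then show thesis using that nbrs by (auto simp: nbrs_def)
  qed
  obtain Q2 where Q2: "path_in E Q2" "set Q2 = set Q" "hd Q2 = u"
    using path_in_start_anywhere[OF Q'(1), of u] nbrs u(1) by blast
  then have "longest_path E (R - set P) Q2" using longest_path_same_set[OF Q] by blast
  then have low_u: "card (nbrs E u \<inter> R) < length P"
    using longest_path_beside_low(1)[OF P] Q2(3) by blast
  have "{hd Q, u} \<subseteq> R - set P" using hd_Q u(1) Q'(3) by blast
  then have "{hd Q, u} \<notin> E"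
    using low_vertices_nbrs(3)[OF P, of "{hd Q, u}" "hd Q" u] u(1) low_hd low_u short by auto
  then show False using u(2) by blast
qed

lemma independent_outside_nbrs:
  assumes P: "longest_path E R P" "length P = 1" and k: "3 \<le> k"
  obtains N where "N \<subseteq> H" "card N = k" "\<And>w. w \<in> R \<Longrightarrow> nbrs E w \<inter> H = N"
    "\<And>w. w \<in> R \<Longrightarrow> nbrs E w \<inter> R = {}"
proof -
  have single: "longest_path E R [v]" if "v \<in> R" for v
    using P that by (intro longest_path_of_length[OF P(1)]) auto
  have indep: "nbrs E w \<inter> R = {}" if "w \<in> R" for w
    using longest_path_hd_degree(2)[OF single[OF that]] finite_R by simp
  have same: "card (nbrs E w \<inter> H) = k \<and> nbrs E w \<inter> H = nbrs E w' \<inter> H" if "w \<in> R" "w' \<in> R" for w w'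
  proof -
    have "card {w, w'} < card R" using card_R k by (simp add: card_insert_if)
    then have "\<not> R \<subseteq> {w, w'}" using card_mono[of "{w, w'}" R] by auto
    then obtain v where v: "v \<in> R" "v \<notin> {w, w'}" by blast
    have "card {w, w'} + length [v] \<le> k" using k by (simp add: card_insert_if)
    then show ?thesis
      using low_vertices_nbrs(2,3)[OF single[OF v(1)], of "{w, w'}" w] that v(2) indep by auto
  qed
  obtain w0 where "w0 \<in> R" using longest_path_hd_in[OF P(1)] by blast
  then show thesis using that[of "nbrs E w0 \<inter> H"] same indep by blast
qed

lemma low_vertex_beside_long_path_nbrs:
  assumes P: "longest_path E R P" and k: "length P + 1 = k"
    and w: "w \<in> R - set P" "card (nbrs E w \<inter> R) < length P"
    and a: "a \<in> nbrs E (hd P) \<inter> H" "a' \<in> nbrs E (last P) \<inter> H" "a \<noteq> a'"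
  shows "nbrs E w \<inter> H = {a, a'}"
proof (rule ccontr)
  assume neg: "nbrs E w \<inter> H \<noteq> {a, a'}"
  have "card (nbrs E w \<inter> H) = 2" using low_vertices_nbrs(2)[OF P, of "{w}" w] w k by auto
  then obtain x y where xy: "nbrs E w \<inter> H = {x, y}" "x \<noteq> y" by (meson card_2_iff)
  have "has_hamilton_path E (insert w H) a a'"
  proof (rule clique_plus_vertex_hamilton_path[OF clique_H finite_H])
    show "x \<in> nbrs E w \<inter> H" "y \<in> nbrs E w \<inter> H" "x \<noteq> y" "{x, y} \<noteq> {a, a'}" using xy neg by auto
  qed (use a w in auto)
  moreover have "path_in E P" "P \<noteq> []" "set P \<subseteq> R" using P by (auto simp: longest_path_def)
  then have "\<not> has_hamilton_path E (H \<union> {w}) a a'"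
    using a w(1) k by (intro no_hamilton_path_beside) (auto simp: in_nbrs_iff')
  ultimately show False by simp
qed

lemma long_path_hd_nbrs:
  assumes P: "longest_path E R P" and k: "length P + 1 = k"
    and w: "w \<in> R - set P" "card (nbrs E w \<inter> R) < length P"
  shows "nbrs E (hd P) \<inter> H = nbrs E w \<inter> H" "nbrs E (hd P) \<inter> R = set P - {hd P}"
proof -
  let ?A = "nbrs E (hd P) \<inter> H" and ?A' = "nbrs E (last P) \<inter> H"
  have "a \<in> nbrs E w \<inter> H" if a: "a \<in> ?A" for a
  proof -
    have "\<not> ?A' \<subseteq> {a}" using longest_path_last_clique_nbrs[OF P] card_mono[of "{a}" ?A'] by auto
    then obtain a' where "a' \<in> ?A'" "a \<noteq> a'" by blast
    then show ?thesis using low_vertex_beside_long_path_nbrs[OF P k w a] by blast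
  qed
  moreover have "card (nbrs E w \<inter> H) = 2" using low_vertices_nbrs(2)[OF P, of "{w}" w] w k by auto
  ultimately show hd_nbrs: "?A = nbrs E w \<inter> H"
    using longest_path_hd_clique_nbrs[OF P] fin_nbrs by (intro card_seteq) auto
  have P': "path_in E P" "P \<noteq> []" using P by (auto simp: longest_path_def)
  have "k \<le> card (nbrs E (hd P))" using longest_path_hd_in[OF P] degree_ge by blast
  then have "length P - 1 \<le> card (nbrs E (hd P) \<inter> R)"
    using card_nbrs_split[of "hd P"] hd_nbrs \<open>card (nbrs E w \<inter> H) = 2\<close> k by simp
  then show "nbrs E (hd P) \<inter> R = set P - {hd P}"
    using longest_path_hd_degree(1)[OF P] P'(2) path_in_distinct[OF P'(1)]
    by (intro card_seteq) (auto simp: distinct_card)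
qed

lemma long_path_vertex_nbrs:
  assumes P: "longest_path E R P" and k: "length P + 1 = k"
    and w: "w \<in> R - set P" "card (nbrs E w \<inter> R) < length P" and v: "v \<in> set P"
  shows "nbrs E v \<inter> H = nbrs E w \<inter> H" "nbrs E v \<inter> R = set P - {v}"
proof -
  obtain P' where P': "path_in E P'" "set P' = set P" "hd P' = v"
    using path_in_start_anywhere[of E P v] long_path_hd_nbrs(2)[OF P k w] P v
    unfolding longest_path_def by blast
  have longest: "longest_path E R P'" using longest_path_same_set[OF P P'(1,2)] .
  then show "nbrs E v \<inter> H = nbrs E w \<inter> H" "nbrs E v \<inter> R = set P - {v}"
    using long_path_hd_nbrs[OF longest, of w] longest_path_length_eq[OF longest P] k w P'(2,3) by auto
qed

lemma long_path_vertex_outside_nbrs: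
  assumes P: "longest_path E R P" "length P + 1 = k" "v \<in> set P"
  shows "nbrs E v \<inter> R = set P - {v}"
proof -
  obtain Q where Q: "longest_path E (R - set P) Q" using ex_longest_path_beside[OF P(1)] .
  from long_path_vertex_nbrs(2)[OF P(1,2) longest_path_hd_in[OF Q]
      longest_path_beside_low(1)[OF P(1) Q] P(3)]
  show ?thesis .
qed

lemma long_paths_cover_outside:
  assumes P: "longest_path E R P" "length P + 1 = k" and w: "w \<in> R"
  obtains L where "longest_path E R L" "w \<in> set L"
proof -
  define D where "D = \<Union> {set L |L. longest_path E R L}"
  have "R - D = {}"
  proof (rule ccontr)
    assume "R - D \<noteq> {}"
    then obtain M where M: "longest_path E (R - D) M"
      using ex_longest_path[of "R - D"] finite_R by blast
    have x: "hd M \<in> R - D" using M by (rule longest_path_hd_in)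
    have "nbrs E (hd M) \<inter> D = {}"
    proof (rule ccontr)
      assume "nbrs E (hd M) \<inter> D \<noteq> {}"
      then obtain y L where y: "y \<in> nbrs E (hd M)" "y \<in> set L" and L: "longest_path E R L"
        unfolding D_def by blast
      have "length L = length P" using L P(1) by (rule longest_path_length_eq)
      then have "nbrs E y \<inter> R = set L - {y}"
        using long_path_vertex_outside_nbrs[OF L _ y(2)] P(2) by simp
      moreover have "hd M \<in> nbrs E y \<inter> R" using x y(1) by (auto simp: nbrs_def insert_commute)
      ultimately show False using x L unfolding D_def by blast
    qed
    then have "nbrs E (hd M) \<inter> R = nbrs E (hd M) \<inter> (R - D)" by blast
    then have low: "card (nbrs E (hd M) \<inter> R) < length M"
      using longest_path_hd_degree(2)[OF M] by simp
    have M_P: "path_in E M" "set M \<subseteq> R" "length M \<le> length P" "hd M \<in> set M"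
      using M P(1) unfolding longest_path_def by auto
    have "hd M \<notin> set P" using x P(1) unfolding D_def by blast
    then have "card (nbrs E (hd M) \<inter> R) = length P - 1"
      using low_vertices_nbrs(1)[OF P(1), of "{hd M}"] x low M_P(3) P(2) by auto
    then have "length M = length P" using low M_P(3) by linarith
    then have "longest_path E R M" using longest_path_of_length[OF P(1) M_P(1,2)] by simp
    then show False using x M_P(4) unfolding D_def by blast
  qed
  then show thesis using that w unfolding D_def by blast
qed

lemma blocks_outside_nbrs:
  assumes P: "longest_path E R P" "length P + 1 = k"
  obtains N where "N \<subseteq> H" "card N = 2" "\<And>w. w \<in> R \<Longrightarrow> nbrs E w \<inter> H = N"
proof -
  note len = longest_path_length_eq[OF _ P(1)]
  have low: "card (nbrs E w \<inter> R) < length P" if w: "w \<in> R" for w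
  proof -
    obtain L where L: "longest_path E R L" "w \<in> set L" using long_paths_cover_outside[OF P w] .
    have "nbrs E w \<inter> R \<subset> set L"
      using long_path_vertex_outside_nbrs[OF L(1) _ L(2)] len[OF L(1)] P(2) L(2) by auto
    then have "card (nbrs E w \<inter> R) < card (set L)" by (intro psubset_card_mono) auto
    then show ?thesis using card_length[of L] len[OF L(1)] by linarith
  qed
  obtain Q where Q: "longest_path E (R - set P) Q" using ex_longest_path_beside[OF P(1)] .
  define w0 where "w0 = hd Q"
  have w0: "w0 \<in> R - set P" unfolding w0_def using Q by (rule longest_path_hd_in)
  have hd_P: "hd P \<in> set P" using P(1) unfolding longest_path_def by simp
  show thesis
  proof (rule that)
    show "card (nbrs E w0 \<inter> H) = 2"
      using low_vertices_nbrs(2)[OF P(1), of "{w0}" w0] w0 low P(2) by auto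
    show "nbrs E w \<inter> H = nbrs E w0 \<inter> H" if w: "w \<in> R" for w
    proof (cases "w \<in> set P")
      case True
      then show ?thesis using long_path_vertex_nbrs(1)[OF P w0] w0 low by simp
    next
      case False
      then show ?thesis
        using long_path_vertex_nbrs(1)[OF P _ _ hd_P, of w]
          long_path_vertex_nbrs(1)[OF P w0 _ hd_P] w w0 low by simp
    qed
  qed auto
qed

lemma outside_structure:
  obtains N P where "longest_path E R P" "N \<subseteq> H"
    "length P = 1 \<and> card N = k \<or> length P = k - 1 \<and> card N = 2"
    "\<And>w. w \<in> R \<Longrightarrow> nbrs E w \<inter> H = N" "\<And>w. w \<in> R \<Longrightarrow> \<exists>L. longest_path E R L \<and> w \<in> set L"
    "\<And>L v. \<lbrakk>longest_path E R L; v \<in> set L\<rbrakk> \<Longrightarrow> nbrs E v \<inter> R = set L - {v}"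
proof -
  obtain P where P: "longest_path E R P" using ex_longest_path[OF finite_R R_nonempty] .
  note len = longest_path_length_eq[OF _ P]
  have "length P < k" using P outside_path_short unfolding longest_path_def by blast
  then consider (long) "length P + 1 = k" | (short) "length P + 2 \<le> k" by linarith
  then show thesis
  proof cases
    case long
    obtain N where N: "N \<subseteq> H" "card N = 2" "\<And>w. w \<in> R \<Longrightarrow> nbrs E w \<inter> H = N"
      using blocks_outside_nbrs[OF P long] by blast
    show thesis
    proof (rule that[OF P N(1) _ N(3)])
      show "\<exists>L. longest_path E R L \<and> w \<in> set L" if "w \<in> R" for w
        using long_paths_cover_outside[OF P long that] by blast
      show "nbrs E v \<inter> R = set L - {v}" if "longest_path E R L" "v \<in> set L" for L v
        using long_path_vertex_outside_nbrs[OF that(1) _ that(2)] len[OF that(1)] long by simp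
    qed (use long N(2) in auto)
  next
    case short
    have single: "length P = 1" using longest_path_trivial[OF P short] .
    obtain N where N: "N \<subseteq> H" "card N = k" "\<And>w. w \<in> R \<Longrightarrow> nbrs E w \<inter> H = N"
      and indep: "\<And>w. w \<in> R \<Longrightarrow> nbrs E w \<inter> R = {}"
      using independent_outside_nbrs[OF P single] short single by auto
    show thesis
    proof (rule that[OF P N(1) _ N(3)])
      show "\<exists>L. longest_path E R L \<and> w \<in> set L" if "w \<in> R" for w
        using longest_path_of_length[OF P, of "[w]"] that single by auto
      show "nbrs E v \<inter> R = set L - {v}" if L: "longest_path E R L" "v \<in> set L" for L v
      proof -
        have "length L = 1" using len[OF L(1)] single by simp
        then have "L = [v]" using L(2) by (cases L) auto
        moreover have "v \<in> R" using L unfolding longest_path_def by blast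
        ultimately show ?thesis using indep by simp
      qed
    qed (use single N(2) in auto)
  qed
qed

end

section \<open>Cliques glued along common vertices\<close>

text \<open>The graphs \<open>W\<close> and \<open>Z\<close> are the cases where \<open>N\<close> has \<open>k\<close> or \<open>2\<close> vertices and every block has
  \<open>1\<close> or \<open>k - 1\<close> vertices.\<close>

definition clique_book :: "'a set \<Rightarrow> 'a set \<Rightarrow> 'a set set \<Rightarrow> 'a ugraph" where
  "clique_book H N \<B> = \<lparr>verts = H \<union> \<Union>\<B>, edges = all_pairs H \<union> (\<Union>B\<in>\<B>. all_pairs (N \<union> B))\<rparr>"

definition is_clique_book :: "nat \<Rightarrow> nat \<Rightarrow> nat \<Rightarrow> nat \<Rightarrow> 'a ugraph \<Rightarrow> bool" where
  "is_clique_book n r s p G \<longleftrightarrow> finite (verts G) \<and> card (verts G) = n \<and>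
     (\<exists>H N \<B>. G = clique_book H N \<B> \<and> card H = r \<and> N \<subseteq> H \<and> card N = s \<and>
       partition_on (verts G - H) \<B> \<and> (\<forall>B\<in>\<B>. card B = p))"

lemma is_clique_bookI:
  assumes "finite (verts G)" "card (verts G) = n" "G = clique_book H N \<B>" "card H = r"
    and "N \<subseteq> H" "card N = s" "partition_on (verts G - H) \<B>" "\<And>B. B \<in> \<B> \<Longrightarrow> card B = p"
  shows "is_clique_book n r s p G"
  using assms unfolding is_clique_book_def by blast

lemma clique_book_adjacent_iff:
  "{u, v} \<in> edges (clique_book H N \<B>) \<longleftrightarrow>
     u \<noteq> v \<and> (u \<in> H \<and> v \<in> H \<or> (\<exists>B\<in>\<B>. u \<in> N \<union> B \<and> v \<in> N \<union> B))"
  by (auto simp: clique_book_def)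

lemma clique_book_edges_subset: "N \<subseteq> H \<Longrightarrow> edges (clique_book H N \<B>) \<subseteq> all_pairs (H \<union> \<Union>\<B>)"
  unfolding clique_book_def by (simp, intro conjI UN_least all_pairs_mono) auto

lemma edges_eq_clique_bookI:
  assumes E: "E \<subseteq> all_pairs V" "clique E H" and H: "H \<subseteq> V" "N \<subseteq> H"
    and part: "partition_on (V - H) \<B>"
    and nbrs: "\<And>B w. \<lbrakk>B \<in> \<B>; w \<in> B\<rbrakk> \<Longrightarrow> nbrs E w = N \<union> (B - {w})"
  shows "E = edges (clique_book H N \<B>)"
proof -
  have adjacent: "{u, v} \<in> E \<longleftrightarrow> {u, v} \<in> edges (clique_book H N \<B>)"
    if uv: "u \<in> V" "v \<in> V" "u \<noteq> v" for u v
  proof (cases "u \<in> H \<and> v \<in> H")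
    case True
    then show ?thesis using cliqueD[OF E(2)] uv(3) by (simp add: clique_book_adjacent_iff)
  next
    case False
    then obtain x y where xy: "{u, v} = {x, y}" "x \<in> V - H" "y \<in> V" "x \<noteq> y" using uv by auto
    then obtain B where B: "B \<in> \<B>" "x \<in> B" using partition_onD1[OF part] by blast
    have "B' = B" if "B' \<in> \<B>" "x \<in> B'" for B'
      using partition_onD2[OF part] that B unfolding disjoint_def by blast
    then have "{x, y} \<in> edges (clique_book H N \<B>) \<longleftrightarrow> y \<in> N \<union> B"
      unfolding clique_book_adjacent_iff using xy(2,4) B H(2) by blast
    then show ?thesis using nbrs[OF B] xy(4) unfolding xy(1) in_nbrs_iff[symmetric] by auto
  qed
  have "H \<union> \<Union>\<B> = V" using H(1) partition_onD1[OF part] by blast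
  then have "edges (clique_book H N \<B>) \<subseteq> all_pairs V"
    using clique_book_edges_subset[OF H(2), of \<B>] by simp
  then have "e \<in> all_pairs V" if "e \<in> E \<or> e \<in> edges (clique_book H N \<B>)" for e
    using that E(1) by blast
  then show ?thesis using adjacent by (auto elim!: all_pairsE)
qed

lemma card_partition_on:
  assumes "finite A" "partition_on A P" "\<And>B. B \<in> P \<Longrightarrow> card B = p"
  shows "p * card P = card A"
proof -
  have "p * card P = card (\<Union>P)"
    using assms partition_onD1[OF assms(2)] partition_onD2[OF assms(2)]
    by (intro card_partition finite_elements[OF assms(1,2)]) (auto simp: disjoint_def)
  then show ?thesis using partition_onD1[OF assms(2)] by simp
qed

lemma ex_bij_betw_partition:
  assumes A: "finite A" "partition_on A P" "\<And>X. X \<in> P \<Longrightarrow> card X = p"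
    and B: "finite B" "partition_on B Q" "\<And>Y. Y \<in> Q \<Longrightarrow> card Y = p"
    and card: "card A = card B" and p: "0 < p"
  obtains \<phi> where "bij_betw \<phi> A B" "(`) \<phi> ` P = Q"
proof -
  have "card P = card Q"
    using card_partition_on[OF A] card_partition_on[OF B] card p
    by (metis mult_left_cancel not_gr_zero)
  then obtain f where f: "bij_betw f P Q"
    using finite_same_card_bij finite_elements[OF A(1,2)] finite_elements[OF B(1,2)] by blast
  have "\<exists>g. bij_betw g X (f X)" if "X \<in> P" for X
  proof (rule finite_same_card_bij)
    have "f X \<in> Q" using f that bij_betwE by blast
    then have "card X = p" "card (f X) = p" using A(3) B(3) that by blast+
    then show "card X = card (f X)" "finite X" "finite (f X)"
      using p by (simp_all add: card_ge_0_finite)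
  qed
  then obtain g where g: "\<And>X. X \<in> P \<Longrightarrow> bij_betw (g X) X (f X)" by metis
  define \<phi> where "\<phi> x = g (THE X. X \<in> P \<and> x \<in> X) x" for x
  have "\<phi> x = g X x" if "X \<in> P" "x \<in> X" for x X
  proof -
    have "(THE X. X \<in> P \<and> x \<in> X) = X"
      using that partition_onD2[OF A(2)] by (intro the_equality) (auto simp: disjoint_def)
    then show ?thesis by (simp add: \<phi>_def)
  qed
  then have \<phi>: "bij_betw \<phi> X (f X)" if "X \<in> P" for X using g that by (simp cong: bij_betw_cong)
  have "disjoint_family_on f P"
    using partition_onD2[OF B(2)] f
    unfolding bij_betw_def by (intro disjoint_image_disjoint_family_on) simp_all
  then have "bij_betw \<phi> (\<Union>X\<in>P. X) (\<Union>X\<in>P. f X)" using \<phi> by (rule bij_betw_UNION_disjoint)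
  moreover have "(\<Union>X\<in>P. X) = A" "(\<Union>X\<in>P. f X) = B"
    using partition_onD1[OF A(2)] partition_onD1[OF B(2)] bij_betw_imp_surj_on[OF f] by auto
  moreover have "(`) \<phi> ` P = Q"
    using \<phi> f by (simp add: bij_betw_def cong: image_cong_simp)
  ultimately show thesis using that by simp
qed

lemma ex_bij_betw_subset:
  assumes "finite A" "finite B" "N \<subseteq> A" "M \<subseteq> B" "card A = card B" "card N = card M"
  obtains \<phi> where "bij_betw \<phi> A B" "\<phi> ` N = M"
proof -
  have fin: "finite N" "finite M" using assms finite_subset by auto
  obtain f where f: "bij_betw f N M" using finite_same_card_bij[OF fin assms(6)] by blast
  have "card (A - N) = card (B - M)" using assms fin by (simp add: card_Diff_subset)
  then obtain g where g: "bij_betw g (A - N) (B - M)"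
    using finite_same_card_bij[of "A - N" "B - M"] assms(1,2) by auto
  define \<phi> where "\<phi> x = (if x \<in> N then f x else g x)" for x
  have N: "bij_betw \<phi> N M" using f by (simp add: \<phi>_def cong: bij_betw_cong)
  moreover have "bij_betw \<phi> (A - N) (B - M)"
    using g bij_betw_cong[of "A - N" \<phi> g] by (simp add: \<phi>_def)
  ultimately have "bij_betw \<phi> (N \<union> (A - N)) (M \<union> (B - M))" by (rule bij_betw_combine) blast
  moreover have "N \<union> (A - N) = A" "M \<union> (B - M) = B" using assms(3,4) by auto
  ultimately show thesis using that bij_betw_imp_surj_on[OF N] by simp
qed

lemma graph_iso_clique_book_image:
  assumes "bij_betw \<phi> (H \<union> \<Union>\<B>) (H' \<union> \<Union>\<B>')" and "N \<subseteq> H"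
    and "\<phi> ` H = H'" "\<phi> ` N = N'" "(`) \<phi> ` \<B> = \<B>'"
  shows "graph_iso (clique_book H N \<B>) (clique_book H' N' \<B>')"
proof -
  have mem: "\<phi> u \<in> \<phi> ` S \<longleftrightarrow> u \<in> S" if "S \<subseteq> H \<union> \<Union>\<B>" "u \<in> H \<union> \<Union>\<B>" for S u
    using inj_on_image_mem_iff[OF bij_betw_imp_inj_on[OF assms(1)] that(2,1)] .
  have "{u, v} \<in> edges (clique_book H N \<B>) \<longleftrightarrow> {\<phi> u, \<phi> v} \<in> edges (clique_book H' N' \<B>')"
    if uv: "u \<in> H \<union> \<Union>\<B>" "v \<in> H \<union> \<Union>\<B>" for u v
  proof -
    have block: "\<phi> x \<in> N' \<union> \<phi> ` B \<longleftrightarrow> x \<in> N \<union> B" if "B \<in> \<B>" "x \<in> H \<union> \<Union>\<B>" for x B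
      using mem[of "N \<union> B" x] that assms(2,4) by (auto simp: image_Un)
    have clique: "\<phi> x \<in> H' \<longleftrightarrow> x \<in> H" if "x \<in> H \<union> \<Union>\<B>" for x using mem[of H x] that assms(3) by blast
    have "\<phi> u = \<phi> v \<longleftrightarrow> u = v" using assms(1) uv unfolding bij_betw_def inj_on_def by blast
    then show ?thesis
      unfolding clique_book_adjacent_iff using clique block uv by (auto simp flip: assms(5))
  qed
  then show ?thesis using assms(1) unfolding graph_iso_def clique_book_def by auto
qed

lemma graph_iso_if_is_clique_book:
  assumes G: "is_clique_book n r s p G" and G': "is_clique_book n r s p G'" and p: "0 < p"
  shows "graph_iso G G'"
proof -
  obtain H N \<B> where H: "G = clique_book H N \<B>" "finite (verts G)" "card (verts G) = n" "card H = r"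
    "N \<subseteq> H" "card N = s" "partition_on (verts G - H) \<B>" "\<And>B. B \<in> \<B> \<Longrightarrow> card B = p"
    using G unfolding is_clique_book_def by blast
  obtain H' N' \<B>' where H': "G' = clique_book H' N' \<B>'" "finite (verts G')" "card (verts G') = n"
    "card H' = r"
    "N' \<subseteq> H'" "card N' = s" "partition_on (verts G' - H') \<B>'" "\<And>B. B \<in> \<B>' \<Longrightarrow> card B = p"
    using G' unfolding is_clique_book_def by blast
  have V: "H \<subseteq> verts G" "H' \<subseteq> verts G'" unfolding H(1) H'(1) clique_book_def by auto
  then have fin: "finite H" "finite H'" using H(2) H'(2) finite_subset by auto
  obtain f where f: "bij_betw f H H'" "f ` N = N'"
    using ex_bij_betw_subset[OF fin H(5) H'(5)] H(4,6) H'(4,6) by auto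
  have "card (verts G - H) = card (verts G' - H')"
    using V fin H(3,4) H'(3,4) by (simp add: card_Diff_subset)
  then obtain g where g: "bij_betw g (verts G - H) (verts G' - H')" "(`) g ` \<B> = \<B>'"
    using ex_bij_betw_partition[OF _ H(7,8) _ H'(7,8)] H(2) H'(2) p by auto
  define \<phi> where "\<phi> x = (if x \<in> H then f x else g x)" for x
  have \<phi>_H: "\<phi> ` S = f ` S" if "S \<subseteq> H" for S using that by (auto simp: \<phi>_def)
  have \<phi>_B: "\<phi> ` B = g ` B" if "B \<in> \<B>" for B
    using that partition_onD1[OF H(7)] by (intro image_cong) (auto simp: \<phi>_def)
  have "bij_betw \<phi> H H'" "bij_betw \<phi> (verts G - H) (verts G' - H')"
    using f(1) g(1) bij_betw_cong[of H \<phi> f] bij_betw_cong[of "verts G - H" \<phi> g]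
    by (simp_all add: \<phi>_def)
  then have "bij_betw \<phi> (H \<union> (verts G - H)) (H' \<union> (verts G' - H'))" by (rule bij_betw_combine) blast
  then have "bij_betw \<phi> (H \<union> \<Union>\<B>) (H' \<union> \<Union>\<B>')"
    using partition_onD1[OF H(7)] partition_onD1[OF H'(7)] by simp
  moreover have "(`) \<phi> ` \<B> = \<B>'" using \<phi>_B g(2) by (simp cong: image_cong)
  ultimately show ?thesis
    using \<phi>_H[OF H(5)] \<phi>_H[of H] f bij_betw_imp_surj_on[OF f(1)] H(5)
    unfolding H(1) H'(1) by (intro graph_iso_clique_book_image) auto
qed

lemma is_clique_book_dvd:
  assumes "is_clique_book n r s p G"
  shows "p dvd n - r"
proof -
  obtain H N \<B> where H: "G = clique_book H N \<B>" "finite (verts G)" "card (verts G) = n" "card H = r"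
    "partition_on (verts G - H) \<B>" "\<And>B. B \<in> \<B> \<Longrightarrow> card B = p"
    using assms unfolding is_clique_book_def by blast
  have "H \<subseteq> verts G" unfolding H(1) clique_book_def by auto
  then have "card (verts G - H) = n - r" using H(2-4) by (metis card_Diff_subset finite_subset)
  then show ?thesis using card_partition_on[OF _ H(5,6)] H(2) by (metis dvd_triv_left finite_Diff)
qed

lemma is_clique_book_W_graph:
  assumes "k \<le> c + 1 - k" "c < n"
  shows "is_clique_book n (c + 1 - k) k 1 (W_graph n k c)"
proof -
  define r where "r = c + 1 - k"
  let ?\<B> = "(\<lambda>w. {w}) ` {r..<n}"
  have r: "k \<le> r" "r \<le> n" using assms unfolding r_def by auto
  have "all_pairs {..<r} \<union> (\<Union>w\<in>{r..<n}. all_pairs ({..<k} \<union> {w})) =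
      all_pairs {..<r} \<union> {{u, v} |u v. u \<in> {..<k} \<and> v \<in> {r..<n}}" (is "?L = ?R")
  proof
    show "?L \<subseteq> ?R"
    proof
      fix e assume "e \<in> ?L"
      then consider (clique) "e \<in> all_pairs {..<r}"
        | (page) w where "w \<in> {r..<n}" "e \<in> all_pairs ({..<k} \<union> {w})" by blast
      then show "e \<in> ?R"
      proof cases
        case page
        obtain u v where "e = {u, v}" "u \<in> {..<k} \<union> {w}" "v \<in> {..<k} \<union> {w}" "u \<noteq> v"
          using page(2) by (rule all_pairsE)
        then show ?thesis
          using page(1) r by (cases "u = w"; cases "v = w") (auto simp: insert_commute)
      qed simp
    qed
    show "?R \<subseteq> ?L" using r by fastforce
  qed
  then have W: "W_graph n k c = clique_book {..<r} {..<k} ?\<B>"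
    using r(2) unfolding W_graph_def clique_book_def r_def[symmetric] by auto
  have "verts (W_graph n k c) = {..<n}" "{..<n} - {..<r} = {r..<n}" by (auto simp: W_graph_def)
  then show ?thesis
    unfolding r_def[symmetric] using r(1) partition_on_singletons
    by (intro is_clique_bookI[OF _ _ W]) auto
qed

lemma partition_on_consecutive_intervals:
  fixes r p q :: nat
  assumes "0 < p"
  shows "partition_on {r..<r + q * p} ((\<lambda>i. {r + i * p..<r + (i + 1) * p}) ` {..<q})"
proof (induction q)
  case 0
  then show ?case by (simp add: partition_on_empty)
next
  case (Suc q)
  let ?f = "\<lambda>i. {r + i * p..<r + (i + 1) * p}"
  have "\<Union> (?f ` {..<q}) = {r..<r + q * p}" using partition_onD1[OF Suc] by simp
  then have "disjnt (?f q) (\<Union> (?f ` {..<q}))" by (auto simp: disjnt_def)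
  moreover have "{r..<r + Suc q * p} - ?f q = {r..<r + q * p}" "?f q \<subseteq> {r..<r + Suc q * p}"
    "?f q \<noteq> {}"
    using assms by auto
  ultimately show ?case
    using Suc by (simp only: lessThan_Suc image_insert partition_on_insert simp_thms)
qed

lemma is_clique_book_Z_graph:
  assumes k: "2 \<le> k" and r: "2 \<le> c + 1 - k" "c < n" and dvd: "k - 1 dvd n - (c + 1 - k)"
  shows "is_clique_book n (c + 1 - k) 2 (k - 1) (Z_graph n k c)"
proof -
  define r q where "r = c + 1 - k" and "q = (n - r) div (k - 1)"
  define \<B> where "\<B> = (\<lambda>i. {r + i * (k - 1)..<r + (i + 1) * (k - 1)}) ` {..<q}"
  have r': "2 \<le> r" "r \<le> n" using assms unfolding r_def by auto
  have n: "n = r + q * (k - 1)" using dvd r' unfolding q_def r_def by simp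
  have part: "partition_on {r..<n} \<B>"
    using partition_on_consecutive_intervals[of "k - 1" r q] k unfolding \<B>_def n by simp
  have "Z_cliques n k c = insert {..<r} ((\<union>) {0, 1} ` \<B>)"
    unfolding Z_cliques_def \<B>_def r_def[symmetric] q_def[symmetric] by (auto simp: image_image)
  moreover have "{..<r} \<union> \<Union> ((\<union>) {0, 1} ` \<B>) = {..<r} \<union> \<Union>\<B>" using r'(1) by auto
  ultimately have Z: "Z_graph n k c = clique_book {..<r} {0, 1} \<B>"
    unfolding Z_graph_def clique_book_def by simp
  then have "verts (Z_graph n k c) = {..<n}"
    using partition_onD1[OF part] r'(2) unfolding clique_book_def by auto
  moreover have "{..<n} - {..<r} = {r..<n}" by auto
  moreover have "card B = k - 1" if "B \<in> \<B>" for B using that unfolding \<B>_def by auto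
  ultimately show ?thesis
    unfolding r_def[symmetric] using part r'(1) by (intro is_clique_bookI[OF _ _ Z]) auto
qed

section \<open>The longest cycle covers the clique\<close>

lemma cycle_in_starting_at:
  assumes "cycle_in E C" "x \<in> set C"
  obtains D where "cycle_in E D" "set D = set C" "hd D = x"
proof -
  obtain A B where C: "C = A @ B" "B \<noteq> []" "hd B = x"
    using assms(2) by (metis list.distinct(1) list.sel(1) split_list)
  then have "cycle_in E (B @ A)"
    using assms(1) unfolding C(1) cycle_in_def by (cases "A = []") (auto simp: path_in_append)
  then show thesis using that[of "B @ A"] C by auto
qed

lemma path_length_le_cut:
  assumes "path_in E P" "P \<noteq> []" "hd P \<in> N"
    and "\<And>Q. \<lbrakk>path_in E Q; set Q \<subseteq> set P - N\<rbrakk> \<Longrightarrow> length Q \<le> p"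
  shows "length P \<le> card (N \<inter> set P) * (p + 1)"
  using assms
proof (induction "length P" arbitrary: P rule: less_induct)
  case less
  obtain x ys where P: "P = x # ys" using less.prems(2) by (cases P) auto
  define Q Z where "Q = takeWhile (\<lambda>v. v \<notin> N) ys" and "Z = dropWhile (\<lambda>v. v \<notin> N) ys"
  have ys: "ys = Q @ Z" unfolding Q_def Z_def by simp
  have paths: "path_in E Q" "path_in E Z" "x \<notin> set ys"
    using less.prems(1) unfolding P ys by (auto simp: path_in_Cons path_in_append)
  have QN: "set Q \<inter> N = {}" unfolding Q_def by (auto dest: set_takeWhileD)
  then have "length Q \<le> p" using paths(1) less.prems(4)[of Q] unfolding P ys by auto
  have x: "x \<in> N" using less.prems(3) P by simp
  have "length Z \<le> card (N \<inter> set Z) * (p + 1)"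
  proof (cases "Z = []")
    case False
    then have "hd Z \<in> N" using hd_dropWhile[of "\<lambda>v. v \<notin> N" ys] unfolding Z_def by blast
    moreover have "length Q' \<le> p" if "path_in E Q'" "set Q' \<subseteq> set Z - N" for Q'
      using less.prems(4)[OF that(1)] that(2) unfolding P ys by auto
    ultimately show ?thesis using less.hyps paths(2) False unfolding P ys by auto
  qed simp
  moreover have "N \<inter> set P = insert x (N \<inter> set Z)" "x \<notin> N \<inter> set Z"
    using x QN paths(3) unfolding P ys by auto
  then have "card (N \<inter> set P) = Suc (card (N \<inter> set Z))" by simp
  ultimately show ?case using \<open>length Q \<le> p\<close> unfolding P ys by simp
qed

lemma cycle_length_le_cut:
  assumes C: "cycle_in E C" and "N \<inter> set C \<noteq> {}"
    and paths: "\<And>Q. \<lbrakk>path_in E Q; set Q \<subseteq> set C - N\<rbrakk> \<Longrightarrow> length Q \<le> p"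
  shows "length C \<le> card (N \<inter> set C) * (p + 1)"
proof -
  obtain x where x: "x \<in> N" "x \<in> set C" using assms(2) by blast
  obtain D where D: "cycle_in E D" "set D = set C" "hd D = x"
    using cycle_in_starting_at[OF C x(2)] .
  have "length D \<le> card (N \<inter> set D) * (p + 1)"
    using D x(1) paths unfolding cycle_in_def by (intro path_length_le_cut) auto
  then show ?thesis using length_cycle_in[OF C] length_cycle_in[OF D(1)] D(2) by simp
qed

lemma (in circumference_clique) clique_subset_cycle:
  assumes C: "cycle_in E C" "length C = c" and N: "N \<subseteq> H" "\<And>w. w \<in> R \<Longrightarrow> nbrs E w \<inter> H = N"
    and paths: "\<And>Q. \<lbrakk>path_in E Q; set Q \<subseteq> R\<rbrakk> \<Longrightarrow> length Q \<le> p" and small: "card N * (p + 1) < c"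
  shows "H \<subseteq> set C"
proof (rule ccontr)
  assume "\<not> H \<subseteq> set C"
  then obtain h where h: "h \<in> H" "h \<notin> set C" by blast
  have CV: "set C \<subseteq> V" using cycle_in_subset[OF edges_V C(1)] .
  have "x \<in> N" if x: "x \<in> set C" "x \<in> H" for x
  proof -
    obtain D where D: "cycle_in E D" "set D = set C" "hd D = x"
      using cycle_in_starting_at[OF C(1) x(1)] .
    have D': "path_in E D" "D \<noteq> []" "{last D, x} \<in> E" using D unfolding cycle_in_def by auto
    have "last D \<notin> H"
    proof
      assume "last D \<in> H"
      moreover have "last D \<in> set C" using D(2) D'(2) last_in_set by blast
      ultimately have "{last D, h} \<in> E" "{h, x} \<in> E" using cliqueD[OF clique_H] h x by metis+
      then have "cycle_in E (D @ [h])"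
        using D D' h(2) unfolding cycle_in_def by (auto simp: path_in_append)
      then have "length (D @ [h]) \<le> c" by (rule cycle_le)
      then show False using length_cycle_in[OF C(1)] length_cycle_in[OF D(1)] D(2) C(2) by simp
    qed
    then have "last D \<in> R" using D(2) D'(2) CV last_in_set by blast
    then have "nbrs E (last D) \<inter> H = N" by (rule N(2))
    then show "x \<in> N" using D'(3) x(2) by (auto simp: in_nbrs_iff)
  qed
  then have outside: "set C - N \<subseteq> R" using CV by blast
  have "N \<inter> set C \<noteq> {}"
  proof
    assume "N \<inter> set C = {}"
    then have "length C < k" using C(1) outside outside_path_short unfolding cycle_in_def by blast
    then show False using C(2) two_k_le by simp
  qed
  moreover have "length Q \<le> p" if "path_in E Q" "set Q \<subseteq> set C - N" for Q
    using paths[OF that(1)] that(2) outside by simp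
  ultimately have "c \<le> card (N \<inter> set C) * (p + 1)" using cycle_length_le_cut[OF C(1)] C(2) by simp
  also have "\<dots> \<le> card N * (p + 1)"
    using N(1) finite_H finite_subset by (intro mult_right_mono card_mono) auto
  finally show False using small by simp
qed

section \<open>The closure\<close>

lemma degree_eq_card_nbrs:
  assumes "simple_graph G"
  shows "degree G v = card (nbrs (edges G) v)"
proof -
  have "e \<in> (\<lambda>w. {v, w}) ` nbrs (edges G) v" if "e \<in> edges G" "v \<in> e" for e
  proof -
    have "e \<in> all_pairs (verts G)" using assms that(1) by (auto simp: simple_graph_def)
    then obtain a b where "e = {a, b}" by (rule all_pairsE)
    then show ?thesis using that by (auto simp: nbrs_def insert_commute)
  qed
  then have "(\<lambda>w. {v, w}) ` nbrs (edges G) v = {e \<in> edges G. v \<in> e}" by (auto simp: nbrs_def)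
  moreover have "inj_on (\<lambda>w. {v, w}) (nbrs (edges G) v)" by (auto simp: inj_on_def doubleton_eq_iff)
  ultimately show ?thesis unfolding degree_def by (metis card_image)
qed

lemma degree_mono:
  assumes "simple_graph H" "edges G \<subseteq> edges H"
  shows "degree G v \<le> degree H v"
  unfolding degree_def using assms finite_edges[OF assms(1)] by (intro card_mono) auto

lemma m_closure_eqI:
  assumes G: "simple_graph G" and T: "simple_graph T" "verts T = verts G" "edges G \<subseteq> edges T"
    and closed: "\<nexists>L. closure_step m T L"
    and new: "\<And>u v. \<lbrakk>{u, v} \<in> edges T; {u, v} \<notin> edges G\<rbrakk> \<Longrightarrow> m \<le> degree G u + degree G v"
  shows "m_closure m G = T"
proof -
  define M where "M = m_closure m G"
  have steps: "(closure_step m)\<^sup>*\<^sup>* G M" and M_closed: "\<nexists>L. closure_step m M L"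
    using is_closure_m_closure[OF G] unfolding M_def is_closure_def by auto
  have M: "simple_graph M" "verts M = verts G" using closure_steps_simple[OF steps G] by auto
  have "edges M \<subseteq> edges T" using closure_steps_below[OF steps T closed] by blast
  moreover have "edges T \<subseteq> edges M"
  proof
    fix e assume e: "e \<in> edges T"
    then have "e \<in> all_pairs (verts G)" using T(1,2) by (auto simp: simple_graph_def)
    then obtain u v where uv: "e = {u, v}" "u \<in> verts M" "v \<in> verts M" "u \<noteq> v"
      unfolding M(2) by (rule all_pairsE)
    show "e \<in> edges M"
    proof (rule ccontr)
      assume "e \<notin> edges M"
      then have "m \<le> degree G u + degree G v"
        using new e closure_steps_mono[OF steps] uv(1) by blast
      also have "\<dots> \<le> degree M u + degree M v"
        using degree_mono[OF M(1) closure_steps_mono[OF steps]] by (intro add_mono)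
      finally show False using M_closed uv \<open>e \<notin> edges M\<close> unfolding closure_step_def by blast
    qed
  qed
  ultimately show ?thesis using M(2) T(2) unfolding M_def by (intro ugraph.equality) auto
qed

lemma C_closure_eqI:
  assumes "m_closure (length C + 1) (induced G (set C)) = induced (G\<lparr>edges := F\<rparr>) (set C)"
    and "edges G \<subseteq> F" "\<And>e. \<lbrakk>e \<in> F; e \<notin> edges G\<rbrakk> \<Longrightarrow> e \<subseteq> set C"
  shows "C_closure G C = G\<lparr>edges := F\<rparr>"
proof -
  have "edges G - edges (induced G (set C)) \<union> edges (induced (G\<lparr>edges := F\<rparr>) (set C)) = F"
    using assms(2,3) by (auto simp: induced_def)
  then show ?thesis unfolding C_closure_def assms(1) by simp
qed

text \<open>A missing edge of the clique lowers the sum of the two degrees by one, and by two only if it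
  joins \<open>u\<close> and \<open>v\<close>.\<close>

lemma nearly_clique_degree_sum:
  assumes fin: "finite H" "finite F" and loopfree: "\<And>v. {v} \<notin> E" and clique: "clique F H"
    and uv: "u \<in> H" "v \<in> H" "u \<noteq> v"
  shows "2 * card H \<le> card (nbrs E u \<inter> H) + card (nbrs E v \<inter> H) + card (F - E) + 3"
proof -
  define A where "A x = (\<lambda>y. {x, y}) ` (H - {x} - nbrs E x)" for x
  have deg: "card H = card (nbrs E x \<inter> H) + card (A x) + 1" if "x \<in> H" for x
  proof -
    have "card (A x) = card (H - {x} - nbrs E x)"
      unfolding A_def by (rule card_image) (auto simp: inj_on_def doubleton_eq_iff)
    moreover have "nbrs E x \<inter> H \<subseteq> H - {x}" "H - {x} - nbrs E x = (H - {x}) - (nbrs E x \<inter> H)"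
      using loopfree[of x] by (auto simp: nbrs_def)
    then have "card (H - {x} - nbrs E x) = card (H - {x}) - card (nbrs E x \<inter> H)"
        "card (nbrs E x \<inter> H) \<le> card (H - {x})"
      using fin(1) by (auto simp: card_Diff_subset card_mono)
    moreover have "card H = Suc (card (H - {x}))" using that fin(1) by (metis card_Suc_Diff1)
    ultimately show ?thesis by simp
  qed
  have "A x \<subseteq> F - E" if "x \<in> H" for x
    unfolding A_def using cliqueD[OF clique that] by (auto simp: nbrs_def)
  then have "card (A u \<union> A v) \<le> card (F - E)" using uv fin(2) by (intro card_mono) auto
  moreover have "A u \<inter> A v \<subseteq> {{u, v}}" unfolding A_def using uv(3) by (auto simp: doubleton_eq_iff)
  then have "card (A u \<inter> A v) \<le> 1" using card_mono[of "{{u, v}}"] by fastforce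
  moreover have "card (A u) + card (A v) = card (A u \<union> A v) + card (A u \<inter> A v)"
    unfolding A_def using fin(1) by (intro card_Un_Int) auto
  ultimately show ?thesis using deg[OF uv(1)] deg[OF uv(2)] by linarith
qed

context circumference_clique begin

lemma nonadjacent_degree_sum:
  assumes deg: "\<And>w. w \<in> R \<Longrightarrow> card (nbrs E w) = k" and N: "\<And>w. w \<in> R \<Longrightarrow> nbrs E w \<inter> H = N"
    and uv: "u \<in> V" "v \<in> V" "u \<noteq> v" "{u, v} \<notin> E"
  shows "card (nbrs E u) + card (nbrs E v) \<le> c"
proof -
  have outside_sum: "card (nbrs E w) + card (nbrs E x) \<le> c" if w: "w \<in> R"
    and x: "x \<in> V" "{w, x} \<notin> E" for w x
  proof (cases "x \<in> H")
    case True
    have "x \<notin> N" using N[OF w] True x(2) by (auto simp: nbrs_def)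
    then have "nbrs E x \<inter> R = {}" using N True by (auto simp: nbrs_def insert_commute)
    then have "nbrs E x \<subseteq> H - {x}" using nbrs_V by blast
    then have "card (nbrs E x) \<le> card (H - {x})" using finite_H by (intro card_mono) auto
    also have "\<dots> = card H - 1" using True by simp
    finally show ?thesis using deg[OF w] card_H two_k_le by simp
  qed (use deg w x two_k_le in simp)
  have "u \<in> R \<or> v \<in> R" using uv cliqueD[OF clique_H] by blast
  then show ?thesis using outside_sum[of u v] outside_sum[of v u] uv by (auto simp: insert_commute)
qed

lemma m_closure_eq_induced:
  assumes G: "simple_graph G" "edges G \<subseteq> E" "verts G = V" and C: "set C \<subseteq> V" "H \<subseteq> set C"
    and outside: "\<And>w. w \<in> R \<Longrightarrow> nbrs (edges G) w = nbrs E w" "\<And>w. w \<in> R \<Longrightarrow> card (nbrs E w) = k"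
      "\<And>w. w \<in> R \<Longrightarrow> nbrs E w \<inter> H = N"
    and few: "card (E - edges G) + 3 * k + 2 \<le> c"
  shows "m_closure (c + 1) (induced G (set C)) = induced (G\<lparr>edges := E\<rparr>) (set C)"
proof (rule m_closure_eqI)
  let ?T = "induced (G\<lparr>edges := E\<rparr>) (set C)"
  show T: "simple_graph ?T"
    using edges_V finite_V G(3) by (intro simple_graph_induced) (simp add: simple_graph_def)
  show "simple_graph (induced G (set C))" using G(1) by (rule simple_graph_induced)
  show "verts ?T = verts (induced G (set C))" "edges (induced G (set C)) \<subseteq> edges ?T"
    using G(2) by (auto simp: induced_def)
  have "degree ?T v \<le> card (nbrs E v)" for v
    unfolding degree_eq_card_nbrs[OF T]
    using fin_nbrs by (intro card_mono) (auto simp: induced_def nbrs_def)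
  then have "degree ?T u + degree ?T v < c + 1" if "u \<in> V" "v \<in> V" "u \<noteq> v" "{u, v} \<notin> E" for u v
    using nonadjacent_degree_sum[OF outside(2,3) that]
    by (meson add_mono le_less_trans less_add_one order_trans)
  then show "\<nexists>L. closure_step (c + 1) ?T L"
    using G(3) unfolding closure_step_def induced_def by fastforce
  have deg: "card (nbrs (edges G) x \<inter> H) \<le> degree (induced G (set C)) x" if "x \<in> H" for x
  proof -
    have "nbrs (edges G) x \<inter> H \<subseteq> nbrs (edges (induced G (set C))) x"
      using that C(2) by (auto simp: induced_def nbrs_def)
    moreover have "nbrs (edges (induced G (set C))) x \<subseteq> nbrs E x"
      using G(2) by (auto simp: induced_def nbrs_def)
    then have "finite (nbrs (edges (induced G (set C))) x)" using fin_nbrs finite_subset by blast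
    ultimately show ?thesis
      unfolding degree_eq_card_nbrs[OF simple_graph_induced[OF G(1)]] by (intro card_mono)
  qed
  fix u v assume uv: "{u, v} \<in> edges ?T" "{u, v} \<notin> edges (induced G (set C))"
  then have new: "{u, v} \<in> E" "{u, v} \<notin> edges G" by (auto simp: induced_def)
  then have uv_V: "u \<in> V" "v \<in> V" "u \<noteq> v" using edge_in_all_pairs[OF new(1) edges_V] by auto
  have "x \<in> H" if "y \<in> nbrs E x" "y \<notin> nbrs (edges G) x" "x \<in> V" for x y
    using outside(1)[of x] that by blast
  then have "u \<in> H" "v \<in> H" using new uv_V by (metis in_nbrs_iff, metis in_nbrs_iff')
  moreover have "{x} \<notin> edges G" for x using G(2) loopfree by blast
  ultimately have "2 * card H \<le>
      card (nbrs (edges G) u \<inter> H) + card (nbrs (edges G) v \<inter> H) + card (E - edges G) + 3"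
    using finite_H finite_subset[OF edges_V finite_all_pairs[OF finite_V]] clique_H uv_V(3)
    by (intro nearly_clique_degree_sum)
  then show "c + 1 \<le> degree (induced G (set C)) u + degree (induced G (set C)) v"
    using deg[OF \<open>u \<in> H\<close>] deg[OF \<open>v \<in> H\<close>] few card_H two_k_le by linarith
qed

lemma longest_paths_partition:
  assumes cover: "\<And>w. w \<in> R \<Longrightarrow> \<exists>L. longest_path E R L \<and> w \<in> set L"
    and block: "\<And>L v. \<lbrakk>longest_path E R L; v \<in> set L\<rbrakk> \<Longrightarrow> nbrs E v \<inter> R = set L - {v}"
  shows "partition_on R {set L |L. longest_path E R L}" (is "partition_on R ?\<B>")
proof (rule partition_onI)
  have "w \<in> \<Union>?\<B>" if "w \<in> R" for w using cover[OF that] by blast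
  then show "\<Union>?\<B> = R" unfolding longest_path_def by blast
  show "disjnt A B" if AB: "A \<in> ?\<B>" "B \<in> ?\<B>" "A \<noteq> B" for A B
  proof (rule ccontr)
    assume "\<not> disjnt A B"
    then obtain v where v: "v \<in> A" "v \<in> B" by (auto simp: disjnt_def)
    have "nbrs E v \<inter> R = A - {v}" "nbrs E v \<inter> R = B - {v}" using block AB(1,2) v by blast+
    then show False using v AB(3) by blast
  qed
  show "{} \<notin> ?\<B>" by (auto simp: longest_path_def)
qed

lemma outside_clique_book:
  obtains N p \<B> where "N \<subseteq> H" "p = 1 \<and> card N = k \<or> p = k - 1 \<and> card N = 2"
    "partition_on R \<B>" "\<And>B. B \<in> \<B> \<Longrightarrow> card B = p" "E = edges (clique_book H N \<B>)"
    "\<And>Q. \<lbrakk>path_in E Q; set Q \<subseteq> R\<rbrakk> \<Longrightarrow> length Q \<le> p" "\<And>w. w \<in> R \<Longrightarrow> nbrs E w \<inter> H = N"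
    "\<And>w. w \<in> R \<Longrightarrow> card (nbrs E w) = k"
proof -
  obtain N P where P: "longest_path E R P" and N: "N \<subseteq> H"
      "length P = 1 \<and> card N = k \<or> length P = k - 1 \<and> card N = 2" "\<And>w. w \<in> R \<Longrightarrow> nbrs E w \<inter> H = N"
    and cover: "\<And>w. w \<in> R \<Longrightarrow> \<exists>L. longest_path E R L \<and> w \<in> set L"
    and block: "\<And>L v. \<lbrakk>longest_path E R L; v \<in> set L\<rbrakk> \<Longrightarrow> nbrs E v \<inter> R = set L - {v}"
    by (rule outside_structure, rule that)
  define \<B> where "\<B> = {set L |L. longest_path E R L}"
  have part: "partition_on R \<B>" unfolding \<B>_def by (rule longest_paths_partition[OF cover block])
  have card_block: "card B = length P" if "B \<in> \<B>" for B
  proof -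
    obtain L where L: "B = set L" "longest_path E R L" using \<open>B \<in> \<B>\<close> unfolding \<B>_def by blast
    then have "length L = length P" using longest_path_length_eq P by blast
    then show ?thesis using L path_in_distinct distinct_card unfolding longest_path_def by metis
  qed
  have R_nbrs: "nbrs E w \<inter> R = B - {w}" if "B \<in> \<B>" "w \<in> B" for w B
    using that block unfolding \<B>_def by blast
  show thesis
  proof (rule that[OF N(1,2) part card_block _ _ N(3)])
    show "E = edges (clique_book H N \<B>)"
    proof (rule edges_eq_clique_bookI[OF edges_V clique_H H_V N(1) part])
      fix B w assume B: "B \<in> \<B>" "w \<in> B"
      then have "nbrs E w \<inter> H = N" using N(3) partition_onD1[OF part] by blast
      then show "nbrs E w = N \<union> (B - {w})" using R_nbrs[OF B] nbrs_V[of w] by blast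
    qed
    show "length Q \<le> length P" if "path_in E Q" "set Q \<subseteq> R" for Q
      using P that unfolding longest_path_def by blast
    show "card (nbrs E w) = k" if w: "w \<in> R" for w
    proof -
      obtain B where B: "B \<in> \<B>" "w \<in> B" using w partition_onD1[OF part] by blast
      then have "card (nbrs E w \<inter> R) = length P - 1" using R_nbrs[OF B] card_block[OF B(1)] by simp
      moreover have "1 \<le> length P" using P unfolding longest_path_def by (cases P) auto
      ultimately show ?thesis using card_nbrs_split[of w] N(2,3) w k_ge_2 by auto
    qed
  qed
qed

theorem C_closure_is_clique_book:
  assumes G: "simple_graph G" "verts G = V" "edges G \<subseteq> E" "\<And>v. v \<in> V \<Longrightarrow> k \<le> card (nbrs (edges G) v)"
    and C: "cycle_in (edges G) C" "length C = c" and few: "card (E - edges G) + 3 * k + 2 \<le> c"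
  obtains s p where "is_clique_book (card V) (c + 1 - k) s p (C_closure G C)"
    "p = 1 \<and> s = k \<or> p = k - 1 \<and> s = 2"
proof -
  obtain N p \<B> where N: "N \<subseteq> H" "p = 1 \<and> card N = k \<or> p = k - 1 \<and> card N = 2"
    and \<B>: "partition_on R \<B>" "\<And>B. B \<in> \<B> \<Longrightarrow> card B = p" "E = edges (clique_book H N \<B>)"
    and paths: "\<And>Q. \<lbrakk>path_in E Q; set Q \<subseteq> R\<rbrakk> \<Longrightarrow> length Q \<le> p"
    and outside: "\<And>w. w \<in> R \<Longrightarrow> nbrs E w \<inter> H = N" "\<And>w. w \<in> R \<Longrightarrow> card (nbrs E w) = k"
    by (rule outside_clique_book, rule that)
  have cycle: "cycle_in E C" "set C \<subseteq> V"
    using cycle_in_mono[OF C(1) G(3)] cycle_in_subset[OF edges_V] by auto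
  have "card N * (p + 1) < c" using N(2) two_k_le k_ge_2 by auto
  then have HC: "H \<subseteq> set C"
    using clique_subset_cycle[OF cycle(1) C(2) N(1) outside(1) paths] by blast
  have same: "nbrs (edges G) w = nbrs E w" if "w \<in> R" for w
    using G(4)[of w] outside(2)[OF that] that by (intro card_seteq fin_nbrs nbrs_mono G(3)) auto
  have "C_closure G C = G\<lparr>edges := E\<rparr>"
  proof (rule C_closure_eqI)
    show "m_closure (length C + 1) (induced G (set C)) = induced (G\<lparr>edges := E\<rparr>) (set C)"
      using m_closure_eq_induced[OF G(1,3,2) cycle(2) HC same outside(2,1) few] C(2) by simp
    show "e \<subseteq> set C" if e: "e \<in> E" "e \<notin> edges G" for e
    proof -
      obtain u v where uv: "e = {u, v}" using e(1) edges_V by (meson all_pairsE subsetD)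
      then have "v \<in> nbrs E u" "v \<notin> nbrs (edges G) u" "u \<in> nbrs E v" "u \<notin> nbrs (edges G) v"
        using e by (auto simp: nbrs_def insert_commute)
      then have "u \<in> H" "v \<in> H" using same nbrs_V by blast+
      then show ?thesis using uv HC by blast
    qed
  qed (rule G(3))
  moreover have "G\<lparr>edges := E\<rparr> = clique_book H N \<B>"
    using \<B>(3) H_V G(2) partition_onD1[OF \<B>(1)]
    by (intro ugraph.equality) (auto simp: clique_book_def)
  moreover have "verts (C_closure G C) = V" using G(2) by (simp add: C_closure_def)
  ultimately have "is_clique_book (card V) (c + 1 - k) (card N) p (C_closure G C)"
    using \<B>(1,2) N(1) card_H finite_V
    by (intro is_clique_bookI[where H = H and N = N and \<B> = \<B>]) auto
  then show thesis using that N(2) by blast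
qed

end

section \<open>Two-connected graphs with many edges\<close>

lemma is_cycle_iff_cycle_in: "is_cycle G C \<longleftrightarrow> cycle_in (edges G) C \<and> set C \<subseteq> verts G"
proof (cases "3 \<le> length C")
  case True
  then obtain m where m: "length C = Suc m" by (cases C) auto
  then have "C \<noteq> []" by auto
  then have "hd C = C ! 0" "last C = C ! m" using m by (simp_all add: hd_conv_nth last_conv_nth)
  moreover have "(\<forall>i<length C. {C ! i, C ! (Suc i mod length C)} \<in> edges G) \<longleftrightarrow>
    {C ! m, C ! 0} \<in> edges G \<and> (\<forall>i<m. {C ! i, C ! Suc i} \<in> edges G)"
    unfolding m by (auto simp: All_less_Suc)
  ultimately show ?thesis
    using True m unfolding is_cycle_def cycle_in_def path_in_def successively_conv_nth by auto
qed (simp add: is_cycle_def cycle_in_def)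

lemma biconnected_if_two_connected:
  assumes "two_connected G" "finite (verts G)"
  shows "biconnected (verts G) (edges G)"
  unfolding biconnected_def
proof (intro conjI ballI allI impI)
  show "3 \<le> card (verts G)" using assms unfolding two_connected_def by simp
  fix z S assume z: "z \<in> verts G" and S: "S \<subseteq> verts G - {z} \<and> S \<noteq> {} \<and> S \<noteq> verts G - {z}"
  let ?I = "induced G (verts G - {z})"
  have "graph_connected ?I" using assms z unfolding two_connected_def by simp
  moreover obtain u w where uw: "u \<in> S" "w \<in> verts G - {z} - S" using S by blast
  ultimately have "(u, w) \<in> {(x, y). {x, y} \<in> edges ?I}\<^sup>*"
    using S unfolding graph_connected_def induced_def by auto
  then show "\<exists>u\<in>S. \<exists>w\<in>verts G - {z} - S. {u, w} \<in> edges G"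
    using uw(2)
  proof (induction rule: rtrancl_induct)
    case base
    then show ?case using uw(1) by blast
  next
    case (step y w)
    have "{y, w} \<in> edges G" "{y, w} \<subseteq> verts G - {z}" using step.hyps unfolding induced_def by auto
    then show ?case using step.IH step.prems by (cases "y \<in> S") blast+
  qed
qed

lemma bounded_circumference_if_longest_cycle:
  assumes "simple_graph G" "two_connected G" "longest_cycle G C"
  shows "bounded_circumference (verts G) (edges G) (length C)"
proof
  show fin: "finite (verts G)" and sub: "edges G \<subseteq> all_pairs (verts G)"
    using assms(1) by (auto simp: simple_graph_def)
  show "biconnected (verts G) (edges G)" using biconnected_if_two_connected[OF assms(2) fin] .
  show "3 \<le> length C" using assms(3) by (simp add: longest_cycle_def is_cycle_def)
  show "length D \<le> length C" if "cycle_in (edges G) D" for D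
    using assms(3) that cycle_in_subset[OF sub that]
    by (simp add: longest_cycle_def is_cycle_iff_cycle_in)
qed

lemma degree_ge_if_min_degree_ge:
  assumes "simple_graph G" "k \<le> min_degree G" "v \<in> verts G"
  shows "k \<le> card (nbrs (edges G) v)"
proof -
  have "min_degree G \<le> degree G v"
    using assms(1,3) unfolding min_degree_def simple_graph_def by (intro Min_le) auto
  then show ?thesis using assms(2) degree_eq_card_nbrs[OF assms(1)] by simp
qed

lemma (in edge_maximal) few_missing_edges:
  assumes "c < card V" "k + 1 \<le> c" "E' \<subseteq> E" "f_edges (card V) (k + 1) c < card E'"
    "card E \<le> f_edges (card V) k c"
  shows "card (E - E') + 3 * k + 2 \<le> c"
proof -
  have "card E' + card (E - E') = card E"
    using assms(3) finite_subset[OF edges_V finite_all_pairs[OF finite_V]]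
    by (metis card_Diff_subset card_mono finite_subset le_add_diff_inverse)
  then show ?thesis using missing_edges_bound[OF assms(1,2,4)] assms(5) by simp
qed

theorem closure_of_many_edges:
  fixes G :: "'a ugraph"
  assumes G: "simple_graph G" "two_connected G" "k \<le> min_degree G"
    and C: "longest_cycle G C" "length C = c" and n: "card (verts G) = n" "c < n"
    and many: "max (f_edges n (k + 1) c) (f_edges n (c div 2) c) < card (edges G)"
  obtains s p where "is_clique_book n (c + 1 - k) s p (C_closure G C)"
    "p = 1 \<and> s = k \<or> p = k - 1 \<and> s = 2" "2 \<le> k" "2 * k + 2 \<le> c"
proof -
  interpret G: bounded_circumference "verts G" "edges G" c
    using bounded_circumference_if_longest_cycle[OF G(1,2) C(1)] C(2) by simp
  obtain F where sub: "edges G \<subseteq> F" and F: "edge_maximal (verts G) F c"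
    using G.ex_edge_maximal by blast
  interpret F: edge_maximal "verts G" F c by (rule F)
  note deg_G = degree_ge_if_min_degree_ge[OF G(1,3)]
  have deg: "k \<le> card (nbrs F v)" if "v \<in> verts G" for v
    using deg_G[OF that] card_mono[OF F.fin_nbrs nbrs_mono[OF sub]] by (rule le_trans)
  have "card (edges G) \<le> card F"
    using sub finite_subset[OF F.edges_V finite_all_pairs[OF G.finite_V]] by (intro card_mono)
  with many have "max (f_edges n (k + 1) c) (f_edges n (c div 2) c) < card F" by linarith
  then obtain H where H: "H \<subseteq> verts G" "clique F H" "card H = c + 1 - k" "2 \<le> k" "k < c div 2"
    "card F \<le> f_edges n k c"
    using F.large_clique_of_many_edges[OF _ deg] n by blast
  have ck: "2 * k + 2 \<le> c" using H(5) by linarith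
  interpret H: circumference_clique "verts G" F c H k
    using H deg n ck by unfold_locales auto
  have "cycle_in (edges G) C" using C(1) by (simp add: longest_cycle_def is_cycle_iff_cycle_in)
  moreover have "card (F - edges G) + 3 * k + 2 \<le> c"
    using F.few_missing_edges[OF _ _ sub] H(6) many n ck by simp
  ultimately obtain s p where "is_clique_book n (c + 1 - k) s p (C_closure G C)"
    "p = 1 \<and> s = k \<or> p = k - 1 \<and> s = 2"
    using H.C_closure_is_clique_book[OF G(1) refl sub deg_G _ C(2)] n(1) by blast
  then show thesis using that H(4) ck by blast
qed

theorem theorem1p9:
  fixes G :: "'a ugraph" and C :: "'a list" and n k c :: nat
  assumes "simple_graph G" and "card (verts G) = n"
    and "two_connected G"
    and "min_degree G \<ge> k"
    and "longest_cycle G C" and "length C = c"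
    and "c \<in> {10..n - 1}"
    and "card (edges G) > max (f_edges n (k + 1) c) (f_edges n (c div 2) c)"
  shows "graph_iso (C_closure G C) (W_graph n k c) \<or> graph_iso (C_closure G C) (Z_graph n k c)"
proof -
  have c: "c < n" using assms(7) by auto
  obtain s p where book: "is_clique_book n (c + 1 - k) s p (C_closure G C)"
    and sp: "p = 1 \<and> s = k \<or> p = k - 1 \<and> s = 2" and k: "2 \<le> k" "2 * k + 2 \<le> c"
    using closure_of_many_edges[OF assms(1,3-6,2) c] assms(8) by blast
  have "k \<le> c + 1 - k" "2 \<le> c + 1 - k" "0 < p" using k sp by auto
  moreover note is_clique_book_dvd[OF book]
  ultimately have "is_clique_book n (c + 1 - k) s p (W_graph n k c) \<or>
      is_clique_book n (c + 1 - k) s p (Z_graph n k c)"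
    using sp is_clique_book_W_graph[OF _ c] is_clique_book_Z_graph[OF k(1) _ c] by auto
  then show ?thesis using graph_iso_if_is_clique_book[OF book _ \<open>0 < p\<close>] by blast
qed

end
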